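(* Let $\beta>1$ be a real number and let $T_\beta\colon[0,1]\to[0,1]$, $T_\beta(x)=\beta x\bmod 1$. If $\mu$ is a $T_\beta$-invariant Borel probability measure on $[0,1]$, then the set of $x\in[0,1]$ which generate $\mu$ is $\mathbf{\Pi}^0_3$-complete, and the set $I(T_\beta)$ of points $x\in[0,1]$ with irregular $\beta$-expansion is $\mathbf{\Sigma}^0_3$-complete.
   Context: Here $\beta x\bmod 1=\beta x-\lfloor\beta x\rfloor$. A Borel probability measure $\mu$ on $[0,1]$ is $T_\beta$-invariant if $\mu(B)=\mu(T_\beta^{-1}(B))$ for all Borel $B\subseteq[0,1]$. A point $x\in[0,1]$ generates $\mu$ if for every interval $I\subseteq[0,1]$ with $\mu(\partial I)=0$ (boundary taken in $[0,1]$) one has $\lim_{N\to\infty}\frac1N|\{0\le n<N: T_\beta^n(x)\in I\}|=\mu(I)$. The $\beta$-expansion of $x\in[0,1]$ is the sequence $\iota_\beta(x)=d_1d_2\ldots$ with digits $d_i=\lfloor\beta T_\beta^{i-1}(x)\rfloor\in\{0,1,\ldots,\lfloor\beta\rfloor\}$ for $i\ge1$. The point $x$ has irregular $\beta$-expansion if there is a nonempty finite block $w=w_1\ldots w_k$ of digits for which $\frac1N|\{1\le i\le N: d_i d_{i+1}\ldots d_{i+k-1}=w\}|$ does not converge as $N\to\infty$. In $[0,1]$: $\mathbf{\Sigma}^0_1$ = open sets, $\mathbf{\Pi}^0_k$ = complements of $\mathbf{\Sigma}^0_k$ sets, $\mathbf{\Sigma}^0_{k+1}$ = countable unions of $\mathbf{\Pi}^0_k$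 sets. A set is $\mathbf{\Pi}^0_3$-complete if it is in $\mathbf{\Pi}^0_3\setminus\mathbf{\Sigma}^0_3$, and $\mathbf{\Sigma}^0_3$-complete if it is in $\mathbf{\Sigma}^0_3\setminus\mathbf{\Pi}^0_3$. *)

theory Defs
  imports "HOL-Probability.Probability"
begin

text \<open>
  \<open>Sigma0 X k\<close> and \<open>Pi0 X k\<close> are the finite levels of the Borel hierarchy of subsets of the
  space \<open>X\<close>, for \<open>k \<ge> 1\<close>. Level 0 does not exist and is set to a dummy value.
\<close>

fun Sigma0 :: "'a topology \<Rightarrow> nat \<Rightarrow> 'a set set" where
  "Sigma0 X 0 = {}"
| "Sigma0 X (Suc 0) = {U. openin X U}"
| "Sigma0 X (Suc (Suc k)) =
     {\<Union>\<A> |\<A>. countable \<A> \<and> \<A> \<subseteq> {topspace X - S |S. S \<in> Sigma0 X (Suc k)}}"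

definition Pi0 :: "'a topology \<Rightarrow> nat \<Rightarrow> 'a set set" where
  "Pi0 X k = {topspace X - S |S. S \<in> Sigma0 X k}"

definition Pi03_complete :: "'a topology \<Rightarrow> 'a set \<Rightarrow> bool" where
  "Pi03_complete X A \<longleftrightarrow> A \<in> Pi0 X 3 - Sigma0 X 3"

definition Sigma03_complete :: "'a topology \<Rightarrow> 'a set \<Rightarrow> bool" where
  "Sigma03_complete X A \<longleftrightarrow> A \<in> Sigma0 X 3 - Pi0 X 3"

abbreviation unit_top :: "real topology" where
  "unit_top \<equiv> top_of_set {0..1}"

definition beta_map :: "real \<Rightarrow> real \<Rightarrow> real" where
  "beta_map \<beta> x = frac (\<beta> * x)"

definition borel_prob_unit :: "real measure \<Rightarrow> bool" where
  "borel_prob_unit \<mu> \<longleftrightarrow> prob_space \<mu> \<and> sets \<mu> = sets (restrict_space borel {0..1})"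

definition beta_invariant :: "real \<Rightarrow> real measure \<Rightarrow> bool" where
  "beta_invariant \<beta> \<mu> \<longleftrightarrow>
     (\<forall>B \<in> sets (restrict_space borel {0..1}).
        measure \<mu> B = measure \<mu> {x \<in> {0..1}. beta_map \<beta> x \<in> B})"

definition generates :: "real \<Rightarrow> real measure \<Rightarrow> real \<Rightarrow> bool" where
  "generates \<beta> \<mu> x \<longleftrightarrow>
     (\<forall>I. is_interval I \<and> I \<subseteq> {0..1} \<and> measure \<mu> (unit_top frontier_of I) = 0 \<longrightarrow>
        (\<lambda>N. real (card {n. n < N \<and> (beta_map \<beta> ^^ n) x \<in> I}) / real N)
          \<longlonglongrightarrow> measure \<mu> I)"

text \<open>
  The digits are indexed from 1: \<open>beta_digit \<beta> x i\<close> is \<open>d\<^sub>i\<close> for \<open>i \<ge> 1\<close>.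
\<close>

definition beta_digit :: "real \<Rightarrow> real \<Rightarrow> nat \<Rightarrow> int" where
  "beta_digit \<beta> x i = \<lfloor>\<beta> * (beta_map \<beta> ^^ (i - 1)) x\<rfloor>"

definition irregular_expansion :: "real \<Rightarrow> real \<Rightarrow> bool" where
  "irregular_expansion \<beta> x \<longleftrightarrow>
     (\<exists>w. w \<noteq> [] \<and> set w \<subseteq> {0..\<lfloor>\<beta>\<rfloor>} \<and>
        \<not> convergent (\<lambda>N. real (card {i \<in> {1..N}.
               map (beta_digit \<beta> x) [i..<i + length w] = w}) / real N))"

end

theory Submission
  imports Defs
begin

text \<open>
  For the upper bounds: off the countable set of points whose orbit meets a
  discontinuity of \<open>T\<^sub>\<beta>\<close>, all Birkhoff averages and digit frequencies are continuous, and a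
  countable exceptional set does not matter for \<open>\<Pi>\<^sup>0\<^sub>3\<close>.

  For the lower bounds, a generic point of \<open>\<mu>\<close> is produced without any ergodic theory: \<open>\<mu>\<close> is a limit
  of averages of empirical measures of long orbit segments, because it is invariant, and orbit
  segments can be concatenated in the \<open>\<beta>\<close>-shift after lowering a single digit. Then a binary sequence
  \<open>x\<close>, indexed by pairs (row, column), selects zones in which the digits are replaced by zeros
  (or, if \<open>\<mu>\<close> is the point mass at 0, in which digits of a periodic expansion are inserted); the zone of
  an entry in row \<open>m\<close> occupies a proportion of about \<open>1 / (m + 1)\<close> of the digits up to its
  end. If all rows of \<open>x\<close> are finite, the zones have density 0 and the point still generates \<open>\<mu>\<close>;
  otherwise the average digit oscillates. Finally, the set of all \<open>x\<close> with finite rows is not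
  \<open>\<Sigma>\<^sup>0\<^sub>3\<close>, by a direct fusion argument.
\<close>

section \<open>The third level of the Borel hierarchy\<close>

text \<open>Completeness means lying in one class of the third level and not in the dual one, so
  beside the upper bounds it is enough to realise one set outside the wrong class as a preimage
  under a continuous map from binary sequences to the unit interval. Two obstacles shape that map.
  The measure need not be ergodic, so almost every point may fail to generate it. And digits cannot
  be edited freely: only changes that make tails smaller are always legal, which is why a digit is
  lowered before gluing and why zones are filled with zeros. Measure and digits are linked by an
  identity: the sum of the first \<open>N\<close> digits is \<beta> - 1 times the sum of the first
  \<open>N\<close> orbit points, up to a bounded term. Hence generating a measure and having a
  regular expansion both force the average digit to converge, and one oscillating average refutes
  both. Erasing digits can make it oscillate only if its limit was nonzero, that is, if \<mu> is not
  the point mass at 0; hence the two cases. The insertion used for the point mass also settles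
  irregular expansions, since digits that are nonzero with density 0 are regular.\<close>

lemma diagonal_limit:
  fixes z :: "nat \<Rightarrow> nat \<Rightarrow> 'a"
  assumes mono: "\<And>i. n i < n (Suc i)" and agree: "\<And>i k. k < n i \<Longrightarrow> z (Suc i) k = z i k"
  shows "\<exists>w. \<forall>i. \<forall>k<n i. w k = z i k"
proof -
  have n: "strict_mono n" using mono by (simp add: strict_mono_Suc_iff)
  have stable: "z j k = z i k" if "i \<le> j" "k < n i" for i j k
    using that
  proof (induction j rule: dec_induct)
    case (step j)
    have "n i \<le> n j" using step.hyps n by (simp add: strict_mono_less_eq)
    then show ?case using step agree[of k j] by simp
  qed simp
  \<comment> \<open>The diagonal \<open>\<lambda>k. z (Suc k) k\<close> is a valid choice because a
    strictly increasing \<open>n\<close> satisfies \<open>k < n (Suc k)\<close>, so entry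
    \<open>k\<close> is already settled at stage \<open>Suc k\<close>.\<close>
  have "z (Suc k) k = z i k" if "k < n i" for i k
  proof -
    have "k < n (Suc k)" using seq_suble[OF n, of "Suc k"] by simp
    then show ?thesis using stable[of i "max i (Suc k)" k] stable[of "Suc k" "max i (Suc k)" k] that by simp
  qed
  then show ?thesis by (intro exI[of _ "\<lambda>k. z (Suc k) k"]) auto
qed

text \<open>Diagonalise against a decomposition of \<open>G\<close> into countably many G-delta sets
  \<open>a j\<close>. Stage \<open>j\<close> extends a finite prefix, with no new entries in rows
  below \<open>j\<close>, until no continuation of this kind can reach \<open>a j\<close>. The limit
  sequence has finite rows, so its image lies in \<open>G\<close>, yet it misses every
  \<open>a j\<close>.\<close>

theorem not_Sigma03_reduction:
  fixes \<phi> :: "(nat \<Rightarrow> bool) \<Rightarrow> 'a" and row :: "nat \<Rightarrow> nat"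
  assumes row: "\<And>m. infinite {k. row k = m}"
    and top: "\<And>x. \<phi> x \<in> topspace X"
    and cont: "\<And>U x. openin X U \<Longrightarrow> \<phi> x \<in> U \<Longrightarrow> \<exists>n. \<forall>y. (\<forall>i<n. y i = x i) \<longrightarrow> \<phi> y \<in> U"
    and red: "\<And>x. \<phi> x \<in> G \<longleftrightarrow> (\<forall>m. finite {k. x k \<and> row k = m})"
  shows "G \<notin> Sigma0 X 3"
proof
  assume "G \<in> Sigma0 X 3"
  then obtain \<A> where A: "G = \<Union>\<A>" "countable \<A>" "\<A> \<subseteq> {topspace X - S |S. S \<in> Sigma0 X (Suc (Suc 0))}"
    by (auto simp: numeral_3_eq_3)
  have Gdelta: "\<exists>U. (\<forall>i. openin X (U i)) \<and> topspace X \<inter> (\<Inter>i::nat. U i) = E" if E: "E \<in> \<A>" for E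
  proof -
    obtain S where S: "E = topspace X - S" "S \<in> Sigma0 X (Suc (Suc 0))" using A(3) E by blast
    then obtain \<B> where B: "S = \<Union>\<B>" "countable \<B>" "\<B> \<subseteq> {topspace X - U |U. openin X U}"
      by auto
    show ?thesis
    proof (cases "\<B> = {}")
      case True
      then show ?thesis using S B by (intro exI[of _ "\<lambda>_. topspace X"]) auto
    next
      case False
      then obtain b :: "nat \<Rightarrow> 'a set" where b: "range b = \<B>" using range_from_nat_into[OF _ B(2)] by blast
      have "openin X (topspace X - b i)" for i
      proof -
        have "b i \<in> {topspace X - U |U. openin X U}" using b B(3) by auto
        then show ?thesis by (auto simp: double_diff[OF _ order_refl] openin_subset)
      qed
      moreover have "topspace X \<inter> (\<Inter>i. topspace X - b i) = E"
        using S B b by auto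
      ultimately show ?thesis by (intro exI[of _ "\<lambda>i. topspace X - b i"] conjI allI)
    qed
  qed
  have "\<phi> (\<lambda>_. False) \<in> G" using red by simp
  then have "\<A> \<noteq> {}" using A(1) by auto
  then obtain a :: "nat \<Rightarrow> 'a set" where a: "range a = \<A>" using range_from_nat_into[OF _ A(2)] by blast
  have "\<exists>U. \<forall>j. (\<forall>i. openin X (U j i)) \<and> topspace X \<inter> (\<Inter>i::nat. U j i) = a j"
    using a by (intro choice allI Gdelta) auto
  then obtain U where U: "\<And>i j. openin X (U j i)" "\<And>j. topspace X \<inter> (\<Inter>i::nat. U j i) = a j" by blast
  \<comment> \<open>Continuations of the prefix of length \<open>n\<close> that add nothing to rows
    below \<open>j\<close>. Row \<open>j\<close> itself stays free, and \<open>avoid\<close>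
    exploits this.\<close>
  define Ext where "Ext j n x = {y. (\<forall>k<n. y k = x k) \<and> (\<forall>k\<ge>n. row k < j \<longrightarrow> \<not> y k)}"
    for j n and x :: "nat \<Rightarrow> bool"
  have sub: "a j \<subseteq> G" for j using a A by auto
  \<comment> \<open>Otherwise every prefix reached could still be continued into \<open>a j\<close>.
    Adding one more entry of row \<open>j\<close> each time, while entering \<open>U j 0\<close>,
    \<open>U j 1\<close>, ... in turn, yields a limit sequence with row \<open>j\<close> infinite
    whose image lies in \<open>a j\<close>, a subset of \<open>G\<close>.\<close>
  have avoid: "\<exists>n' x'. n < n' \<and> x' \<in> Ext j n x \<and> (\<forall>y\<in>Ext j n' x'. \<phi> y \<notin> a j)" for j n x
  proof (rule ccontr)
    assume con: "\<not> ?thesis"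
    have step: "\<exists>n'' x''. n' < n'' \<and> x'' \<in> Ext j n x \<and> x'' \<in> Ext j n' x' \<and>
        (\<exists>k\<ge>n'. k < n'' \<and> row k = j \<and> x'' k) \<and> (\<forall>y. (\<forall>k<n''. y k = x'' k) \<longrightarrow> \<phi> y \<in> U j i)"
      if "n < n'" "x' \<in> Ext j n x" for n' x' i
    proof -
      obtain y where y: "y \<in> Ext j n' x'" "\<phi> y \<in> a j" using con \<open>n < n'\<close> \<open>x' \<in> Ext j n x\<close> by blast
      then have "\<phi> y \<in> U j i" using U by blast
      then obtain m where m: "\<And>y'. (\<forall>k<m. y' k = y k) \<Longrightarrow> \<phi> y' \<in> U j i" using cont U(1) by blast
      obtain k where k: "k \<ge> max m n'" "row k = j"
        using row[of j, unfolded infinite_nat_iff_unbounded_le, rule_format, of "max m n'"] by auto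
      \<comment> \<open>The new entry sits beyond the prefix that secures membership in
        \<open>U j i\<close>, and its row \<open>j\<close> is not frozen, so it spoils neither
        condition.\<close>
      define x'' where "x'' = y(k := True)"
      have 1: "x'' \<in> Ext j n' x'" using y k by (auto simp: Ext_def x''_def)
      have 2: "x'' \<in> Ext j n x" using y k that unfolding Ext_def x''_def
        by (auto; metis linorder_not_le order.strict_trans)
      have 3: "\<forall>y'. (\<forall>l<Suc k. y' l = x'' l) \<longrightarrow> \<phi> y' \<in> U j i"
        using k by (intro allI impI m) (auto simp: x''_def)
      have 4: "\<exists>l\<ge>n'. l < Suc k \<and> row l = j \<and> x'' l" "n' < Suc k"
        using k by (auto simp: x''_def intro!: exI[of _ k])
      show ?thesis by (intro exI[of _ "Suc k"] exI[of _ x''] conjI 1 2 3 4)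
    qed
    have "\<exists>f. \<forall>i. (n < fst (f i) \<and> snd (f i) \<in> Ext j n x) \<and> (fst (f i) < fst (f (Suc i)) \<and>
        snd (f (Suc i)) \<in> Ext j (fst (f i)) (snd (f i)) \<and>
        (\<exists>k\<ge>fst (f i). k < fst (f (Suc i)) \<and> row k = j \<and> snd (f (Suc i)) k) \<and>
        (\<forall>y. (\<forall>k<fst (f (Suc i)). y k = snd (f (Suc i)) k) \<longrightarrow> \<phi> y \<in> U j i))"
    proof (rule dependent_nat_choice, goal_cases)
      case 1
      show ?case by (rule exI[of _ "(Suc n, \<lambda>k. k < n \<and> x k)"]) (simp add: Ext_def)
    next
      case (2 p i)
      then obtain n'' x'' where "fst p < n'' \<and> x'' \<in> Ext j n x \<and> x'' \<in> Ext j (fst p) (snd p) \<and>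
        (\<exists>k\<ge>fst p. k < n'' \<and> row k = j \<and> x'' k) \<and> (\<forall>y. (\<forall>k<n''. y k = x'' k) \<longrightarrow> \<phi> y \<in> U j i)"
        using step by blast
      then show ?case using 2 by (intro exI[of _ "(n'',x'')"]) simp
    qed
    then obtain f where f: "\<And>i. fst (f i) < fst (f (Suc i))"
      "\<And>i. snd (f (Suc i)) \<in> Ext j (fst (f i)) (snd (f i))"
      "\<And>i. \<exists>k\<ge>fst (f i). k < fst (f (Suc i)) \<and> row k = j \<and> snd (f (Suc i)) k"
      "\<And>i y. (\<forall>k<fst (f (Suc i)). y k = snd (f (Suc i)) k) \<Longrightarrow> \<phi> y \<in> U j i" by blast
    obtain w where w: "\<And>i k. k < fst (f i) \<Longrightarrow> w k = snd (f i) k"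
      using diagonal_limit[of "\<lambda>i. fst (f i)" "\<lambda>i. snd (f i)"] f(1,2) by (auto simp: Ext_def)
    have "\<phi> w \<in> U j i" for i using w[of _ "Suc i"] by (intro f(4)) auto
    then have "\<phi> w \<in> G" using U(2)[of j] sub top by blast
    then have fin: "finite {k. w k \<and> row k = j}" using red by blast
    have "strict_mono (\<lambda>i. fst (f i))" using f(1) by (simp add: strict_mono_Suc_iff)
    then have le: "i \<le> fst (f i)" for i by (rule seq_suble)
    have "\<exists>k\<ge>i. w k \<and> row k = j" for i
    proof -
      obtain k where k: "fst (f i) \<le> k" "k < fst (f (Suc i))" "row k = j" "snd (f (Suc i)) k"
        using f(3)[of i] by blast
      then show ?thesis using le[of i] w[of k "Suc i"] by (intro exI[of _ k]) simp
    qed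
    then have "infinite {k. w k \<and> row k = j}" by (simp add: infinite_nat_iff_unbounded_le)
    then show False using fin by simp
  qed
  have "\<exists>f. \<forall>j. True \<and> (fst (f j) < fst (f (Suc j)) \<and> snd (f (Suc j)) \<in> Ext j (fst (f j)) (snd (f j)) \<and>
      (\<forall>y\<in>Ext j (fst (f (Suc j))) (snd (f (Suc j))). \<phi> y \<notin> a j))"
  proof (rule dependent_nat_choice, goal_cases)
    case (2 p j)
    obtain n x where "fst p < n \<and> x \<in> Ext j (fst p) (snd p) \<and> (\<forall>y\<in>Ext j n x. \<phi> y \<notin> a j)"
      using avoid[of "fst p" j "snd p"] by blast
    then show ?case by (intro exI[of _ "(n, x)"]) simp
  qed simp
  then obtain f where f: "\<And>j. fst (f j) < fst (f (Suc j))"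
      "\<And>j. snd (f (Suc j)) \<in> Ext j (fst (f j)) (snd (f j))"
      "\<And>j. \<forall>y\<in>Ext j (fst (f (Suc j))) (snd (f (Suc j))). \<phi> y \<notin> a j" by blast
  obtain w where w: "\<And>i k. k < fst (f i) \<Longrightarrow> w k = snd (f i) k"
    using diagonal_limit[of "\<lambda>i. fst (f i)" "\<lambda>i. snd (f i)"] f(1,2) by (auto simp: Ext_def)
  have mono: "strict_mono (\<lambda>i. fst (f i))" using f(1) by (simp add: strict_mono_Suc_iff)
  \<comment> \<open>Such a \<open>k\<close> is settled at a stage \<open>l > j\<close>, which
    freezes all rows below \<open>l\<close> and so all rows up to \<open>j\<close>. This gives
    finite rows and keeps the limit in every \<open>Ext\<close> set for which avoidance was
    arranged.\<close>
  have tail: "\<not> w k" if "fst (f (Suc j)) \<le> k" "row k \<le> j" for j k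
  proof -
    have ex: "\<exists>i. k < fst (f i)"
      using seq_suble[OF mono, of "Suc k"] by (intro exI[of _ "Suc k"]) simp
    define i where "i = (LEAST i. k < fst (f i))"
    have i: "k < fst (f i)" unfolding i_def using ex by (rule LeastI_ex)
    have "Suc j < i"
    proof (rule ccontr)
      assume "\<not> Suc j < i"
      then have "fst (f i) \<le> fst (f (Suc j))" using strict_mono_less_eq[OF mono, of i "Suc j"] by simp
      then show False using i that(1) by simp
    qed
    then obtain l where l: "i = Suc l" "j < l" by (cases i) auto
    have "fst (f l) \<le> k" using not_less_Least[of l "\<lambda>i. k < fst (f i)"] l unfolding i_def by simp
    then have "\<not> snd (f (Suc l)) k" using f(2)[of l] l that(2) unfolding Ext_def by simp
    then show ?thesis using w[of k i] i l by simp
  qed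
  have "finite {k. w k \<and> row k = m}" for m
  proof (rule finite_subset)
    show "{k. w k \<and> row k = m} \<subseteq> {..<fst (f (Suc m))}"
      using tail[of m] by (fastforce simp: not_less[symmetric])
  qed simp
  then have "\<phi> w \<in> G" using red by blast
  then obtain j where "\<phi> w \<in> a j" using A(1) a by auto
  moreover have "w \<in> Ext j (fst (f (Suc j))) (snd (f (Suc j)))"
    unfolding Ext_def
  proof (intro CollectI conjI allI impI)
    show "w k = snd (f (Suc j)) k" if "k < fst (f (Suc j))" for k by (rule w[OF that])
    show "\<not> w k" if "fst (f (Suc j)) \<le> k" "row k < j" for k using tail[of j k] that by simp
  qed
  ultimately show False using f(3) by blast
qed

text \<open>Off \<open>D\<close>, the condition for a fixed \<open>p\<close> is a countable union of
  traces of closed sets \<open>F p M\<close>. Two corrections repair the points of \<open>D\<close>: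
  adding the countable set \<open>A \<inter> D\<close> to each union keeps it F-sigma, and the
  points of \<open>D\<close> outside \<open>A\<close> are removed by intersecting with countably
  many F-sigma sets \<open>X - {d}\<close>.\<close>

lemma Pi03_off_countable:
  fixes X :: "'a::metric_space set"
  assumes D: "countable D"
    and cl: "\<And>p M r. closedin (top_of_set (X - D)) {x \<in> X - D. C p M r x}"
  shows "{x \<in> X. \<forall>p::nat. \<exists>M::nat. \<forall>r::'r. C p M r x} \<in> Pi0 (top_of_set X) 3"
proof -
  let ?X = "top_of_set X"
  define A where "A = {x \<in> X. \<forall>p. \<exists>M. \<forall>r. C p M r x}"
  have "closedin (top_of_set (X - D)) (\<Inter>r. {x \<in> X - D. C p M r x})" for p M
    by (intro closedin_Inter) (use cl in auto)
  then have "\<exists>F. closed F \<and> (\<Inter>r. {x \<in> X - D. C p M r x}) = (X - D) \<inter> F" for p M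
    unfolding closedin_closed by blast
  then have "\<forall>p M. \<exists>F. closed F \<and> (\<Inter>r. {x \<in> X - D. C p M r x}) = (X - D) \<inter> F" by blast
  then obtain F where F: "\<And>p M. closed (F p M)"
    "\<And>p M. (\<Inter>r. {x \<in> X - D. C p M r x}) = (X - D) \<inter> F p M" by metis
  have iff: "x \<in> A \<longleftrightarrow> (\<forall>p. \<exists>M. x \<in> F p M)" if "x \<in> X - D" for x
  proof -
    have "x \<in> F p M \<longleftrightarrow> (\<forall>r. C p M r x)" for p M using F(2)[of p M] that by blast
    then show ?thesis using that unfolding A_def by blast
  qed
  have closed_compl: "S \<in> {X - U |U. openin ?X U}" if "S = X \<inter> K" "closed K" for S K
  proof -
    have "openin ?X (X \<inter> - K)" using that(2) by (intro openin_open_Int) auto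
    then show ?thesis using that(1) by (intro CollectI exI[of _ "X \<inter> - K"]) auto
  qed
  have Fsigma: "(\<Union>i\<in>I. X \<inter> K i) \<in> Sigma0 ?X 2" if "countable I" "\<And>i. i \<in> I \<Longrightarrow> closed (K i)"
    for I :: "('b + 'a) set" and K :: "'b + 'a \<Rightarrow> 'a set"
    unfolding numeral_2_eq_2 Sigma0.simps
    by (intro CollectI exI[of _ "(\<lambda>i. X \<inter> K i) ` I"] conjI)
       (use that closed_compl in auto)
  define E where "E p = (\<Union>i \<in> range Inl \<union> Inr ` (A \<inter> D). X \<inter> case_sum (F p) (\<lambda>d. {d}) i)" for p
  have E: "E p \<in> Sigma0 ?X 2" for p
    unfolding E_def using D F(1) by (intro Fsigma) (auto simp: countable_Un)
  have E_eq: "E p = X \<inter> ((\<Union>M. F p M) \<union> (A \<inter> D))" for p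
    unfolding E_def by auto
  have sing: "X - {d} \<in> Sigma0 ?X 2" if "d \<in> X" for d
  proof -
    have pos: "\<exists>n. 1 / real (Suc n) \<le> dist x d" if "x \<noteq> d" for x
      using that nat_approx_posE[of "dist x d"] by (metis less_imp_le zero_less_dist_iff)
    have "X - {d} = \<Union> (range (\<lambda>n. X \<inter> {x. 1 / real (Suc n) \<le> dist x d}))"
      using pos by (auto simp: not_le)
    moreover have "closed {x. 1 / real (Suc n) \<le> dist x d}" for n
      by (intro closed_Collect_le continuous_intros)
    ultimately show ?thesis
      unfolding numeral_2_eq_2 Sigma0.simps using closed_compl
      by (intro CollectI exI[of _ "range (\<lambda>n. X \<inter> {x. 1 / real (Suc n) \<le> dist x d})"]) auto
  qed
  have "X - A = \<Union> ((\<lambda>p. X - E p) ` UNIV \<union> (\<lambda>d. X - (X - {d})) ` (X \<inter> D - A))"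
  proof (rule set_eqI)
    fix x
    have "x \<in> \<Union> ((\<lambda>p. X - E p) ` UNIV \<union> (\<lambda>d. X - (X - {d})) ` (X \<inter> D - A)) \<longleftrightarrow>
        x \<in> X \<and> ((\<exists>p. x \<notin> E p) \<or> x \<in> D - A)" by auto
    then show "x \<in> X - A \<longleftrightarrow>
        x \<in> \<Union> ((\<lambda>p. X - E p) ` UNIV \<union> (\<lambda>d. X - (X - {d})) ` (X \<inter> D - A))"
      using iff[of x] by (auto simp: E_eq)
  qed
  moreover have "\<Union> ((\<lambda>p. X - E p) ` UNIV \<union> (\<lambda>d. X - (X - {d})) ` (X \<inter> D - A)) \<in> Sigma0 ?X 3"
    unfolding numeral_3_eq_3 Sigma0.simps(3)[of _ "Suc 0"]
  proof (intro CollectI exI[of _ "(\<lambda>p. X - E p) ` UNIV \<union> (\<lambda>d. X - (X - {d})) ` (X \<inter> D - A)"] conjI refl)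
    show "countable ((\<lambda>p. X - E p) ` UNIV \<union> (\<lambda>d. X - (X - {d})) ` (X \<inter> D - A))"
      using D by (simp add: countable_Diff)
    show "(\<lambda>p. X - E p) ` UNIV \<union> (\<lambda>d. X - (X - {d})) ` (X \<inter> D - A)
        \<subseteq> {topspace ?X - S |S. S \<in> Sigma0 ?X (Suc (Suc 0))}"
      using E sing unfolding numeral_2_eq_2 topspace_subtopology by (auto simp del: Sigma0.simps)
  qed
  ultimately have "X - A \<in> Sigma0 ?X 3" by simp
  moreover have "A = X - (X - A)" by (auto simp: A_def)
  ultimately show ?thesis unfolding A_def[symmetric] Pi0_def by auto
qed

section \<open>Generating points and weak convergence\<close>

definition empirical :: "(nat \<Rightarrow> real) \<Rightarrow> nat \<Rightarrow> real measure" where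
  "empirical y N = distr (measure_pmf (pmf_of_set {..<N})) borel y"

text \<open>Stated on the whole line, so that the theory of real distributions applies;
  \<open>distr\<close> transports \<mu> from the unit interval. The index \<open>Suc N\<close> keeps
  the sample set nonempty.\<close>

definition equidistributed :: "real measure \<Rightarrow> (nat \<Rightarrow> real) \<Rightarrow> bool" where
  "equidistributed \<mu> y \<longleftrightarrow>
     weak_conv_m (\<lambda>N. empirical y (Suc N)) (distr \<mu> borel (\<lambda>x. x))"

lemma real_distribution_empirical: "real_distribution (empirical y N)"
  unfolding empirical_def by (rule prob_space.real_distribution_distr) (auto intro: measure_pmf.prob_space_axioms)

lemma integral_empirical:
  assumes "f \<in> borel_measurable borel"
  shows "integral\<^sup>L (empirical y (Suc N)) f = (\<Sum>i<Suc N. f (y i)) / real (Suc N)"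
proof -
  have "integral\<^sup>L (empirical y (Suc N)) f = measure_pmf.expectation (pmf_of_set {..<Suc N}) (\<lambda>i. f (y i))"
    unfolding empirical_def using assms by (subst integral_distr) auto
  also have "\<dots> = (\<Sum>i<Suc N. f (y i)) / real (card {..<Suc N})"
    by (rule integral_pmf_of_set) auto
  finally show ?thesis by simp
qed

lemma measure_empirical:
  assumes "A \<in> sets borel"
  shows "measure (empirical y (Suc N)) A = card {n. n < Suc N \<and> y n \<in> A} / real (Suc N)"
proof -
  have "{..<Suc N} \<inter> y -` A = {n. n < Suc N \<and> y n \<in> A}" by auto
  moreover have "measure (empirical y (Suc N)) A = measure_pmf.prob (pmf_of_set {..<Suc N}) (y -` A)"
    unfolding empirical_def using assms by (subst measure_distr) auto
  moreover have "\<dots> = real (card ({..<Suc N} \<inter> y -` A)) / real (card {..<Suc N})"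
    by (rule measure_pmf_of_set) auto
  ultimately show ?thesis by simp
qed

context
  fixes \<mu> :: "real measure"
  assumes \<mu>: "borel_prob_unit \<mu>"
begin

lemma prob_mu: "prob_space \<mu>" and sets_mu: "sets \<mu> = sets (restrict_space borel {0..1})"
  using \<mu> by (auto simp: borel_prob_unit_def)

lemma space_mu: "space \<mu> = {0..1}"
  using sets_eq_imp_space_eq[OF sets_mu] by (simp add: space_restrict_space)

lemma measurable_mu: "measurable \<mu> N = measurable (restrict_space borel {0..1}) N"
  by (rule measurable_cong_sets[OF sets_mu refl])

lemma measurable_ident_mu: "(\<lambda>x. x) \<in> borel_measurable \<mu>"
  unfolding measurable_mu by (simp add: measurable_restrict_space1)

lemma borel_measurable_mu_continuous:
  fixes f :: "real \<Rightarrow> real"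
  shows "continuous_on {0..1} f \<Longrightarrow> f \<in> borel_measurable \<mu>"
  unfolding measurable_mu by (rule borel_measurable_continuous_on_restrict)

lemma integrable_mu_continuous:
  fixes f :: "real \<Rightarrow> real"
  assumes "continuous_on {0..1} f" shows "integrable \<mu> f"
proof -
  have "bounded (f ` {0..1})"
    using assms by (intro compact_imp_bounded compact_continuous_image) auto
  then obtain B where "\<forall>x\<in>{0..1}. norm (f x) \<le> B" by (auto simp: bounded_iff)
  then show ?thesis
    using prob_mu borel_measurable_mu_continuous[OF assms]
    by (intro finite_measure.integrable_const_bound[of _ _ B])
       (auto simp: prob_space.finite_measure space_mu)
qed

lemma real_distribution_mu: "real_distribution (distr \<mu> borel (\<lambda>x. x))"
  by (rule prob_space.real_distribution_distr[OF prob_mu measurable_ident_mu])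

lemma measure_distr_mu:
  "A \<in> sets borel \<Longrightarrow> measure (distr \<mu> borel (\<lambda>x. x)) A = measure \<mu> (A \<inter> {0..1})"
  by (subst measure_distr) (auto simp: space_mu measurable_ident_mu)

lemma integral_distr_mu:
  fixes f :: "real \<Rightarrow> real"
  shows "f \<in> borel_measurable borel \<Longrightarrow> integral\<^sup>L (distr \<mu> borel (\<lambda>x. x)) f = integral\<^sup>L \<mu> f"
  by (rule integral_distr[OF measurable_ident_mu])

lemma equidistributed_imp_average:
  assumes y: "\<And>i. y i \<in> {0..1}" and eq: "equidistributed \<mu> y" and f: "continuous_on {0..1} f"
  shows "(\<lambda>N. (\<Sum>i<N. f (y i)) / real N) \<longlonglongrightarrow> integral\<^sup>L \<mu> f"
proof -
  \<comment> \<open>Clamping extends \<open>f\<close> to a bounded continuous function on the whole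
    line, as required by the integral form of weak convergence.\<close>
  define g where "g x = f (max 0 (min 1 x))" for x :: real
  have "continuous_on UNIV g"
    unfolding g_def by (intro continuous_on_compose2[OF f] continuous_intros) auto
  then have g: "isCont g x" for x by (simp add: continuous_on_eq_continuous_at)
  have g_meas: "g \<in> borel_measurable borel"
    using \<open>continuous_on UNIV g\<close> by (rule borel_measurable_continuous_onI)
  have "bounded (f ` {0..1})"
    using f by (intro compact_imp_bounded compact_continuous_image) auto
  then obtain B where "\<forall>x\<in>{0..1}. norm (f x) \<le> B" by (auto simp: bounded_iff)
  then have B: "norm (g x) \<le> B" for x by (simp add: g_def)
  have "(\<lambda>N. integral\<^sup>L (empirical y (Suc N)) g) \<longlonglongrightarrow> integral\<^sup>L (distr \<mu> borel (\<lambda>x. x)) g"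
    using eq unfolding equidistributed_def
    by (intro weak_conv_imp_integral_bdd_continuous_conv[OF real_distribution_empirical real_distribution_mu _ g B])
  moreover have "integral\<^sup>L (distr \<mu> borel (\<lambda>x. x)) g = integral\<^sup>L \<mu> f"
    unfolding integral_distr_mu[OF g_meas]
    by (rule Bochner_Integration.integral_cong) (auto simp: space_mu g_def)
  moreover have "integral\<^sup>L (empirical y (Suc N)) g = (\<Sum>i<Suc N. f (y i)) / real (Suc N)" for N
    unfolding integral_empirical[OF g_meas] using y by (auto simp: g_def)
  ultimately have "(\<lambda>N. (\<Sum>i<Suc N. f (y i)) / real (Suc N)) \<longlonglongrightarrow> integral\<^sup>L \<mu> f"
    by simp
  then show ?thesis by (rule LIMSEQ_imp_Suc)
qed

text \<open>Weak convergence can be tested on the ramps \<open>cts_step a b\<close>. Their slope is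
  at most 1 / (b - a) in absolute value, so a factor \<open>b - a\<close> makes them 1-Lipschitz.
  This class of test functions suits the later constructions, because displacements of orbit points
  bound the resulting errors directly.\<close>

lemma equidistributed_if_Lipschitz:
  assumes lip: "\<And>f. 1-lipschitz_on {0..1} f \<Longrightarrow>
      (\<lambda>N. (\<Sum>i<N. f (y i)) / real N) \<longlonglongrightarrow> integral\<^sup>L \<mu> f"
  shows "equidistributed \<mu> y"
  unfolding equidistributed_def
proof (rule integral_cts_step_conv_imp_weak_conv[OF real_distribution_empirical real_distribution_mu])
  fix a b :: real assume ab: "a < b"
  have meas: "cts_step a b \<in> borel_measurable borel"
    unfolding cts_step_def[abs_def] by measurable
  have eq: "cts_step a b x = max 0 (min 1 ((b - x) / (b - a)))" for x
    using ab by (auto simp: cts_step_def max_def min_def field_simps)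
  have "\<bar>cts_step a b u - cts_step a b v\<bar> \<le> \<bar>(b - u) / (b - a) - (b - v) / (b - a)\<bar>" for u v
    unfolding eq by (auto simp: max_def min_def)
  moreover have "\<bar>(b - u) / (b - a) - (b - v) / (b - a)\<bar> * (b - a) = \<bar>u - v\<bar>" for u v
    using ab by (simp add: diff_divide_distrib[symmetric] abs_divide abs_minus_commute)
  ultimately have step: "\<bar>cts_step a b u - cts_step a b v\<bar> * (b - a) \<le> \<bar>u - v\<bar>" for u v
    using ab by (metis mult_right_mono diff_ge_0_iff_ge less_imp_le)
  have "1-lipschitz_on {0..1} (\<lambda>x. (b - a) * cts_step a b x)"
    using step ab
    by (intro lipschitz_onI)
       (auto simp: dist_real_def right_diff_distrib[symmetric] abs_mult mult.commute)
  from lip[OF this] have "(\<lambda>N. (b - a) * ((\<Sum>i<N. cts_step a b (y i)) / real N))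
      \<longlonglongrightarrow> (b - a) * integral\<^sup>L \<mu> (cts_step a b)"
    by (simp add: sum_distrib_left)
  then have "(\<lambda>N. (\<Sum>i<N. cts_step a b (y i)) / real N) \<longlonglongrightarrow> integral\<^sup>L \<mu> (cts_step a b)"
    by (rule tendsto_mult_left_iff[THEN iffD1, rotated]) (use ab in simp)
  from LIMSEQ_Suc[OF this]
  show "(\<lambda>N. integral\<^sup>L (empirical y (Suc N)) (cts_step a b))
      \<longlonglongrightarrow> integral\<^sup>L (distr \<mu> borel (\<lambda>x. x)) (cts_step a b)"
    unfolding integral_empirical[OF meas] integral_distr_mu[OF meas] .
qed

text \<open>Bernstein polynomials form a countable family with dense span in the continuous
  functions, so equidistribution reduces to countably many limits, the shape needed for the Borel
  upper bound.\<close>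

lemma equidistributed_if_Bernstein:
  assumes y: "\<And>i. y i \<in> {0..1}"
    and lim: "\<And>n k. (\<lambda>N. (\<Sum>i<N. Bernstein n k (y i)) / real N) \<longlonglongrightarrow> integral\<^sup>L \<mu> (Bernstein n k)"
  shows "equidistributed \<mu> y"
proof (rule equidistributed_if_Lipschitz)
  fix f :: "real \<Rightarrow> real" assume "1-lipschitz_on {0..1} f"
  then have f: "continuous_on {0..1} f" by (rule lipschitz_on_continuous_on)
  show "(\<lambda>N. (\<Sum>i<N. f (y i)) / real N) \<longlonglongrightarrow> integral\<^sup>L \<mu> f"
  proof (rule LIMSEQ_I)
    fix e :: real assume e: "0 < e"
    obtain n where n: "\<And>x. x \<in> {0..1} \<Longrightarrow> \<bar>f x - (\<Sum>k\<le>n. f (k/n) * Bernstein n k x)\<bar> < e / 3"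
      using Bernstein_Weierstrass[OF f, of "e/3"] e by fastforce
    define p where "p x = (\<Sum>k\<le>n. f (k/n) * Bernstein n k x)" for x
    have p: "continuous_on {0..1} p"
      unfolding p_def Bernstein_def by (intro continuous_intros)
    have Bc: "continuous_on {0..1} (Bernstein n k)" for k
      unfolding Bernstein_def by (intro continuous_intros)
    have "(\<Sum>i<N. p (y i)) / real N = (\<Sum>k\<le>n. f (k/n) * ((\<Sum>i<N. Bernstein n k (y i)) / real N))" for N
      unfolding p_def by (subst sum.swap) (simp add: sum_distrib_left sum_divide_distrib)
    moreover have "integral\<^sup>L \<mu> p = (\<Sum>k\<le>n. f (k/n) * integral\<^sup>L \<mu> (Bernstein n k))"
      unfolding p_def by (simp add: integrable_mu_continuous[OF Bc])
    moreover have "(\<lambda>N. \<Sum>k\<le>n. f (k/n) * ((\<Sum>i<N. Bernstein n k (y i)) / real N))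
        \<longlonglongrightarrow> (\<Sum>k\<le>n. f (k/n) * integral\<^sup>L \<mu> (Bernstein n k))"
      by (intro tendsto_sum tendsto_mult tendsto_const lim)
    ultimately have "(\<lambda>N. (\<Sum>i<N. p (y i)) / real N) \<longlonglongrightarrow> integral\<^sup>L \<mu> p"
      by (simp only:)
    then obtain M where M: "\<And>N. N \<ge> M \<Longrightarrow> \<bar>(\<Sum>i<N. p (y i)) / real N - integral\<^sup>L \<mu> p\<bar> < e / 3"
      using LIMSEQ_D[of _ _ "e/3"] e by fastforce
    have avg: "\<bar>(\<Sum>i<N. f (y i)) / real N - (\<Sum>i<N. p (y i)) / real N\<bar> \<le> e / 3" for N
    proof -
      have "\<bar>\<Sum>i<N. f (y i) - p (y i)\<bar> \<le> (\<Sum>i<N. \<bar>f (y i) - p (y i)\<bar>)" by (rule sum_abs)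
      also have "\<dots> \<le> (\<Sum>i<N. e / 3)" using n[OF y] by (intro sum_mono) (simp add: p_def less_imp_le)
      finally show ?thesis
        using e by (cases "N = 0") (simp_all add: diff_divide_distrib[symmetric] sum_subtractf field_simps)
    qed
    have "\<bar>integral\<^sup>L \<mu> f - integral\<^sup>L \<mu> p\<bar> = \<bar>integral\<^sup>L \<mu> (\<lambda>x. f x - p x)\<bar>"
      by (simp add: integrable_mu_continuous f p)
    also have "\<dots> \<le> integral\<^sup>L \<mu> (\<lambda>x. \<bar>f x - p x\<bar>)" by (rule integral_abs_bound)
    also have "\<dots> \<le> integral\<^sup>L \<mu> (\<lambda>x. e / 3)"
      using n by (intro integral_mono integrable_mu_continuous continuous_intros f p)
        (auto simp: space_mu p_def less_imp_le)
    also have "\<dots> = e / 3" by (simp add: prob_space.prob_space[OF prob_mu])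
    finally have int: "\<bar>integral\<^sup>L \<mu> f - integral\<^sup>L \<mu> p\<bar> \<le> e / 3" .
    have "norm ((\<Sum>i<N. f (y i)) / real N - integral\<^sup>L \<mu> f) < e" if "N \<ge> M" for N
      using M[OF that] avg[of N] int unfolding real_norm_def by linarith
    then show "\<exists>M. \<forall>N\<ge>M. norm ((\<Sum>i<N. f (y i)) / real N - integral\<^sup>L \<mu> f) < e" by blast
  qed
qed

text \<open>An interval such as \<open>{0..a}\<close> has 0 in its boundary on the line, but for
  \<open>a > 0\<close> not in its boundary relative to the unit interval. The preimage under
  clamping extends past the endpoints 0 and 1 and so has no such artificial boundary points.\<close>

lemma frontier_clamp_vimage:
  fixes I :: "real set"
  defines "r \<equiv> \<lambda>x::real. max 0 (min 1 x)"
  assumes "I \<subseteq> {0..1}"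
  shows "frontier (r -` I) \<inter> {0..1} \<subseteq> unit_top frontier_of I"
proof
  fix x assume x: "x \<in> frontier (r -` I) \<inter> {0..1}"
  have r: "continuous_on UNIV r" unfolding r_def by (intro continuous_intros)
  have rx: "r x = x" using x by (auto simp: r_def)
  have "r -` I \<subseteq> r -` closure I" using closure_subset by auto
  moreover have "closed (r -` closure I)" using r by (simp add: continuous_on_closed_vimage)
  ultimately have "x \<in> closure I"
    using x rx closure_minimal[of "r -` I" "r -` closure I"] by (auto simp: frontier_def)
  then have 1: "x \<in> unit_top closure_of I"
    using x assms(2) by (simp add: closure_of_subtopology Int_absorb1)
  have "x \<notin> unit_top interior_of I"
  proof
    assume "x \<in> unit_top interior_of I"
    then obtain V where V: "openin unit_top V" "x \<in> V" "V \<subseteq> I" by (auto simp: interior_of_def)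
    then obtain W where W: "open W" "V = {0..1} \<inter> W" by (auto simp: openin_open)
    have "r u \<in> {0..1}" for u by (auto simp: r_def)
    then have "r -` W \<subseteq> r -` I" using V(3) W(2) by blast
    moreover have "open (r -` W)" using r W by (simp add: continuous_on_open_vimage)
    moreover have "x \<in> r -` W" using V W rx by auto
    ultimately have "x \<in> interior (r -` I)" by (meson interior_maximal subsetD)
    then show False using x by (simp add: frontier_def)
  qed
  then show "x \<in> unit_top frontier_of I" using 1 by (simp add: frontier_of_def)
qed

text \<open>In one direction the intervals \<open>{0..a}\<close> give convergence of distribution
  functions: continuity at \<open>a\<close> says that \<open>a\<close>, the only possible relative
  boundary point, has mass 0. In the other, the criterion for sets with null boundary is applied to
  the clamped preimage of the interval.\<close>

lemma generates_iff_equidistributed: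
  assumes y: "\<And>n. (beta_map \<beta> ^^ n) x \<in> {0..1}"
  shows "generates \<beta> \<mu> x \<longleftrightarrow> equidistributed \<mu> (\<lambda>n. (beta_map \<beta> ^^ n) x)"
proof
  let ?y = "\<lambda>n. (beta_map \<beta> ^^ n) x"
  let ?M = "distr \<mu> borel (\<lambda>x. x)"
  interpret M: real_distribution ?M by (rule real_distribution_mu)
  assume gen: "generates \<beta> \<mu> x"
  show "equidistributed \<mu> ?y"
    unfolding equidistributed_def weak_conv_m_def weak_conv_def
  proof (intro allI impI)
    fix a assume a: "isCont (cdf ?M) a"
    consider "a < 0" | "a \<ge> 1" | "0 \<le> a" "a < 1" by linarith
    then show "(\<lambda>n. cdf (empirical ?y (Suc n)) a) \<longlonglongrightarrow> cdf ?M a"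
    proof cases
      case 1
      then have "{..a} \<inter> {0..1} = {}" by auto
      moreover have "\<not> ?y n \<le> a" for n using y[of n] 1 by auto
      ultimately show ?thesis by (simp add: cdf_def measure_distr_mu measure_empirical)
    next
      case 2
      then have "{..a} \<inter> {0..1} = {0..1}" by auto
      moreover have "?y n \<le> a" for n using y[of n] 2 by auto
      ultimately show ?thesis
        using prob_space.prob_space[OF prob_mu] by (simp add: cdf_def measure_distr_mu measure_empirical space_mu)
    next
      case 3
      have I: "{..a} \<inter> {0..1} = {0..a}" using 3 by auto
      have "unit_top frontier_of {0..a} \<subseteq> {a}"
      proof -
        have "{0..<a} \<subseteq> unit_top interior_of {0..a}"
          using 3 by (intro interior_of_maximal) (auto simp: openin_open intro!: exI[of _ "{..<a}"])
        moreover have "unit_top closure_of {0..a} \<subseteq> {0..a}"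
          using 3 by (intro closure_of_minimal) (auto simp: closedin_closed intro!: exI[of _ "{0..a}"])
        moreover have "{0..a} - {0..<a} \<subseteq> {a}" by auto
        ultimately show ?thesis unfolding frontier_of_def by blast
      qed
      then have "measure \<mu> (unit_top frontier_of {0..a}) \<le> measure \<mu> {a}"
        using 3 prob_mu by (intro finite_measure.finite_measure_mono)
          (auto simp: prob_space.finite_measure sets_mu sets_restrict_space_iff)
      also have "\<dots> = 0" using a measure_distr_mu[of "{a}"] 3 by (simp add: M.isCont_cdf)
      finally have "measure \<mu> (unit_top frontier_of {0..a}) = 0" by (simp add: measure_le_0_iff)
      moreover have "is_interval {0..a}" "{0..a} \<subseteq> {0..1}" using 3 by (auto simp: is_interval_cc)
      ultimately have "(\<lambda>N. real (card {n. n < N \<and> ?y n \<in> {0..a}}) / real N) \<longlonglongrightarrow> measure \<mu> {0..a}"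
        using gen unfolding generates_def by blast
      from LIMSEQ_Suc[OF this] show ?thesis
        using y I 3 by (simp add: cdf_def measure_distr_mu measure_empirical)
    qed
  qed
next
  let ?y = "\<lambda>n. (beta_map \<beta> ^^ n) x"
  let ?M = "distr \<mu> borel (\<lambda>x. x)"
  let ?r = "\<lambda>x::real. max 0 (min 1 x)"
  assume eq: "equidistributed \<mu> ?y"
  interpret M: real_distribution ?M by (rule real_distribution_mu)
  show "generates \<beta> \<mu> x"
    unfolding generates_def
  proof (intro allI impI, elim conjE)
    fix I :: "real set" assume I: "is_interval I" "I \<subseteq> {0..1}" "measure \<mu> (unit_top frontier_of I) = 0"
    define J where "J = ?r -` I"
    have [measurable]: "?r \<in> borel_measurable borel" by measurable
    have "I \<in> sets borel" using I(1) by (rule real_interval_borel_measurable)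
    then have J: "J \<in> sets borel" unfolding J_def by (metis measurable_sets_borel \<open>?r \<in> borel_measurable borel\<close>)
    have "u \<in> J \<longleftrightarrow> u \<in> I" if "u \<in> {0..1}" for u
    proof -
      have "?r u = u" using that by auto
      then show ?thesis by (simp only: J_def vimage_eq)
    qed
    then have JI: "J \<inter> {0..1} = I" using I(2) by blast
    have cl: "closed (unit_top frontier_of I)"
      by (rule closedin_closed_trans[OF closedin_frontier_of]) simp
    have "measure ?M (frontier J) = measure \<mu> (frontier J \<inter> {0..1})"
      by (intro measure_distr_mu) auto
    also have "\<dots> \<le> measure \<mu> (unit_top frontier_of I)"
      using frontier_clamp_vimage[OF I(2)] prob_mu cl frontier_of_subset_topspace[of unit_top I]
      by (intro finite_measure.finite_measure_mono)
        (auto simp: J_def prob_space.finite_measure sets_mu sets_restrict_space_iff)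
    finally have "measure ?M (frontier J) = 0" using I(3) by (simp add: measure_le_0_iff)
    then have "emeasure ?M (frontier J) = 0" by (simp add: M.emeasure_eq_measure)
    then have "(\<lambda>n. measure (empirical ?y (Suc n)) J) \<longlonglongrightarrow> measure ?M J"
      using eq J unfolding equidistributed_def
      by (intro weak_conv_imp_continuity_set_conv[OF real_distribution_empirical real_distribution_mu])
    moreover have "?y n \<in> J \<longleftrightarrow> ?y n \<in> I" for n using y[of n] JI by blast
    ultimately have "(\<lambda>N. real (card {n. n < Suc N \<and> ?y n \<in> I}) / real (Suc N)) \<longlonglongrightarrow> measure \<mu> I"
      using J JI by (simp add: measure_distr_mu measure_empirical)
    then show "(\<lambda>N. real (card {n. n < N \<and> ?y n \<in> I}) / real N) \<longlonglongrightarrow> measure \<mu> I"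
      by (rule LIMSEQ_imp_Suc)
  qed
qed

end

section \<open>Borel class of sets of pointwise convergence\<close>

lemma Pi03_pointwise_limit:
  fixes h :: "nat \<Rightarrow> nat \<Rightarrow> 'a::metric_space \<Rightarrow> real"
  assumes D: "countable D" and h: "\<And>j N. continuous_on (X - D) (h j N)"
  shows "{x \<in> X. \<forall>j. (\<lambda>N. h j N x) \<longlonglongrightarrow> c j} \<in> Pi0 (top_of_set X) 3"
proof -
  \<comment> \<open>The code \<open>p\<close> merges the index \<open>j\<close> with a tolerance 1 /
    Suc e, which brings simultaneous convergence into the form: for all \<open>p\<close> there is
    \<open>M\<close> such that for all \<open>N\<close>. The non-strict inequality makes each
    condition closed.\<close>
  define C where "C p M N x \<longleftrightarrow> (case prod_decode p of (j, e) \<Rightarrow> N \<ge> M \<longrightarrow> \<bar>h j N x - c j\<bar> \<le> 1 / Suc e)"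
    for p M N x
  have "closedin (top_of_set (X - D)) {x \<in> X - D. C p M N x}" for p M N
  proof -
    obtain j e where p: "prod_decode p = (j, e)" by (cases "prod_decode p")
    have "closedin (top_of_set (X - D)) ((X - D) \<inter> h j N -` cball (c j) (1 / Suc e))"
      by (intro continuous_closedin_preimage h) auto
    moreover have "(X - D) \<inter> h j N -` cball (c j) (1 / Suc e) = {x \<in> X - D. \<bar>h j N x - c j\<bar> \<le> 1 / Suc e}"
      by (auto simp: dist_real_def)
    moreover have "closedin (top_of_set (X - D)) {x \<in> X. x \<notin> D}"
      using closedin_topspace[of "top_of_set (X - D)"] by (simp add: set_diff_eq)
    ultimately show ?thesis by (cases "N \<ge> M") (simp_all add: C_def p)
  qed
  note Pi03_off_countable[where C = C, OF D this]
  moreover have "(\<forall>j. (\<lambda>N. h j N x) \<longlonglongrightarrow> c j) \<longleftrightarrow> (\<forall>p. \<exists>M. \<forall>N. C p M N x)" for x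
  proof
    assume lim: "\<forall>j. (\<lambda>N. h j N x) \<longlonglongrightarrow> c j"
    show "\<forall>p. \<exists>M. \<forall>N. C p M N x"
    proof
      fix p obtain j e where p: "prod_decode p = (j, e)" by (cases "prod_decode p")
      from lim[THEN spec, of j] have "\<exists>M. \<forall>N\<ge>M. norm (h j N x - c j) < 1 / Suc e"
        by (rule LIMSEQ_D) simp
      then show "\<exists>M. \<forall>N. C p M N x" unfolding C_def p prod.case real_norm_def by (meson less_imp_le)
    qed
  next
    assume C: "\<forall>p. \<exists>M. \<forall>N. C p M N x"
    show "\<forall>j. (\<lambda>N. h j N x) \<longlonglongrightarrow> c j"
    proof (intro allI LIMSEQ_I)
      fix j and r :: real assume "0 < r"
      then obtain e where e: "1 / Suc e < r" by (rule nat_approx_posE)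
      from C[THEN spec, of "prod_encode (j, e)"] obtain M where
        "\<And>N. N \<ge> M \<Longrightarrow> \<bar>h j N x - c j\<bar> \<le> 1 / Suc e" by (auto simp: C_def)
      then show "\<exists>M. \<forall>N\<ge>M. norm (h j N x - c j) < r" using e by (auto intro: le_less_trans)
    qed
  qed
  ultimately show ?thesis by simp
qed

lemma Pi03_pointwise_convergent:
  fixes h :: "nat \<Rightarrow> nat \<Rightarrow> 'a::metric_space \<Rightarrow> real"
  assumes D: "countable D" and h: "\<And>j N. continuous_on (X - D) (h j N)"
  shows "{x \<in> X. \<forall>j. convergent (\<lambda>N. h j N x)} \<in> Pi0 (top_of_set X) 3"
proof -
  \<comment> \<open>No limit is prescribed here, so the Cauchy condition is used; \<open>r\<close>
    ranges over pairs of times.\<close>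
  define C where "C p M r x \<longleftrightarrow> (case prod_decode p of (j, e) \<Rightarrow>
      fst r \<ge> M \<longrightarrow> snd r \<ge> M \<longrightarrow> \<bar>h j (fst r) x - h j (snd r) x\<bar> \<le> 1 / Suc e)"
    for p M r x
  have "closedin (top_of_set (X - D)) {x \<in> X - D. C p M r x}" for p M r
  proof -
    obtain j e where p: "prod_decode p = (j, e)" by (cases "prod_decode p")
    have "closedin (top_of_set (X - D)) ((X - D) \<inter> (\<lambda>x. h j (fst r) x - h j (snd r) x) -` cball 0 (1 / Suc e))"
      by (intro continuous_closedin_preimage continuous_intros h) auto
    moreover have "(X - D) \<inter> (\<lambda>x. h j (fst r) x - h j (snd r) x) -` cball 0 (1 / Suc e)
        = {x \<in> X - D. \<bar>h j (fst r) x - h j (snd r) x\<bar> \<le> 1 / Suc e}"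
      by (auto simp: dist_real_def)
    moreover have "closedin (top_of_set (X - D)) {x \<in> X. x \<notin> D}"
      using closedin_topspace[of "top_of_set (X - D)"] by (simp add: set_diff_eq)
    ultimately show ?thesis by (cases "fst r \<ge> M"; cases "snd r \<ge> M") (simp_all add: C_def p)
  qed
  note Pi03_off_countable[where C = C, OF D this]
  moreover have "(\<forall>j. convergent (\<lambda>N. h j N x)) \<longleftrightarrow> (\<forall>p. \<exists>M. \<forall>r. C p M r x)" for x
  proof
    assume lim: "\<forall>j. convergent (\<lambda>N. h j N x)"
    show "\<forall>p. \<exists>M. \<forall>r. C p M r x"
    proof
      fix p obtain j e where p: "prod_decode p = (j, e)" by (cases "prod_decode p")
      from lim have "Cauchy (\<lambda>N. h j N x)" by (auto intro: convergent_Cauchy)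
      from CauchyD[OF this, of "1 / Suc e"]
      have "\<exists>M. \<forall>m\<ge>M. \<forall>n\<ge>M. norm (h j m x - h j n x) < 1 / Suc e" by simp
      then show "\<exists>M. \<forall>r. C p M r x" unfolding C_def p prod.case real_norm_def by (meson less_imp_le)
    qed
  next
    assume C: "\<forall>p. \<exists>M. \<forall>r. C p M r x"
    show "\<forall>j. convergent (\<lambda>N. h j N x)"
    proof (intro allI Cauchy_convergent CauchyI)
      fix j and r :: real assume "0 < r"
      then obtain e where e: "1 / Suc e < r" by (rule nat_approx_posE)
      from C[THEN spec, of "prod_encode (j, e)"] obtain M where
        "\<And>m n. m \<ge> M \<Longrightarrow> n \<ge> M \<Longrightarrow> \<bar>h j m x - h j n x\<bar> \<le> 1 / Suc e" by (auto simp: C_def)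
      then show "\<exists>M. \<forall>m\<ge>M. \<forall>n\<ge>M. norm (h j m x - h j n x) < r" using e by (auto intro: le_less_trans)
    qed
  qed
  ultimately show ?thesis by (simp only:)
qed

section \<open>Upper bounds: orbits and digits away from the discontinuities\<close>

lemma beta_orbit_unit: "x \<in> {0..1} \<Longrightarrow> (beta_map \<beta> ^^ n) x \<in> {0..1}"
  by (cases n) (simp_all add: beta_map_def frac_lt_1 less_imp_le)

definition discontinuities :: "real \<Rightarrow> real set" where
  "discontinuities \<beta> = {x. \<exists>n. \<beta> * (beta_map \<beta> ^^ n) x \<in> \<int>}"

lemma countable_discontinuities:
  assumes "\<beta> \<noteq> 0"
  shows "countable (discontinuities \<beta>)"
proof -
  have pre: "countable {x. beta_map \<beta> x \<in> C}" if "countable C" for C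
  proof (rule countable_subset)
    show "{x. beta_map \<beta> x \<in> C} \<subseteq> (\<lambda>(c, j). (c + of_int j) / \<beta>) ` (C \<times> UNIV)"
    proof
      fix x assume "x \<in> {x. beta_map \<beta> x \<in> C}"
      moreover have "x = (beta_map \<beta> x + of_int \<lfloor>\<beta> * x\<rfloor>) / \<beta>"
        using assms by (simp add: beta_map_def frac_def)
      ultimately show "x \<in> (\<lambda>(c, j). (c + of_int j) / \<beta>) ` (C \<times> UNIV)"
        by (intro image_eqI[of _ _ "(beta_map \<beta> x, \<lfloor>\<beta> * x\<rfloor>)"]) auto
    qed
    show "countable ((\<lambda>(c, j). (c + of_int j) / \<beta>) ` (C \<times> (UNIV :: int set)))" using that by auto
  qed
  have orbit: "countable {x. (beta_map \<beta> ^^ n) x \<in> C}" if "countable C" for n C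
    using that
  proof (induction n arbitrary: C)
    case (Suc n)
    then show ?case using Suc.IH[OF pre[OF Suc.prems]] by simp
  qed simp
  have "countable {x. \<beta> * x \<in> \<int>}"
    by (rule countable_subset[of _ "(\<lambda>j. of_int j / \<beta>) ` UNIV"])
      (use assms in \<open>auto elim!: Ints_cases simp: image_iff field_simps\<close>)
  from orbit[OF this] show ?thesis
    unfolding discontinuities_def by (simp add: Collect_ex_eq)
qed

lemma isCont_beta_orbit:
  assumes "x \<notin> discontinuities \<beta>"
  shows "isCont (beta_map \<beta> ^^ n) x"
proof (induction n)
  case (Suc n)
  have "\<beta> * (beta_map \<beta> ^^ n) x \<notin> \<int>" using assms by (auto simp: discontinuities_def)
  then have "isCont (\<lambda>x. frac (\<beta> * (beta_map \<beta> ^^ n) x)) x"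
    using isCont_o2[OF _ continuous_frac, of x "\<lambda>x. \<beta> * (beta_map \<beta> ^^ n) x"] Suc
    by (auto intro: continuous_intros)
  then show ?case by (simp add: beta_map_def[abs_def] comp_def)
qed (simp add: id_def)

lemma eventually_beta_digit_eq:
  assumes "x \<notin> discontinuities \<beta>"
  shows "\<forall>\<^sub>F x' in nhds x. beta_digit \<beta> x' i = beta_digit \<beta> x i"
proof -
  have "isCont (\<lambda>x. \<beta> * (beta_map \<beta> ^^ (i - 1)) x) x"
    using isCont_beta_orbit[OF assms] by (intro continuous_intros)
  then have "((\<lambda>x. \<beta> * (beta_map \<beta> ^^ (i - 1)) x) \<longlongrightarrow> \<beta> * (beta_map \<beta> ^^ (i - 1)) x) (nhds x)"
    using tendsto_at_iff_tendsto_nhds[of "\<lambda>x. \<beta> * (beta_map \<beta> ^^ (i - 1)) x" x] by (simp add: isCont_def)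
  moreover have "\<beta> * (beta_map \<beta> ^^ (i - 1)) x \<notin> \<int>" using assms by (auto simp: discontinuities_def)
  ultimately show ?thesis unfolding beta_digit_def by (rule eventually_floor_eq)
qed

lemma generating_set_Pi03:
  assumes \<beta>: "\<beta> > 1" and \<mu>: "borel_prob_unit \<mu>"
  shows "{x \<in> {0..1}. generates \<beta> \<mu> x} \<in> Pi0 unit_top 3"
proof -
  define c where "c j = integral\<^sup>L \<mu> (case prod_decode j of (n, k) \<Rightarrow> Bernstein n k)" for j
  define h where "h j N x = (\<Sum>i<N. (case prod_decode j of (n, k) \<Rightarrow> Bernstein n k) ((beta_map \<beta> ^^ i) x)) / real N"
    for j N x
  have "generates \<beta> \<mu> x \<longleftrightarrow> (\<forall>j. (\<lambda>N. h j N x) \<longlonglongrightarrow> c j)" if x: "x \<in> {0..1}" for x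
  proof -
    note y = beta_orbit_unit[OF x, where \<beta> = \<beta>]
    show ?thesis
      unfolding generates_iff_equidistributed[OF \<mu> y]
    proof
      assume eq: "equidistributed \<mu> (\<lambda>n. (beta_map \<beta> ^^ n) x)"
      show "\<forall>j. (\<lambda>N. h j N x) \<longlonglongrightarrow> c j"
        unfolding h_def c_def
        by (intro allI equidistributed_imp_average[OF \<mu> y eq])
          (auto simp: Bernstein_def split: prod.split intro!: continuous_intros)
    next
      assume "\<forall>j. (\<lambda>N. h j N x) \<longlonglongrightarrow> c j"
      then have "(\<lambda>N. h (prod_encode (n, k)) N x) \<longlonglongrightarrow> c (prod_encode (n, k))" for n k by blast
      then show "equidistributed \<mu> (\<lambda>n. (beta_map \<beta> ^^ n) x)"
        by (intro equidistributed_if_Bernstein[OF \<mu> y]) (simp add: h_def c_def)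
    qed
  qed
  then have "{x \<in> {0..1}. generates \<beta> \<mu> x} = {x \<in> {0..1}. \<forall>j. (\<lambda>N. h j N x) \<longlonglongrightarrow> c j}" by blast
  moreover have "continuous_on ({0..1} - discontinuities \<beta>) (h j N)" for j N
  proof -
    have "isCont (h j N) x" if "x \<notin> discontinuities \<beta>" for x
      unfolding h_def Bernstein_def divide_inverse using isCont_beta_orbit[OF that]
      by (cases "prod_decode j") (auto intro!: continuous_intros)
    then show ?thesis by (intro continuous_at_imp_continuous_on) auto
  qed
  ultimately show ?thesis
    using Pi03_pointwise_limit[OF countable_discontinuities[of \<beta>], of "{0..1}" h c] \<beta> by simp
qed

lemma regular_set_Pi03:
  assumes \<beta>: "\<beta> > 1"
  shows "{x \<in> {0..1}. \<not> irregular_expansion \<beta> x} \<in> Pi0 unit_top 3"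
proof -
  define fr where "fr w N x = real (card {i \<in> {1..N}. map (beta_digit \<beta> x) [i..<i + length w] = w}) / real N"
    for w N x
  define ok where "ok w \<longleftrightarrow> w \<noteq> [] \<and> set w \<subseteq> {0..\<lfloor>\<beta>\<rfloor>}" for w
  \<comment> \<open>Indices that decode to something other than a nonempty block of digits receive
    the constant 0, which converges and thus imposes nothing.\<close>
  define h where "h j N x = (if ok (from_nat j) then fr (from_nat j) N x else 0)" for j N x
  have "isCont (fr w N) x" if x: "x \<notin> discontinuities \<beta>" for w N x
  proof -
    have "\<forall>\<^sub>F x' in nhds x. \<forall>i\<in>{..N + length w}. beta_digit \<beta> x' i = beta_digit \<beta> x i"
      using eventually_beta_digit_eq[OF x] by (intro eventually_ball_finite) auto
    then have "\<forall>\<^sub>F x' in nhds x. fr w N x' = fr w N x"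
    proof eventually_elim
      case (elim x')
      have "map (beta_digit \<beta> x') [i..<i + length w] = map (beta_digit \<beta> x) [i..<i + length w]"
        if "i \<in> {1..N}" for i using elim that by (intro map_cong refl) auto
      then have "{i \<in> {1..N}. map (beta_digit \<beta> x') [i..<i + length w] = w} =
          {i \<in> {1..N}. map (beta_digit \<beta> x) [i..<i + length w] = w}" by (intro Collect_cong) metis
      then show ?case by (simp add: fr_def)
    qed
    then show ?thesis
      by (auto simp: isCont_def tendsto_at_iff_tendsto_nhds intro: tendsto_eventually)
  qed
  then have "isCont (h j N) x" if "x \<notin> discontinuities \<beta>" for j N x
    unfolding h_def using that by (cases "ok (from_nat j)") auto
  then have "continuous_on ({0..1} - discontinuities \<beta>) (h j N)" for j N
    by (intro continuous_at_imp_continuous_on) auto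
  moreover have "\<not> irregular_expansion \<beta> x \<longleftrightarrow> (\<forall>j. convergent (\<lambda>N. h j N x))" for x
  proof
    assume "\<not> irregular_expansion \<beta> x"
    then have reg: "convergent (\<lambda>N. fr w N x)" if "ok w" for w
      using that unfolding irregular_expansion_def fr_def ok_def by blast
    show "\<forall>j. convergent (\<lambda>N. h j N x)"
    proof (intro allI)
      fix j
      show "convergent (\<lambda>N. h j N x)"
        using reg
        by (cases "ok (from_nat j)") (simp_all add: h_def convergent_const)
    qed
  next
    assume conv: "\<forall>j. convergent (\<lambda>N. h j N x)"
    have "convergent (\<lambda>N. fr w N x)" if "ok w" for w
      using conv[THEN spec, of "to_nat w"] that by (simp add: h_def)
    then show "\<not> irregular_expansion \<beta> x"
      unfolding irregular_expansion_def fr_def ok_def by blast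
  qed
  ultimately show ?thesis
    using Pi03_pointwise_convergent[OF countable_discontinuities[of \<beta>], of "{0..1}" h] \<beta> by simp
qed

section \<open>Gluing orbit segments\<close>

text \<open>The interval from \<open>c\<close> to \<open>c + 1 / \<beta> ^ n\<close> is a full
  cylinder of rank \<open>n\<close>: \<open>n\<close> steps of the map stretch it affinely onto
  \<open>{0..<1}\<close>. Every point of \<open>{0..<1}\<close> can therefore serve as
  continuation.\<close>

definition branch :: "real \<Rightarrow> nat \<Rightarrow> real \<Rightarrow> bool" where
  "branch \<beta> n c \<longleftrightarrow> 0 \<le> c \<and> c + 1 / \<beta> ^ n \<le> 1 \<and> (\<forall>y\<in>{0..<1}. (beta_map \<beta> ^^ n) (c + y / \<beta> ^ n) = y)"

text \<open>\<open>\<Phi>\<close> prescribes a Birkhoff sum over \<open>n\<close> steps for each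
  test function. The error is absolute and uniform over all continuations \<open>y\<close>, so
  errors simply add under concatenation.\<close>

definition block :: "real \<Rightarrow> nat \<Rightarrow> ((real \<Rightarrow> real) \<Rightarrow> real) \<Rightarrow> real \<Rightarrow> bool" where
  "block \<beta> n \<Phi> e \<longleftrightarrow> (\<exists>c. branch \<beta> n c \<and> (\<forall>y\<in>{0..<1}. \<forall>f. 1-lipschitz_on {0..1} f \<longrightarrow>
      \<bar>(\<Sum>i<n. f ((beta_map \<beta> ^^ i) (c + y / \<beta> ^ n))) - \<Phi> f\<bar> \<le> e))"

text \<open>The second summand is a potential. If \<open>z\<close> and \<open>x\<close> have the
  same first digit, one step multiplies their distance by \<beta>, and the change of the potential
  exactly compensates the term that leaves the sum. Only a changed digit costs anything.\<close>

definition shadow_sum :: "real \<Rightarrow> nat \<Rightarrow> real \<Rightarrow> real \<Rightarrow> real" where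
  "shadow_sum \<beta> n z x = (\<Sum>i<n. \<bar>(beta_map \<beta> ^^ i) z - (beta_map \<beta> ^^ i) x\<bar>) + \<bar>z - x\<bar> / (\<beta> - 1)"

lemma lipschitz_le:
  fixes f :: "real \<Rightarrow> real"
  assumes "1-lipschitz_on {0..1} f" "x \<in> {0..1}" "y \<in> {0..1}"
  shows "\<bar>f x - f y\<bar> \<le> \<bar>x - y\<bar>"
  using lipschitz_onD[OF assms] by (simp add: dist_real_def)

lemma sum_lessThan_add:
  fixes g :: "nat \<Rightarrow> real"
  shows "(\<Sum>i<m + n. g i) = (\<Sum>i<m. g i) + (\<Sum>i<n. g (m + i))"
  by (induction n) (simp_all add: add.assoc)

section \<open>Full cylinders that shadow a given orbit\<close>

context
  fixes \<beta> :: real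
  assumes \<beta>: "\<beta> > 1"
begin

lemma branch_range:
  assumes "branch \<beta> n c" "y \<in> {0..<1}"
  shows "c + y / \<beta> ^ n \<in> {0..<1}"
proof -
  have "y / \<beta> ^ n < 1 / \<beta> ^ n" using \<beta> assms(2) by (simp add: divide_strict_right_mono)
  moreover have "0 \<le> y / \<beta> ^ n" using \<beta> assms(2) by simp
  ultimately show ?thesis using assms(1) unfolding branch_def by auto
qed

lemma branch_append:
  assumes a: "branch \<beta> m a" and c: "branch \<beta> n c"
  shows "branch \<beta> (m + n) (a + c / \<beta> ^ m)"
  unfolding branch_def
proof (intro conjI ballI)
  have pos: "\<beta> ^ m > 0" "\<beta> ^ n > 0" using \<beta> by simp_all
  show "0 \<le> a + c / \<beta> ^ m" using a c pos by (simp add: branch_def)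
  have "(c + 1 / \<beta> ^ n) / \<beta> ^ m \<le> 1 / \<beta> ^ m"
    using c pos by (intro divide_right_mono) (auto simp: branch_def)
  then show "a + c / \<beta> ^ m + 1 / \<beta> ^ (m + n) \<le> 1"
    using a by (simp add: branch_def power_add add_divide_distrib mult.commute)
  fix y :: real assume y: "y \<in> {0..<1}"
  have eq: "a + c / \<beta> ^ m + y / \<beta> ^ (m + n) = a + (c + y / \<beta> ^ n) / \<beta> ^ m"
    by (simp add: power_add add_divide_distrib mult.commute)
  have "(beta_map \<beta> ^^ (m + n)) (a + (c + y / \<beta> ^ n) / \<beta> ^ m) = (beta_map \<beta> ^^ n) ((beta_map \<beta> ^^ m) (a + (c + y / \<beta> ^ n) / \<beta> ^ m))"
    by (simp add: funpow_add add.commute[of m n])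
  also have "\<dots> = y" using a c y branch_range[OF c y] by (simp add: branch_def)
  finally show "(beta_map \<beta> ^^ (m + n)) (a + c / \<beta> ^ m + y / \<beta> ^ (m + n)) = y" unfolding eq .
qed

lemma beta_map_digit: "y \<in> {0..<1} \<Longrightarrow> beta_map \<beta> ((of_int d + y) / \<beta>) = y"
  using \<beta> by (simp add: beta_map_def frac_unique_iff)

lemma branch_1:
  assumes "0 \<le> d" "of_int d + 1 \<le> \<beta>"
  shows "branch \<beta> 1 (of_int d / \<beta>)"
  unfolding branch_def
proof (intro conjI ballI)
  show "of_int d / \<beta> + 1 / \<beta> ^ 1 \<le> 1" "0 \<le> of_int d / \<beta>"
    using assms \<beta> by (simp_all add: field_simps)
  fix y :: real assume "y \<in> {0..<1}"
  then show "(beta_map \<beta> ^^ 1) (of_int d / \<beta> + y / \<beta> ^ 1) = y"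
    using beta_map_digit[of y d] by (simp add: add_divide_distrib)
qed

text \<open>A full cylinder may be preceded by any nonnegative digit for which the contracted
  interval still ends at or before 1; this numerical test takes the place of lexicographic
  conditions on digits.\<close>

lemma branch_prepend:
  assumes c: "branch \<beta> n c" and d: "0 \<le> d" "(of_int d + (c + 1 / \<beta> ^ n)) / \<beta> \<le> 1"
  shows "branch \<beta> (Suc n) ((of_int d + c) / \<beta>)"
    and "(of_int d + c) / \<beta> + y / \<beta> ^ Suc n = (of_int d + (c + y / \<beta> ^ n)) / \<beta>"
    and "y \<in> {0..<1} \<Longrightarrow> beta_map \<beta> ((of_int d + c) / \<beta> + y / \<beta> ^ Suc n) = c + y / \<beta> ^ n"
proof -
  have eq: "(of_int d + c) / \<beta> + y / \<beta> ^ Suc n = (of_int d + (c + y / \<beta> ^ n)) / \<beta>" for y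
    using \<beta> by (simp add: field_simps)
  have T1: "beta_map \<beta> ((of_int d + c) / \<beta> + y / \<beta> ^ Suc n) = c + y / \<beta> ^ n" if "y \<in> {0..<1}" for y
    unfolding eq by (rule beta_map_digit[OF branch_range[OF c that]])
  show "(of_int d + c) / \<beta> + y / \<beta> ^ Suc n = (of_int d + (c + y / \<beta> ^ n)) / \<beta>" by (rule eq)
  show "beta_map \<beta> ((of_int d + c) / \<beta> + y / \<beta> ^ Suc n) = c + y / \<beta> ^ n" if "y \<in> {0..<1}"
    by (rule T1[OF that])
  show "branch \<beta> (Suc n) ((of_int d + c) / \<beta>)"
    unfolding branch_def
  proof (intro conjI ballI)
    show "0 \<le> (of_int d + c) / \<beta>" using c d \<beta> by (simp add: branch_def)
    show "(of_int d + c) / \<beta> + 1 / \<beta> ^ Suc n \<le> 1" unfolding eq by (rule d(2))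
    fix y :: real assume y: "y \<in> {0..<1}"
    then show "(beta_map \<beta> ^^ Suc n) ((of_int d + c) / \<beta> + y / \<beta> ^ Suc n) = y"
      unfolding funpow_Suc_right comp_def T1[OF y] using c by (simp add: branch_def)
  qed
qed

lemma shadow_sum_Suc: "shadow_sum \<beta> (Suc n) z x =
    shadow_sum \<beta> n (beta_map \<beta> z) (beta_map \<beta> x) + \<bar>z - x\<bar> + (\<bar>z - x\<bar> - \<bar>beta_map \<beta> z - beta_map \<beta> x\<bar>) / (\<beta> - 1)"
  unfolding shadow_sum_def
  by (simp add: sum.lessThan_Suc_shift funpow_swap1 diff_divide_distrib del: sum.lessThan_Suc)

text \<open>The branch follows \<open>x\<close> with the same digits, except that the last nonzero digit among
  the first \<open>n\<close> is decreased by one, which makes room for an arbitrary continuation.\<close>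

lemma shadowing_branch_aux:
  assumes "x \<in> {0..<1}"
  shows "\<exists>c. branch \<beta> n c \<and>
    (c = 0 \<and> (\<forall>y\<in>{0..<1}. shadow_sum \<beta> n (c + y / \<beta> ^ n) x \<le> 1 / (\<beta> - 1)) \<or>
     c + 1 / \<beta> ^ n \<le> x \<and> (\<forall>y\<in>{0..<1}. shadow_sum \<beta> n (c + y / \<beta> ^ n) x \<le> (\<beta> + 1) / (\<beta> - 1)))"
  using assms
proof (induction n arbitrary: x)
  case 0
  have "branch \<beta> 0 0" by (simp add: branch_def)
  moreover have "shadow_sum \<beta> 0 (0 + y / \<beta> ^ 0) x \<le> 1 / (\<beta> - 1)" if "y \<in> {0..<1}" for y
    using that 0 \<beta> by (auto simp: shadow_sum_def intro!: divide_right_mono)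
  ultimately show ?case by blast
next
  case (Suc n)
  define d where "d = \<lfloor>\<beta> * x\<rfloor>"
  have d0: "0 \<le> d" using Suc.prems \<beta> by (simp add: d_def)
  have x_eq: "x = (of_int d + beta_map \<beta> x) / \<beta>" using \<beta> by (simp add: d_def beta_map_def frac_def)
  have Tx: "beta_map \<beta> x \<in> {0..<1}" by (simp add: beta_map_def frac_lt_1)
  obtain c where c: "branch \<beta> n c" and cc:
    "c = 0 \<and> (\<forall>y\<in>{0..<1}. shadow_sum \<beta> n (c + y / \<beta> ^ n) (beta_map \<beta> x) \<le> 1 / (\<beta> - 1)) \<or>
     c + 1 / \<beta> ^ n \<le> beta_map \<beta> x \<and> (\<forall>y\<in>{0..<1}. shadow_sum \<beta> n (c + y / \<beta> ^ n) (beta_map \<beta> x) \<le> (\<beta> + 1) / (\<beta> - 1))"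
    using Suc.IH[OF Tx] by blast
  have same_digit: "shadow_sum \<beta> (Suc n) ((of_int d + c) / \<beta> + y / \<beta> ^ Suc n) x =
      shadow_sum \<beta> n (c + y / \<beta> ^ n) (beta_map \<beta> x)"
    if y: "y \<in> {0..<1}" and le: "(of_int d + (c + 1 / \<beta> ^ n)) / \<beta> \<le> 1" for y
  proof -
    note pre = branch_prepend[OF c d0 le]
    let ?z = "(of_int d + c) / \<beta> + y / \<beta> ^ Suc n" and ?z' = "c + y / \<beta> ^ n"
    have "?z - x = (?z' - beta_map \<beta> x) / \<beta>"
      by (subst x_eq) (simp add: pre(2) diff_divide_distrib[symmetric] del: power_Suc)
    then have "\<bar>?z - x\<bar> = \<bar>?z' - beta_map \<beta> x\<bar> / \<beta>" using \<beta> by (simp add: abs_divide)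
    then show ?thesis using \<beta>
      by (simp add: shadow_sum_Suc pre(3)[OF y] del: power_Suc) (simp add: field_simps)
  qed
  \<comment> \<open>Digits are prepended, so the word is read from its end. The first alternative of
    \<open>cc\<close> is the one in which only zeros have been met; the first digit
    \<open>d \<ge> 1\<close> is then the last nonzero one and gets lowered. Afterwards the interval
    lies below the point, so copying digits keeps it inside the unit interval.\<close>
  from cc consider (zero) "c = 0" "d = 0" "\<forall>y\<in>{0..<1}. shadow_sum \<beta> n (c + y / \<beta> ^ n) (beta_map \<beta> x) \<le> 1 / (\<beta> - 1)"
    | (change) "c = 0" "d \<ge> 1" "\<forall>y\<in>{0..<1}. shadow_sum \<beta> n (c + y / \<beta> ^ n) (beta_map \<beta> x) \<le> 1 / (\<beta> - 1)"
    | (below) "c + 1 / \<beta> ^ n \<le> beta_map \<beta> x" "\<forall>y\<in>{0..<1}. shadow_sum \<beta> n (c + y / \<beta> ^ n) (beta_map \<beta> x) \<le> (\<beta> + 1) / (\<beta> - 1)"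
    using d0 by linarith
  then show ?case
  proof cases
    case zero
    have le: "(of_int d + (c + 1 / \<beta> ^ n)) / \<beta> \<le> 1"
      using zero \<beta> one_le_power[of \<beta> "Suc n"] by (simp add: divide_le_eq mult.commute)
    show ?thesis
      using branch_prepend(1)[OF c d0 le] same_digit[OF _ le] zero
      by (intro exI[of _ "(of_int d + c) / \<beta>"]) simp
  next
    case below
    have "(of_int d + (c + 1 / \<beta> ^ n)) / \<beta> \<le> (of_int d + beta_map \<beta> x) / \<beta>"
      using below \<beta> by (intro divide_right_mono) auto
    then have le': "(of_int d + (c + 1 / \<beta> ^ n)) / \<beta> \<le> x" using x_eq by simp
    then have le: "(of_int d + (c + 1 / \<beta> ^ n)) / \<beta> \<le> 1" using Suc.prems by simp
    have "(of_int d + c) / \<beta> + 1 / \<beta> ^ Suc n \<le> x" using le' unfolding branch_prepend(2)[OF c d0 le] .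
    then show ?thesis
      using branch_prepend(1)[OF c d0 le] same_digit[OF _ le] below
      by (intro exI[of _ "(of_int d + c) / \<beta>"]) simp
  next
    case change
    let ?c = "(of_int (d - 1) + c) / \<beta>"
    have "1 \<le> \<beta> ^ n" using \<beta> by simp
    then have "1 / \<beta> ^ n \<le> 1" by simp
    moreover have "0 \<le> beta_map \<beta> x" using Tx by simp
    ultimately have "of_int (d - 1) + (c + 1 / \<beta> ^ n) \<le> of_int d + beta_map \<beta> x"
      unfolding change(1) of_int_diff of_int_1 by linarith
    then have "(of_int (d - 1) + (c + 1 / \<beta> ^ n)) / \<beta> \<le> (of_int d + beta_map \<beta> x) / \<beta>"
      using \<beta> by (intro divide_right_mono) simp_all
    then have le': "(of_int (d - 1) + (c + 1 / \<beta> ^ n)) / \<beta> \<le> x" using x_eq by simp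
    then have le: "(of_int (d - 1) + (c + 1 / \<beta> ^ n)) / \<beta> \<le> 1" using Suc.prems by simp
    have d1: "0 \<le> d - 1" using change by simp
    note pre = branch_prepend[OF c d1 le]
    have "?c + 1 / \<beta> ^ Suc n \<le> x" using le' unfolding pre(2) .
    moreover have "shadow_sum \<beta> (Suc n) (?c + y / \<beta> ^ Suc n) x \<le> (\<beta> + 1) / (\<beta> - 1)"
      if y: "y \<in> {0..<1}" for y
    proof -
      let ?z = "?c + y / \<beta> ^ Suc n"
      have "?z \<in> {0..<1}" by (rule branch_range[OF pre(1) y])
      then have z1: "\<bar>?z - x\<bar> \<le> 1" using Suc.prems by auto
      have "(\<bar>?z - x\<bar> - \<bar>beta_map \<beta> ?z - beta_map \<beta> x\<bar>) / (\<beta> - 1) \<le> 1 / (\<beta> - 1)"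
        using z1 \<beta> by (intro divide_right_mono) auto
      moreover have "shadow_sum \<beta> n (beta_map \<beta> ?z) (beta_map \<beta> x) \<le> 1 / (\<beta> - 1)"
        unfolding pre(3)[OF y] using change y by blast
      \<comment> \<open>The lowered digit costs at most 1 for the distance and 1 / (\<beta> - 1) for
        the potential, on top of the 1 / (\<beta> - 1) already allowed for the arbitrary
        continuation. It is paid once, whence the constant (\<beta> + 1) / (\<beta> - 1).\<close>
      ultimately have "shadow_sum \<beta> (Suc n) ?z x \<le> 1 / (\<beta> - 1) + 1 + 1 / (\<beta> - 1)"
        unfolding shadow_sum_Suc using z1 by linarith
      also have "\<dots> = (\<beta> + 1) / (\<beta> - 1)" using \<beta> by (simp add: field_simps)
      finally show ?thesis .
    qed
    ultimately show ?thesis using pre(1) by blast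
  qed
qed

text \<open>A 1-Lipschitz function inherits the total displacement as a bound for the error. The
  bound does not grow with \<open>n\<close>, so it is negligible for long segments.\<close>

lemma block_orbit:
  assumes x: "x \<in> {0..<1}"
  shows "block \<beta> n (\<lambda>f. \<Sum>i<n. f ((beta_map \<beta> ^^ i) x)) ((\<beta> + 1) / (\<beta> - 1))"
proof -
  have le: "1 / (\<beta> - 1) \<le> (\<beta> + 1) / (\<beta> - 1)" using \<beta> by (intro divide_right_mono) auto
  obtain c where c: "branch \<beta> n c"
    "\<And>y. y \<in> {0..<1} \<Longrightarrow> shadow_sum \<beta> n (c + y / \<beta> ^ n) x \<le> (\<beta> + 1) / (\<beta> - 1)"
    using shadowing_branch_aux[OF x, of n] le by (meson order_trans)
  have "\<bar>(\<Sum>i<n. f ((beta_map \<beta> ^^ i) (c + y / \<beta> ^ n))) - (\<Sum>i<n. f ((beta_map \<beta> ^^ i) x))\<bar> \<le> (\<beta> + 1) / (\<beta> - 1)"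
    if y: "y \<in> {0..<1}" and f: "1-lipschitz_on {0..1} f" for y and f :: "real \<Rightarrow> real"
  proof -
    let ?z = "c + y / \<beta> ^ n"
    have mem: "(beta_map \<beta> ^^ i) x \<in> {0..1}" "(beta_map \<beta> ^^ i) ?z \<in> {0..1}" for i
      using branch_range[OF c(1) y] x by (intro beta_orbit_unit; auto)+
    have "\<bar>(\<Sum>i<n. f ((beta_map \<beta> ^^ i) ?z)) - (\<Sum>i<n. f ((beta_map \<beta> ^^ i) x))\<bar>
        \<le> (\<Sum>i<n. \<bar>f ((beta_map \<beta> ^^ i) ?z) - f ((beta_map \<beta> ^^ i) x)\<bar>)"
      unfolding sum_subtractf[symmetric] by (rule sum_abs)
    also have "\<dots> \<le> (\<Sum>i<n. \<bar>(beta_map \<beta> ^^ i) ?z - (beta_map \<beta> ^^ i) x\<bar>)"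
      by (intro sum_mono lipschitz_le f mem)
    also have "\<dots> \<le> shadow_sum \<beta> n ?z x" using \<beta> by (simp add: shadow_sum_def)
    also have "\<dots> \<le> (\<beta> + 1) / (\<beta> - 1)" by (rule c(2)[OF y])
    finally show ?thesis .
  qed
  then show ?thesis unfolding block_def using c(1) by blast
qed

text \<open>The second block together with its continuation is a point of \<open>{0..<1}\<close>,
  hence itself a continuation of the first block; uniformity in \<open>y\<close> makes the two
  estimates compatible.\<close>

lemma block_append:
  assumes "block \<beta> m \<Phi> e" "block \<beta> n \<Psi> e'"
  shows "block \<beta> (m + n) (\<lambda>f. \<Phi> f + \<Psi> f) (e + e')"
proof -
  obtain a where a: "branch \<beta> m a" "\<And>y f. y \<in> {0..<1} \<Longrightarrow> 1-lipschitz_on {0..1} f \<Longrightarrow>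
      \<bar>(\<Sum>i<m. f ((beta_map \<beta> ^^ i) (a + y / \<beta> ^ m))) - \<Phi> f\<bar> \<le> e"
    using assms(1) unfolding block_def by blast
  obtain c where c: "branch \<beta> n c" "\<And>y f. y \<in> {0..<1} \<Longrightarrow> 1-lipschitz_on {0..1} f \<Longrightarrow>
      \<bar>(\<Sum>i<n. f ((beta_map \<beta> ^^ i) (c + y / \<beta> ^ n))) - \<Psi> f\<bar> \<le> e'"
    using assms(2) unfolding block_def by blast
  have "\<bar>(\<Sum>i<m + n. f ((beta_map \<beta> ^^ i) (a + c / \<beta> ^ m + y / \<beta> ^ (m + n)))) - (\<Phi> f + \<Psi> f)\<bar> \<le> e + e'"
    if y: "y \<in> {0..<1}" and f: "1-lipschitz_on {0..1} f" for y f
  proof -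
    let ?w = "c + y / \<beta> ^ n" and ?z = "a + c / \<beta> ^ m + y / \<beta> ^ (m + n)"
    have w: "?w \<in> {0..<1}" by (rule branch_range[OF c(1) y])
    have z: "?z = a + ?w / \<beta> ^ m" by (simp add: power_add add_divide_distrib mult.commute)
    have "(beta_map \<beta> ^^ (m + i)) ?z = (beta_map \<beta> ^^ i) ?w" for i
      using a(1) w by (simp add: z funpow_add add.commute[of m i] branch_def)
    then have "(\<Sum>i<m + n. f ((beta_map \<beta> ^^ i) ?z)) = (\<Sum>i<m. f ((beta_map \<beta> ^^ i) (a + ?w / \<beta> ^ m))) + (\<Sum>i<n. f ((beta_map \<beta> ^^ i) ?w))"
      unfolding sum_lessThan_add by (simp add: z)
    then show ?thesis using a(2)[OF w f] c(2)[OF y f] by linarith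
  qed
  then show ?thesis unfolding block_def using branch_append[OF a(1) c(1)] by blast
qed

lemma block_0: "block \<beta> 0 (\<lambda>f. 0) 0"
  unfolding block_def by (intro exI[of _ 0]) (simp add: branch_def)

lemma block_repeat: "block \<beta> n \<Phi> e \<Longrightarrow> block \<beta> (k * n) (\<lambda>f. real k * \<Phi> f) (real k * e)"
proof (induction k)
  case (Suc k)
  then show ?case using block_append[OF Suc.prems Suc.IH[OF Suc.prems]] by (simp add: distrib_right)
qed (simp add: block_0)

text \<open>Concatenating \<open>k a\<close> copies of each segment realises a combination of
  empirical measures with integer weights.\<close>

lemma block_sum:
  assumes "finite A" "\<And>a. a \<in> A \<Longrightarrow> block \<beta> n (\<Phi> a) e"
  shows "block \<beta> ((\<Sum>a\<in>A. k a) * n) (\<lambda>f. \<Sum>a\<in>A. real (k a) * \<Phi> a f) ((\<Sum>a\<in>A. real (k a)) * e)"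
  using assms
proof (induction A)
  case (insert a A)
  then show ?case
    using block_append[OF block_repeat[of n "\<Phi> a" e "k a"], of "(\<Sum>a\<in>A. k a) * n"
      "\<lambda>f. \<Sum>a\<in>A. real (k a) * \<Phi> a f" "(\<Sum>a\<in>A. real (k a)) * e"]
    by (simp add: distrib_right)
qed (simp add: block_0)

end

section \<open>Existence of generic points\<close>

context
  fixes \<beta> :: real and \<mu> :: "real measure"
  assumes \<beta>: "\<beta> > 1" and \<mu>: "borel_prob_unit \<mu>" and inv: "beta_invariant \<beta> \<mu>"
begin

lemma borel_subset_sets_mu: "B \<in> sets borel \<Longrightarrow> B \<subseteq> {0..1} \<Longrightarrow> B \<in> sets \<mu>"
  by (simp add: sets_mu[OF \<mu>] sets_restrict_space_iff)

lemma beta_map_borel: "beta_map \<beta> \<in> borel_measurable borel"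
  unfolding beta_map_def[abs_def] frac_def by measurable

lemma beta_orbit_borel: "(beta_map \<beta> ^^ i) \<in> borel_measurable borel"
proof (induction i)
  case (Suc i)
  then show ?case unfolding funpow.simps by (rule measurable_comp[OF _ beta_map_borel])
qed (simp add: id_def)

lemma beta_orbit_measurable: "(beta_map \<beta> ^^ i) \<in> measurable \<mu> \<mu>"
proof -
  have "(beta_map \<beta> ^^ i) \<in> measurable (restrict_space borel {0..1}) (restrict_space borel {0..1})"
    using beta_orbit_unit beta_orbit_borel
    by (intro measurable_restrict_space2 measurable_restrict_space1) (auto simp: space_restrict_space)
  then show ?thesis using measurable_cong_sets[OF sets_mu[OF \<mu>] sets_mu[OF \<mu>]] by simp
qed

lemma distr_beta_map: "distr \<mu> \<mu> (beta_map \<beta>) = \<mu>"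
proof (rule measure_eqI)
  interpret prob_space \<mu> by (rule prob_mu[OF \<mu>])
  fix B assume "B \<in> sets (distr \<mu> \<mu> (beta_map \<beta>))"
  then have B: "B \<in> sets \<mu>" by simp
  have "beta_map \<beta> -` B \<inter> space \<mu> = {x \<in> {0..1}. beta_map \<beta> x \<in> B}"
    by (auto simp: space_mu[OF \<mu>])
  then have "emeasure (distr \<mu> \<mu> (beta_map \<beta>)) B = emeasure \<mu> {x \<in> {0..1}. beta_map \<beta> x \<in> B}"
    using beta_orbit_measurable[of 1] B by (simp add: emeasure_distr)
  also have "\<dots> = emeasure \<mu> B"
    using inv B unfolding beta_invariant_def emeasure_eq_measure sets_mu[OF \<mu>] by simp
  finally show "emeasure (distr \<mu> \<mu> (beta_map \<beta>)) B = emeasure \<mu> B" .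
qed simp

lemma integral_beta_orbit:
  fixes f :: "real \<Rightarrow> real"
  assumes "f \<in> borel_measurable \<mu>"
  shows "(\<integral>x. f ((beta_map \<beta> ^^ i) x) \<partial>\<mu>) = integral\<^sup>L \<mu> f"
proof (induction i)
  case (Suc i)
  have "(\<integral>x. f ((beta_map \<beta> ^^ i) x) \<partial>\<mu>) = (\<integral>x. f ((beta_map \<beta> ^^ i) x) \<partial>distr \<mu> \<mu> (beta_map \<beta>))"
    by (simp add: distr_beta_map)
  also have "\<dots> = (\<integral>x. f ((beta_map \<beta> ^^ i) (beta_map \<beta> x)) \<partial>\<mu>)"
    using beta_orbit_measurable[of 1] measurable_compose[OF beta_orbit_measurable assms]
    by (intro integral_distr) auto
  also have "\<dots> = (\<integral>x. f ((beta_map \<beta> ^^ Suc i) x) \<partial>\<mu>)" by (simp only: funpow_Suc_right comp_def)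
  finally show ?case using Suc by simp
qed simp

text \<open>The map only takes values below 1, so the preimage of \<open>{1}\<close> is empty and
  invariance gives mass 0. This allows 1 to be discarded: blocks and expansions live in
  \<open>{0..<1}\<close>.\<close>

lemma measure_one: "measure \<mu> {1} = 0"
proof -
  have "{x \<in> {0..1}. beta_map \<beta> x \<in> {1}} = {}"
    using frac_lt_1 by (auto simp: beta_map_def less_le)
  moreover have "{1} \<in> sets (restrict_space borel {0..1::real})"
    by (auto simp: sets_restrict_space_iff)
  ultimately show ?thesis using inv unfolding beta_invariant_def by (metis measure_empty)
qed

lemma AE_less_one: "AE x in \<mu>. x \<in> {0..<1}"
proof (rule AE_I)
  interpret prob_space \<mu> by (rule prob_mu[OF \<mu>])
  show "{x \<in> space \<mu>. x \<notin> {0..<1}} \<subseteq> {1}" by (auto simp: space_mu[OF \<mu>])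
  show "emeasure \<mu> {1} = 0" using measure_one by (simp add: emeasure_eq_measure)
  show "{1} \<in> sets \<mu>" by (intro borel_subset_sets_mu) auto
qed

text \<open>A 1-Lipschitz function varies by at most 1 on the unit interval, so an uncontrolled
  orbit step costs at most 1, whatever the size of \<open>f\<close>.\<close>

lemma lipschitz_integral:
  fixes f :: "real \<Rightarrow> real"
  assumes f: "1-lipschitz_on {0..1} f"
  shows "integrable \<mu> f" and "u \<in> {0..1} \<Longrightarrow> \<bar>f u - integral\<^sup>L \<mu> f\<bar> \<le> 1"
proof -
  interpret prob_space \<mu> by (rule prob_mu[OF \<mu>])
  show int: "integrable \<mu> f"
    using lipschitz_on_continuous_on[OF f] by (rule integrable_mu_continuous[OF \<mu>])
  assume u: "u \<in> {0..1}"
  have "f u - integral\<^sup>L \<mu> f = (\<integral>x. f u - f x \<partial>\<mu>)"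
    using int prob_space by simp
  also have "\<bar>\<dots>\<bar> \<le> (\<integral>x. \<bar>f u - f x\<bar> \<partial>\<mu>)" by (rule integral_abs_bound)
  also have "\<dots> \<le> (\<integral>x. 1 \<partial>\<mu>)"
  proof (rule integral_mono)
    fix x assume "x \<in> space \<mu>"
    then have x: "x \<in> {0..1}" by (simp add: space_mu[OF \<mu>])
    have "\<bar>f u - f x\<bar> \<le> \<bar>u - x\<bar>" by (rule lipschitz_le[OF f u x])
    then show "\<bar>f u - f x\<bar> \<le> 1" using u x by auto
  qed (use int in auto)
  finally show "\<bar>f u - integral\<^sup>L \<mu> f\<bar> \<le> 1" using prob_space by simp
qed

text \<open>Grouping the points of \<open>[0, 1)\<close> by the codes \<open>\<lfloor>m T\<^sup>i x\<rfloor>\<close>, \<open>i < n\<close>, approximates \<open>\<mu>\<close> by a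
  convex combination of empirical measures of orbits of length \<open>n\<close>, uniformly over all
  1-Lipschitz functions.\<close>

lemma orbit_code_approximation:
  assumes m: "m \<ge> 1"
  shows "\<exists>(C :: int list set) rep p. finite C \<and> C \<noteq> {} \<and> (\<forall>a\<in>C. rep a \<in> {0..<1}) \<and>
    (\<forall>a. 0 \<le> p a) \<and> (\<Sum>a\<in>C. p a) = 1 \<and> (\<forall>f. 1-lipschitz_on {0..1} f \<longrightarrow>
      \<bar>(\<Sum>a\<in>C. p a * (\<Sum>i<n. f ((beta_map \<beta> ^^ i) (rep a)))) - real n * integral\<^sup>L \<mu> f\<bar> \<le> real n / real m)"
proof -
  interpret prob_space \<mu> by (rule prob_mu[OF \<mu>])
  let ?T = "\<lambda>i. (beta_map \<beta> ^^ i)"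
  define code where "code x = map (\<lambda>i. \<lfloor>real m * ?T i x\<rfloor>) [0..<n]" for x
  define C where "C = code ` {0..<1}"
  define rep where "rep = inv_into {0..<1} code"
  define P where "P a = {x \<in> {0..<1}. code x = a}" for a
  have T1: "?T i x \<in> {0..1}" if "x \<in> {0..<1}" for i x using that by (intro beta_orbit_unit) auto
  have "C \<subseteq> {xs. set xs \<subseteq> {0..int m} \<and> length xs = n}"
  proof
    fix a assume "a \<in> C"
    then obtain x where x: "x \<in> {0..<1}" "a = code x" unfolding C_def by blast
    have "\<lfloor>real m * ?T i x\<rfloor> \<in> {0..int m}" for i
    proof -
      have "real m * ?T i x \<le> real m * 1" using T1[OF x(1), of i] by (intro mult_left_mono) auto
      then have "\<lfloor>real m * ?T i x\<rfloor> \<le> int m" by (simp add: floor_le_iff)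
      moreover have "0 \<le> real m * ?T i x" using T1[OF x(1), of i] by simp
      ultimately show ?thesis by simp
    qed
    then show "a \<in> {xs. set xs \<subseteq> {0..int m} \<and> length xs = n}" by (auto simp: x code_def)
  qed
  then have fin: "finite C" by (rule finite_subset) (rule finite_lists_length_eq, simp)
  have ne: "C \<noteq> {}" by (auto simp: C_def)
  have rep: "rep a \<in> {0..<1}" "code (rep a) = a" if "a \<in> C" for a
    using that unfolding rep_def C_def by (rule inv_into_into, rule f_inv_into_f)
  have P_sets: "P a \<in> sets \<mu>" for a
  proof -
    have [measurable]: "?T i \<in> borel_measurable borel" for i by (rule beta_orbit_borel)
    have "P a = {0..<1} \<inter> {x \<in> space borel. length a = n \<and> (\<forall>i\<in>{..<n}. \<lfloor>real m * ?T i x\<rfloor> = a ! i)}"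
      unfolding P_def code_def by (auto simp: list_eq_iff_nth_eq)
    also have "\<dots> \<in> sets borel" by measurable
    finally show ?thesis by (rule borel_subset_sets_mu) (auto simp: P_def)
  qed
  have ind: "(\<Sum>a\<in>C. h a * indicator (P a) x) = h (code x)" if "x \<in> {0..<1}" for x and h :: "int list \<Rightarrow> real"
  proof -
    have "(\<Sum>a\<in>C. h a * indicator (P a) x) = (\<Sum>a\<in>C. if a = code x then h a else 0)"
      using that by (intro sum.cong refl) (auto simp: P_def indicator_def)
    also have "\<dots> = h (code x)" using fin that by (simp add: C_def)
    finally show ?thesis .
  qed
  have int_ind: "integrable \<mu> (\<lambda>x. \<Sum>a\<in>C. h a * indicator (P a) x)"
    "(\<integral>x. (\<Sum>a\<in>C. h a * indicator (P a) x) \<partial>\<mu>) = (\<Sum>a\<in>C. h a * measure \<mu> (P a))"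
    for h :: "int list \<Rightarrow> real"
    using P_sets by (auto simp: emeasure_eq_measure sets.Int_space_eq2)
  have "(\<Sum>a\<in>C. measure \<mu> (P a)) = (\<integral>x. (\<Sum>a\<in>C. 1 * indicator (P a) x) \<partial>\<mu>)"
    unfolding int_ind by simp
  also have "\<dots> = (\<integral>x. 1 \<partial>\<mu>)"
  proof (rule integral_cong_AE)
    show "AE x in \<mu>. (\<Sum>a\<in>C. 1 * indicator (P a) x) = (1::real)"
      using AE_less_one by eventually_elim (rule ind)
  qed (use int_ind(1)[of "\<lambda>_. 1"] in auto)
  finally have sum1: "(\<Sum>a\<in>C. measure \<mu> (P a)) = 1" by (simp add: prob_space)
  have approx: "\<bar>(\<Sum>a\<in>C. measure \<mu> (P a) * (\<Sum>i<n. f (?T i (rep a)))) - real n * integral\<^sup>L \<mu> f\<bar> \<le> real n / real m"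
    if f: "1-lipschitz_on {0..1} f" for f
  proof -
    define A where "A x = (\<Sum>i<n. f (?T i x))" for x
    have fT: "integrable \<mu> (\<lambda>x. f (?T i x))" for i
    proof (rule integrable_const_bound[where B="\<bar>integral\<^sup>L \<mu> f\<bar> + 1"])
      show "(\<lambda>x. f (?T i x)) \<in> borel_measurable \<mu>"
        using lipschitz_integral(1)[OF f] beta_orbit_measurable[of i] by (auto intro: measurable_compose)
      have "\<bar>f (?T i x)\<bar> \<le> \<bar>integral\<^sup>L \<mu> f\<bar> + 1" if "x \<in> {0..1}" for x
        using lipschitz_integral(2)[OF f beta_orbit_unit[OF that, of i \<beta>]] by linarith
      then show "AE x in \<mu>. norm (f (?T i x)) \<le> \<bar>integral\<^sup>L \<mu> f\<bar> + 1"
        by (intro AE_I2) (simp add: space_mu[OF \<mu>])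
    qed
    have A: "integrable \<mu> A" unfolding A_def using fT by auto
    have "integral\<^sup>L \<mu> A = (\<Sum>i<n. integral\<^sup>L \<mu> f)"
      unfolding A_def using fT lipschitz_integral(1)[OF f]
      by (subst Bochner_Integration.integral_sum) (auto simp: integral_beta_orbit)
    then have intA: "integral\<^sup>L \<mu> A = real n * integral\<^sup>L \<mu> f" by simp
    \<comment> \<open>\<open>g\<close> evaluates the orbit sum at the representative with the same
      code. Its integral is the convex combination, while by invariance \<open>A\<close> has
      \<open>n\<close> times the integral of \<open>f\<close>; equal codes keep the two functions
      within n / m of each other.\<close>
    define g where "g x = (\<Sum>a\<in>C. A (rep a) * indicator (P a) x)" for x
    have g: "integrable \<mu> g" "integral\<^sup>L \<mu> g = (\<Sum>a\<in>C. A (rep a) * measure \<mu> (P a))"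
      unfolding g_def by (rule int_ind)+
    have close: "\<bar>g x - A x\<bar> \<le> real n / real m" if x: "x \<in> {0..<1}" for x
    proof -
      let ?x' = "rep (code x)"
      have cx: "code x \<in> C" using x by (simp add: C_def)
      have "\<bar>f (?T i ?x') - f (?T i x)\<bar> \<le> 1 / real m" if i: "i < n" for i
      proof -
        have "code ?x' ! i = code x ! i" using rep(2)[OF cx] by simp
        then have "\<lfloor>real m * ?T i ?x'\<rfloor> = \<lfloor>real m * ?T i x\<rfloor>" using i by (simp add: code_def)
        then have "\<bar>real m * ?T i ?x' - real m * ?T i x\<bar> \<le> 1" by linarith
        moreover have "\<bar>real m * ?T i ?x' - real m * ?T i x\<bar> = real m * \<bar>?T i ?x' - ?T i x\<bar>"
          by (simp only: right_diff_distrib[symmetric] abs_mult abs_of_nat)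
        ultimately have "\<bar>?T i ?x' - ?T i x\<bar> \<le> 1 / real m"
          using m by (simp add: pos_le_divide_eq mult.commute)
        moreover have "\<bar>f (?T i ?x') - f (?T i x)\<bar> \<le> \<bar>?T i ?x' - ?T i x\<bar>"
          by (rule lipschitz_le[OF f T1[OF rep(1)[OF cx]] T1[OF x]])
        ultimately show ?thesis by simp
      qed
      then have "(\<Sum>i<n. \<bar>f (?T i ?x') - f (?T i x)\<bar>) \<le> (\<Sum>i<n. 1 / real m)" by (intro sum_mono) auto
      moreover have "\<bar>A ?x' - A x\<bar> \<le> (\<Sum>i<n. \<bar>f (?T i ?x') - f (?T i x)\<bar>)"
        unfolding A_def sum_subtractf[symmetric] by (rule sum_abs)
      moreover have "g x = A ?x'" unfolding g_def by (rule ind[OF x])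
      ultimately show ?thesis by simp
    qed
    have "\<bar>integral\<^sup>L \<mu> g - integral\<^sup>L \<mu> A\<bar> = \<bar>\<integral>x. g x - A x \<partial>\<mu>\<bar>" using A g(1) by simp
    also have "\<dots> \<le> (\<integral>x. \<bar>g x - A x\<bar> \<partial>\<mu>)" by (rule integral_abs_bound)
    also have "\<dots> \<le> (\<integral>x. real n / real m \<partial>\<mu>)"
    proof (rule integral_mono_AE)
      show "AE x in \<mu>. \<bar>g x - A x\<bar> \<le> real n / real m"
        using AE_less_one by eventually_elim (rule close)
    qed (use A g(1) in auto)
    also have "\<dots> = real n / real m" by (simp add: prob_space)
    finally show ?thesis unfolding intA g A_def by (simp add: mult.commute)
  qed
  show ?thesis
    by (intro exI[of _ C] exI[of _ rep] exI[of _ "\<lambda>a. measure \<mu> (P a)"] conjI ballI allI impI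
        fin ne rep(1) measure_nonneg sum1 approx)
qed

end

section \<open>From approximating blocks to a generic point\<close>

lemma slow_selection:
  fixes L :: "nat \<Rightarrow> nat"
  obtains \<sigma> where "\<And>J. \<forall>\<^sub>F l in sequentially. \<sigma> l \<ge> J \<and> J * L (\<sigma> l) \<le> l"
proof -
  \<comment> \<open>The largest quality \<open>j \<le> l\<close> with
    \<open>j * L j \<le> l\<close>. Quality tends to infinity, but so slowly that one block is
    negligible against the \<open>l\<close> blocks that precede it. The alternative
    \<open>j = 0\<close> keeps the set nonempty.\<close>
  define \<sigma> where "\<sigma> l = Max {j \<in> {..l}. j = 0 \<or> j * L j \<le> l}" for l
  have mem: "\<sigma> l \<in> {j \<in> {..l}. j = 0 \<or> j * L j \<le> l}" for l
    unfolding \<sigma>_def by (rule Max_in) auto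
  have ge: "J \<le> \<sigma> l" if "max J (J * L J) \<le> l" for J l
    unfolding \<sigma>_def using that by (intro Max_ge) auto
  have "\<forall>\<^sub>F l in sequentially. \<sigma> l \<ge> J \<and> J * L (\<sigma> l) \<le> l" for J
  proof -
    have *: "\<sigma> l \<ge> J \<and> J * L (\<sigma> l) \<le> l" if l: "max J (J * L J) \<le> l" for l
    proof
      show J: "J \<le> \<sigma> l" by (rule ge[OF l])
      show "J * L (\<sigma> l) \<le> l"
      proof (cases "J = 0")
        case False
        then have "\<sigma> l * L (\<sigma> l) \<le> l" using mem[of l] J by simp
        moreover have "J * L (\<sigma> l) \<le> \<sigma> l * L (\<sigma> l)" using J by (rule mult_le_mono1)
        ultimately show ?thesis by (rule order_trans[rotated])
      qed simp
    qed
    show ?thesis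
      unfolding eventually_sequentially by (intro exI[of _ "max J (J * L J)"] allI impI *)
  qed
  then show thesis by (rule that)
qed

context
  fixes \<beta> :: real and \<mu> :: "real measure"
  assumes \<beta>: "\<beta> > 1" and \<mu>: "borel_prob_unit \<mu>" and inv: "beta_invariant \<beta> \<mu>"
begin

text \<open>Four errors are budgeted: coding orbits with mesh 1 / m, rounding the weights to
  integers, shadowing at cost \<open>D\<close> per segment, and one extra step. The choice of
  \<open>m\<close> keeps the first two below half of the allowance, the choice of \<open>n\<close>
  the last two.\<close>

lemma approximating_block:
  assumes e: "0 < e"
  obtains n c where "n \<ge> 1" "branch \<beta> n c" "c + 1 / \<beta> ^ n < 1"
    "\<And>y f. y \<in> {0..<1} \<Longrightarrow> 1-lipschitz_on {0..1} f \<Longrightarrow>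
      \<bar>(\<Sum>i<n. f ((beta_map \<beta> ^^ i) (c + y / \<beta> ^ n))) - real n * integral\<^sup>L \<mu> f\<bar> \<le> e * real n"
proof -
  let ?T = "\<lambda>i. (beta_map \<beta> ^^ i)"
  define D where "D = (\<beta> + 1) / (\<beta> - 1)"
  have D: "0 \<le> D" using \<beta> by (simp add: D_def)
  obtain m0 :: nat where m0: "4 / e < real m0" using reals_Archimedean2 by blast
  define m where "m = m0 + 2"
  have m: "m \<ge> 2" "4 / e < real m - 1" using m0 by (auto simp: m_def)
  obtain n :: nat where n: "2 * (D + 1) / e < real n" using reals_Archimedean2 by blast
  have n0: "0 < real n" using n D e by (meson add_nonneg_pos divide_nonneg_nonneg le_less_trans less_imp_le mult_nonneg_nonneg zero_le_numeral zero_less_one)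
  have nD: "D + 1 \<le> e / 2 * real n" using n e by (simp add: field_simps)
  have mm: "2 \<le> e / 2 * (real m - 1)" using m e by (simp add: field_simps)
  have m1: "m \<ge> 1" using m(1) by simp
  obtain C :: "int list set" and rep p where Q: "finite C \<and> C \<noteq> {} \<and> (\<forall>a\<in>C. rep a \<in> {0..<1}) \<and>
    (\<forall>a. 0 \<le> p a) \<and> (\<Sum>a\<in>C. p a) = 1 \<and> (\<forall>f. 1-lipschitz_on {0..1} f \<longrightarrow>
      \<bar>(\<Sum>a\<in>C. p a * (\<Sum>i<n. f (?T i (rep a)))) - real n * integral\<^sup>L \<mu> f\<bar> \<le> real n / real m)"
    using orbit_code_approximation[OF \<beta> \<mu> inv m1, of n] by (elim exE)
  note C = Q[THEN conjunct1] Q[THEN conjunct2, THEN conjunct1]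
    Q[THEN conjunct2, THEN conjunct2, THEN conjunct1, THEN bspec]
    Q[THEN conjunct2, THEN conjunct2, THEN conjunct2, THEN conjunct1, THEN spec]
    Q[THEN conjunct2, THEN conjunct2, THEN conjunct2, THEN conjunct2, THEN conjunct1]
  note approx = Q[THEN conjunct2, THEN conjunct2, THEN conjunct2, THEN conjunct2, THEN conjunct2, THEN spec, THEN mp]
  \<comment> \<open>With this scale coding and rounding each contribute at most
    \<open>card C * n\<close>: the former R * n / m, the latter at most one segment per code. The
    total weight \<open>K\<close> is at least (m - 1) * card C, so both are small relative to K *
    n.\<close>
  define R where "R = real m * real (card C)"
  define k where "k a = nat \<lfloor>R * p a\<rfloor>" for a
  define K where "K = (\<Sum>a\<in>C. k a)"
  have cardC: "1 \<le> real (card C)" using C(1,2) by (simp add: Suc_le_eq card_gt_0_iff)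
  have k: "real (k a) \<le> R * p a" "R * p a - 1 \<le> real (k a)" for a
  proof -
    have "0 \<le> R * p a" using C(4) by (simp add: R_def)
    then have "real (k a) = of_int \<lfloor>R * p a\<rfloor>" unfolding k_def by simp
    then show "real (k a) \<le> R * p a" "R * p a - 1 \<le> real (k a)" by linarith+
  qed
  have "(\<Sum>a\<in>C. R * p a - 1) \<le> real K"
    unfolding K_def of_nat_sum by (intro sum_mono k)
  moreover have "(\<Sum>a\<in>C. R * p a - 1) = R * (\<Sum>a\<in>C. p a) - real (card C)"
    by (simp add: sum_subtractf sum_distrib_left)
  moreover have "\<dots> = (real m - 1) * real (card C)"
    unfolding C(5) by (simp add: R_def left_diff_distrib)
  ultimately have K: "(real m - 1) * real (card C) \<le> real K" by simp
  have "1 * 1 \<le> (real m - 1) * real (card C)" using m cardC by (intro mult_mono) auto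
  then have K1: "1 \<le> real K" using K by simp
  have weighted: "\<bar>(\<Sum>a\<in>C. real (k a) * (\<Sum>i<n. f (?T i (rep a)))) - real (K * n) * integral\<^sup>L \<mu> f\<bar>
      \<le> e / 2 * real (K * n)" if f: "1-lipschitz_on {0..1} f" for f
  proof -
    define b where "b a = (\<Sum>i<n. f (?T i (rep a))) - real n * integral\<^sup>L \<mu> f" for a
    have b: "\<bar>b a\<bar> \<le> real n" if "a \<in> C" for a
    proof -
      have "b a = (\<Sum>i<n. f (?T i (rep a)) - integral\<^sup>L \<mu> f)" by (simp add: b_def sum_subtractf)
      also have "\<bar>\<dots>\<bar> \<le> (\<Sum>i<n. \<bar>f (?T i (rep a)) - integral\<^sup>L \<mu> f\<bar>)" by (rule sum_abs)
      also have "\<dots> \<le> (\<Sum>i<n. 1)"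
        using C(3)[OF that] by (intro sum_mono lipschitz_integral(2)[OF \<beta> \<mu> inv f] beta_orbit_unit) auto
      finally show ?thesis by simp
    qed
    have "(\<Sum>a\<in>C. p a * b a) = (\<Sum>a\<in>C. p a * (\<Sum>i<n. f (?T i (rep a)))) - real n * integral\<^sup>L \<mu> f"
      by (simp add: b_def right_diff_distrib sum_subtractf sum_distrib_right[symmetric] C(5))
    then have pb: "\<bar>\<Sum>a\<in>C. p a * b a\<bar> \<le> real n / real m" using approx[OF f] by simp
    have "(\<Sum>a\<in>C. real (k a) * (\<Sum>i<n. f (?T i (rep a)))) - real (K * n) * integral\<^sup>L \<mu> f =
        (\<Sum>a\<in>C. real (k a) * b a)"
      by (simp add: b_def right_diff_distrib sum_subtractf sum_distrib_right[symmetric] K_def mult.assoc)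
    also have "\<dots> = R * (\<Sum>a\<in>C. p a * b a) + (\<Sum>a\<in>C. (real (k a) - R * p a) * b a)"
      by (simp add: sum_distrib_left sum.distrib[symmetric] left_diff_distrib mult.assoc)
    finally have eq: "(\<Sum>a\<in>C. real (k a) * (\<Sum>i<n. f (?T i (rep a)))) - real (K * n) * integral\<^sup>L \<mu> f =
      R * (\<Sum>a\<in>C. p a * b a) + (\<Sum>a\<in>C. (real (k a) - R * p a) * b a)" .
    have "\<bar>R * (\<Sum>a\<in>C. p a * b a)\<bar> \<le> R * (real n / real m)"
      unfolding abs_mult using pb by (intro mult_mono) (auto simp: R_def)
    also have "\<dots> = real (card C) * real n" using m by (simp add: R_def)
    finally have 1: "\<bar>R * (\<Sum>a\<in>C. p a * b a)\<bar> \<le> real (card C) * real n" .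
    have "\<bar>\<Sum>a\<in>C. (real (k a) - R * p a) * b a\<bar> \<le> (\<Sum>a\<in>C. \<bar>(real (k a) - R * p a) * b a\<bar>)"
      by (rule sum_abs)
    also have "\<dots> \<le> (\<Sum>a\<in>C. 1 * real n)"
    proof (rule sum_mono)
      fix a assume "a \<in> C"
      have "\<bar>real (k a) - R * p a\<bar> \<le> 1" using k[of a] by linarith
      then show "\<bar>(real (k a) - R * p a) * b a\<bar> \<le> 1 * real n"
        unfolding abs_mult using b[OF \<open>a \<in> C\<close>] by (intro mult_mono) auto
    qed
    also have "\<dots> = real (card C) * real n" by simp
    finally have 2: "\<bar>\<Sum>a\<in>C. (real (k a) - R * p a) * b a\<bar> \<le> real (card C) * real n" .
    have "2 * real (card C) \<le> e / 2 * (real m - 1) * real (card C)"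
      using mm by (intro mult_right_mono) auto
    also have "\<dots> \<le> e / 2 * real K" using K e by (simp add: mult.assoc)
    finally have "2 * real (card C) * real n \<le> e / 2 * real K * real n" by (rule mult_right_mono) simp
    then have "real (card C) * real n + real (card C) * real n \<le> e / 2 * real (K * n)"
      by (simp add: mult.assoc mult.left_commute mult.commute)
    then show ?thesis unfolding eq using 1 2 by linarith
  qed
  have "block \<beta> (K * n) (\<lambda>f. \<Sum>a\<in>C. real (k a) * (\<Sum>i<n. f (?T i (rep a)))) ((\<Sum>a\<in>C. real (k a)) * D)"
    unfolding K_def D_def by (intro block_sum[OF \<beta>] block_orbit[OF \<beta>] C)
  then obtain c where c: "branch \<beta> (K * n) c" and cf:
    "\<And>y f. y \<in> {0..<1} \<Longrightarrow> 1-lipschitz_on {0..1} f \<Longrightarrow>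
      \<bar>(\<Sum>i<K * n. f (?T i (c + y / \<beta> ^ (K * n)))) - (\<Sum>a\<in>C. real (k a) * (\<Sum>i<n. f (?T i (rep a))))\<bar> \<le> real K * D"
    unfolding block_def K_def of_nat_sum by blast
  \<comment> \<open>One digit 0 is appended to make the right endpoint strictly smaller than 1; an
    infinite concatenation could otherwise converge to the excluded point 1. The continuation seen
    by the old block becomes y / \<beta>.\<close>
  have zero: "branch \<beta> 1 0" using branch_1[OF \<beta>, of 0] \<beta> by simp
  have c': "branch \<beta> (Suc (K * n)) c" using branch_append[OF \<beta> c zero] by simp
  have "1 / \<beta> ^ Suc (K * n) < 1 / \<beta> ^ (K * n)" using \<beta> by (simp add: field_simps)
  then have strict: "c + 1 / \<beta> ^ Suc (K * n) < 1" using c unfolding branch_def by linarith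
  have fin: "\<bar>(\<Sum>i<Suc (K * n). f (?T i (c + y / \<beta> ^ Suc (K * n)))) - real (Suc (K * n)) * integral\<^sup>L \<mu> f\<bar>
      \<le> e * real (Suc (K * n))" if y: "y \<in> {0..<1}" and f: "1-lipschitz_on {0..1} f" for y f
  proof -
    let ?z = "c + y / \<beta> ^ Suc (K * n)"
    have y': "y / \<beta> \<in> {0..<1}" using y \<beta> by (auto simp: divide_less_eq)
    have z: "?z = c + (y / \<beta>) / \<beta> ^ (K * n)" by simp
    have "?z \<in> {0..<1}" by (rule branch_range[OF \<beta> c' y])
    then have last: "\<bar>f (?T (K * n) ?z) - integral\<^sup>L \<mu> f\<bar> \<le> 1"
      by (intro lipschitz_integral(2)[OF \<beta> \<mu> inv f] beta_orbit_unit) auto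
    have "real K * (D + 1) \<le> real K * (e / 2 * real n)" using nD by (intro mult_left_mono) auto
    then have KD: "real K * D + 1 \<le> e / 2 * real (K * n)" using K1 by (simp add: algebra_simps)
    have split: "(\<Sum>i<Suc (K * n). f (?T i ?z)) = (\<Sum>i<K * n. f (?T i ?z)) + f (?T (K * n) ?z)" by simp
    have "\<bar>(\<Sum>i<Suc (K * n). f (?T i ?z)) - real (Suc (K * n)) * integral\<^sup>L \<mu> f\<bar> \<le> e * real (K * n)"
      using cf[OF y' f, folded z] weighted[OF f] last KD unfolding split of_nat_Suc distrib_right
      by linarith
    also have "\<dots> \<le> e * real (Suc (K * n))" using e by (intro mult_left_mono) auto
    finally show ?thesis .
  qed
  show thesis by (rule that[OF _ c' strict fin]) auto
qed

end

text \<open>The cylinders of the finite concatenations are nested: left endpoints \<open>Z l\<close>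
  increase, right endpoints decrease. The limit lies in all closed cylinders, and \<open>Y l\<close>
  is its rescaled position in the one of stage \<open>l\<close>. Strictness of the endpoint
  condition excludes \<open>Y l = 1\<close>, so the branch property applies.\<close>

lemma infinite_branch:
  fixes M :: "nat \<Rightarrow> nat" and a :: "nat \<Rightarrow> real"
  assumes \<beta>: "\<beta> > 1" and br: "\<And>l. branch \<beta> (M l) (a l)" and strict: "\<And>l. a l + 1 / \<beta> ^ M l < 1"
  obtains Y where "\<And>l. Y l \<in> {0..<1}" "\<And>l. Y l = a l + Y (Suc l) / \<beta> ^ M l"
    "\<And>l. (beta_map \<beta> ^^ (\<Sum>j<l. M j)) (Y 0) = Y l"
proof -
  define P where "P l = (\<Sum>j<l. M j)" for l
  define Z where "Z l = (\<Sum>j<l. a j / \<beta> ^ P j)" for l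
  have pos: "0 < \<beta> ^ n" for n using \<beta> by simp
  have Z: "branch \<beta> (P l) (Z l)" for l
  proof (induction l)
    case 0
    show ?case by (simp add: P_def Z_def branch_def)
  next
    case (Suc l)
    then show ?case using branch_append[OF \<beta> Suc br[of l]] by (simp add: P_def Z_def)
  qed
  have dec: "Z (Suc l) + 1 / \<beta> ^ P (Suc l) \<le> Z l + 1 / \<beta> ^ P l" for l
  proof -
    have "(a l + 1 / \<beta> ^ M l) / \<beta> ^ P l \<le> 1 / \<beta> ^ P l"
      using strict[of l] pos by (intro divide_right_mono) (auto simp: less_imp_le)
    then show ?thesis by (simp add: Z_def P_def power_add add_divide_distrib mult.commute)
  qed
  have upper: "Z (l + k) \<le> Z l + 1 / \<beta> ^ P l" for l k
  proof -
    have "Z (l + k) + 1 / \<beta> ^ P (l + k) \<le> Z l + 1 / \<beta> ^ P l"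
      by (induction k) (use dec order_trans in \<open>auto\<close>)
    moreover have "0 \<le> 1 / \<beta> ^ P (l + k)" using pos[of "P (l + k)"] by simp
    ultimately show ?thesis by linarith
  qed
  have inc: "incseq Z"
  proof (rule incseq_SucI)
    fix l
    have "0 \<le> a l / \<beta> ^ P l"
      using br[of l] pos[of "P l"] by (intro divide_nonneg_pos) (simp_all add: branch_def)
    then show "Z l \<le> Z (Suc l)" by (simp add: Z_def)
  qed
  moreover have "Z l \<le> 1" for l using upper[of 0 l] by (simp add: Z_def P_def)
  ultimately obtain z where z: "Z \<longlonglongrightarrow> z" "\<And>l. Z l \<le> z" using incseq_convergent by metis
  have z_le: "z \<le> Z l + 1 / \<beta> ^ P l" for l
    by (rule LIMSEQ_le_const2[OF LIMSEQ_ignore_initial_segment[OF z(1), of l]])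
      (use upper[of l] in \<open>auto simp: add.commute\<close>)
  define Y where "Y l = (z - Z l) * \<beta> ^ P l" for l
  have zY: "z = Z l + Y l / \<beta> ^ P l" for l using \<beta> by (simp add: Y_def)
  have Y01: "Y l \<in> {0..1}" for l
  proof -
    have "Y l / \<beta> ^ P l \<le> 1 / \<beta> ^ P l" using z_le[of l] zY[of l] by linarith
    then have "Y l \<le> 1" using pos[of "P l"] by (simp add: divide_le_cancel)
    moreover have "0 \<le> Y l" using z(2)[of l] pos[of "P l"] by (simp add: Y_def)
    ultimately show ?thesis by simp
  qed
  have step: "Y l = a l + Y (Suc l) / \<beta> ^ M l" for l
  proof -
    have "Y (Suc l) / \<beta> ^ M l = (z - Z (Suc l)) * \<beta> ^ P l"
      using \<beta> by (simp add: Y_def P_def power_add)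
    also have "\<dots> = Y l - a l" using \<beta> by (simp add: Y_def Z_def algebra_simps)
    finally show ?thesis by simp
  qed
  have Y: "Y l \<in> {0..<1}" for l
  proof -
    have "Y (Suc l) / \<beta> ^ M l \<le> 1 / \<beta> ^ M l" using Y01[of "Suc l"] pos[of "M l"] by (intro divide_right_mono) auto
    then show ?thesis using step[of l] strict[of l] Y01[of l] by auto
  qed
  have "Y 0 = z" by (simp add: Y_def Z_def P_def)
  then have "(beta_map \<beta> ^^ P l) (Y 0) = Y l" for l
    using Z[of l] Y[of l] unfolding branch_def by (metis zY)
  then show thesis using that[OF Y step] by (simp add: P_def)
qed

lemma nat_between_partial_sums:
  fixes P :: "nat \<Rightarrow> nat"
  assumes "P 0 \<le> N" "\<And>l. l \<le> P l"
  shows "\<exists>l. P l \<le> N \<and> N < P (Suc l)"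
proof -
  have ex: "N < P (Suc N)" using assms(2)[of "Suc N"] by simp
  define l where "l = (LEAST l. N < P (Suc l))"
  have "N < P (Suc l)" unfolding l_def using ex by (rule LeastI)
  moreover have "P l \<le> N"
  proof (cases l)
    case (Suc j)
    then show ?thesis using not_less_Least[of j "\<lambda>l. N < P (Suc l)"] by (simp add: l_def)
  qed (simp add: assms)
  ultimately show ?thesis by blast
qed

text \<open>The orbit runs through blocks of quality \<open>\<sigma> l\<close>. At the end of a
  block the accumulated deviation \<open>E\<close> is a small fraction of the elapsed time, up to a
  constant; inside a block it changes by at most the block length, which is small against the number
  of earlier blocks and hence against the time.\<close>

theorem exists_generic_point:
  assumes \<beta>: "\<beta> > 1" and \<mu>: "borel_prob_unit \<mu>" and inv: "beta_invariant \<beta> \<mu>"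
  obtains z where "z \<in> {0..<1}" "\<And>f. 1-lipschitz_on {0..1} f \<Longrightarrow>
    (\<lambda>N. (\<Sum>i<N. f ((beta_map \<beta> ^^ i) z)) / real N) \<longlonglongrightarrow> integral\<^sup>L \<mu> f"
proof -
  let ?T = "\<lambda>i. beta_map \<beta> ^^ i"
  define good where "good e n c \<longleftrightarrow> n \<ge> 1 \<and> branch \<beta> n c \<and> c + 1 / \<beta> ^ n < 1 \<and>
    (\<forall>y f. y \<in> {0..<1} \<longrightarrow> 1-lipschitz_on {0..1} f \<longrightarrow>
      \<bar>(\<Sum>i<n. f (?T i (c + y / \<beta> ^ n))) - real n * integral\<^sup>L \<mu> f\<bar> \<le> e * real n)" for e n c
  have "\<exists>n c. good (1 / real (Suc j)) n c" for j
  proof -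
    have "0 < 1 / real (Suc j)" by simp
    from approximating_block[OF \<beta> \<mu> inv this] show ?thesis unfolding good_def by metis
  qed
  then obtain L C where LC: "\<And>j. good (1 / real (Suc j)) (L j) (C j)" by metis
  obtain \<sigma> where \<sigma>: "\<And>J. \<forall>\<^sub>F l in sequentially. \<sigma> l \<ge> J \<and> J * L (\<sigma> l) \<le> l"
    using slow_selection[of L] by blast
  define M where "M l = L (\<sigma> l)" for l
  define a where "a l = C (\<sigma> l)" for l
  have g: "good (1 / real (Suc (\<sigma> l))) (M l) (a l)" for l unfolding M_def a_def by (rule LC)
  obtain Y where Y: "\<And>l. Y l \<in> {0..<1}" "\<And>l. Y l = a l + Y (Suc l) / \<beta> ^ M l"
    "\<And>l. ?T (\<Sum>j<l. M j) (Y 0) = Y l"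
    using infinite_branch[OF \<beta>, of M a] g unfolding good_def by blast
  define P where "P l = (\<Sum>j<l. M j)" for l
  have M1: "1 \<le> M l" for l using g[of l] by (simp add: good_def)
  have P_ge: "l \<le> P l" for l
  proof (induction l)
    case (Suc l)
    then show ?case using M1[of l] by (simp add: P_def)
  qed simp
  have P_Suc: "P (Suc l) = P l + M l" for l by (simp add: P_def)
  show thesis
  proof (rule that[OF Y(1)[of 0]])
    fix f :: "real \<Rightarrow> real" assume f: "1-lipschitz_on {0..1} f"
    define E where "E N = (\<Sum>i<N. f (?T i (Y 0)) - integral\<^sup>L \<mu> f)" for N
    have Y0: "Y 0 \<in> {0..1}" using Y(1)[of 0] by auto
    have one: "\<bar>f (?T i (Y 0)) - integral\<^sup>L \<mu> f\<bar> \<le> 1" for i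
      by (rule lipschitz_integral(2)[OF \<beta> \<mu> inv f beta_orbit_unit[OF Y0]])
    have E_add: "\<bar>E (m + n) - E m\<bar> \<le> real n" for m n
    proof -
      have "E (m + n) - E m = (\<Sum>i<n. f (?T (m + i) (Y 0)) - integral\<^sup>L \<mu> f)"
        unfolding E_def sum_lessThan_add by simp
      also have "\<bar>\<dots>\<bar> \<le> (\<Sum>i<n. \<bar>f (?T (m + i) (Y 0)) - integral\<^sup>L \<mu> f\<bar>)" by (rule sum_abs)
      also have "\<dots> \<le> (\<Sum>i<n. 1)" by (intro sum_mono one)
      finally show ?thesis by simp
    qed
    have E_block: "\<bar>E (P (Suc l)) - E (P l)\<bar> \<le> 1 / real (Suc (\<sigma> l)) * real (M l)" for l
    proof -
      have T: "?T (P l + i) (Y 0) = ?T i (a l + Y (Suc l) / \<beta> ^ M l)" for i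
      proof -
        have "?T (P l + i) (Y 0) = ?T i (?T (P l) (Y 0))"
          by (simp only: add.commute[of "P l"] funpow_add comp_def)
        also have "?T (P l) (Y 0) = a l + Y (Suc l) / \<beta> ^ M l"
          unfolding P_def Y(3) by (rule Y(2))
        finally show ?thesis .
      qed
      have "E (P (Suc l)) - E (P l) = (\<Sum>i<M l. f (?T i (a l + Y (Suc l) / \<beta> ^ M l)) - integral\<^sup>L \<mu> f)"
        unfolding E_def P_Suc sum_lessThan_add T by simp
      then have "E (P (Suc l)) - E (P l) =
          (\<Sum>i<M l. f (?T i (a l + Y (Suc l) / \<beta> ^ M l))) - real (M l) * integral\<^sup>L \<mu> f"
        by (simp add: sum_subtractf)
      then show ?thesis using g[of l] Y(1)[of "Suc l"] f unfolding good_def by presburger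
    qed
    have lim: "(\<lambda>N. E N / real N) \<longlonglongrightarrow> 0"
    proof (rule LIMSEQ_I)
      fix r :: real assume r: "0 < r"
      obtain J :: nat where J: "4 / r < real J" using reals_Archimedean2 by blast
      then have J0: "0 < real J" using r by (meson divide_pos_pos less_trans zero_less_numeral)
      define e where "e = 1 / real J"
      have e: "0 < e" "4 * e < r" using J J0 r by (auto simp: e_def field_simps)
      obtain l0 where l0: "\<And>l. l \<ge> l0 \<Longrightarrow> \<sigma> l \<ge> J \<and> J * M l \<le> l"
        using \<sigma>[of J] unfolding eventually_sequentially M_def by blast
      have small: "1 / real (Suc (\<sigma> l)) \<le> e" "real (M l) \<le> e * real l" if "l \<ge> l0" for l
      proof -
        have "real J \<le> real (Suc (\<sigma> l))" using l0[OF that] by simp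
        then show "1 / real (Suc (\<sigma> l)) \<le> e" unfolding e_def using J0 by (intro divide_left_mono) auto
        have "real J * real (M l) \<le> real l" using l0[OF that] by (metis of_nat_le_iff of_nat_mult)
        then show "real (M l) \<le> e * real l" using J0 by (simp add: e_def field_simps)
      qed
      have cut: "\<bar>E (P l)\<bar> \<le> real (P l0) + e * real (P l)" if "l \<ge> l0" for l
        using that
      proof (induction l rule: dec_induct)
        case base
        have "\<bar>E (P l0)\<bar> \<le> real (P l0)" using E_add[of 0 "P l0"] by (simp add: E_def)
        then show ?case using e by (simp add: add_increasing2)
      next
        case (step l)
        have "\<bar>E (P (Suc l)) - E (P l)\<bar> \<le> e * real (M l)"
          using E_block[of l] small(1)[OF step.hyps(1)] mult_right_mono[of _ e "real (M l)"]
          by (meson of_nat_0_le_iff order_trans)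
        then show ?case using step.IH unfolding P_Suc of_nat_add distrib_left by linarith
      qed
      \<comment> \<open>From here on the uncontrolled initial part is at most e * N. Completed
        blocks and the current incomplete one add at most e * N each, and 4 * e < r leaves room for
        strictness.\<close>
      define N0 where "N0 = max (P l0) (nat \<lceil>real (P l0) / e\<rceil> + 1)"
      have "\<bar>E N\<bar> < r * real N" if N: "N \<ge> N0" for N
      proof -
        obtain l where l: "P l \<le> N" "N < P (Suc l)"
          using nat_between_partial_sums[of P N] P_ge by (auto simp: P_def)
        have "l0 \<le> l"
        proof (rule ccontr)
          assume "\<not> l0 \<le> l"
          then have "Suc l \<le> l0" by simp
          then have "P (Suc l) \<le> P l0" unfolding P_def by (intro sum_mono2) auto
          then show False using l N by (simp add: N0_def)
        qed
        have "\<bar>E N - E (P l)\<bar> \<le> real (N - P l)" using E_add[of "P l" "N - P l"] l by simp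
        also have "\<dots> \<le> real (M l)" using l unfolding P_Suc by simp
        also have "\<dots> \<le> e * real l" by (rule small(2)[OF \<open>l0 \<le> l\<close>])
        also have "\<dots> \<le> e * real N" using P_ge[of l] l e by (intro mult_left_mono) auto
        finally have 1: "\<bar>E N - E (P l)\<bar> \<le> e * real N" .
        have 2: "e * real (P l) \<le> e * real N" using l e by (intro mult_left_mono) auto
        have "real (P l0) / e \<le> real N" using N by (simp add: N0_def) linarith
        then have 3: "real (P l0) \<le> e * real N" using e by (simp add: field_simps)
        have "0 < real N" using N by (simp add: N0_def)
        then have "4 * e * real N < r * real N" using e by (intro mult_strict_right_mono)
        moreover have "0 \<le> e * real N" using e by simp
        ultimately show ?thesis using 1 2 3 cut[OF \<open>l0 \<le> l\<close>] by linarith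
      qed
      moreover have "0 < N0" by (simp add: N0_def)
      ultimately show "\<exists>N0. \<forall>N\<ge>N0. norm (E N / real N - 0) < r"
        by (intro exI[of _ N0]) (auto simp: abs_divide divide_less_eq)
    qed
    have eq: "(\<Sum>i<N. f (?T i (Y 0))) / real N = E N / real N + integral\<^sup>L \<mu> f" if "N > 0" for N
      using that by (simp add: E_def sum_subtractf diff_divide_distrib)
    have "(\<lambda>N. E N / real N + integral\<^sup>L \<mu> f) \<longlonglongrightarrow> integral\<^sup>L \<mu> f"
      using tendsto_add[OF lim tendsto_const[of "integral\<^sup>L \<mu> f"]] by simp
    then show "(\<lambda>N. (\<Sum>i<N. f (?T i (Y 0))) / real N) \<longlonglongrightarrow> integral\<^sup>L \<mu> f"
      by (rule Lim_transform_eventually) (use eq in \<open>auto simp: eventually_sequentially intro!: exI[of _ 1]\<close>)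
  qed
qed

section \<open>Zones of modified digits\<close>

definition stage_row :: "nat \<Rightarrow> nat" where "stage_row k = fst (prod_decode k)"

text \<open>Factorials serve two purposes: \<open>start k\<close> is divisible by every
  \<open>Suc m\<close> with \<open>m \<le> k\<close>, so zone lengths are exact fractions, and the
  ratio of consecutive starts tends to infinity, so each zone begins with all earlier ones
  negligible.\<close>

definition start :: "nat \<Rightarrow> nat" where "start k = fact (Suc k)"

definition zone :: "(nat \<Rightarrow> bool) \<Rightarrow> nat set" where
  "zone x = (\<Union>k\<in>{k. x k}. {start k..<start k + start k div Suc (stage_row k)})"

lemma infinite_stage_row: "infinite {k. stage_row k = m}"
proof -
  have "inj (\<lambda>j. prod_encode (m, j))" by (simp add: inj_on_def)
  then have "infinite (range (\<lambda>j. prod_encode (m, j)))" by (rule range_inj_infinite)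
  moreover have "range (\<lambda>j. prod_encode (m, j)) \<subseteq> {k. stage_row k = m}" by (auto simp: stage_row_def)
  ultimately show ?thesis by (rule infinite_super[rotated])
qed

lemma start_pos: "0 < start k" and start_gt: "k < start k" and start_Suc: "start (Suc k) = (k + 2) * start k"
  using fact_ge_self[of "Suc k"] by (simp_all add: start_def)

lemma start_mono: "k \<le> l \<Longrightarrow> start k \<le> start l"
  unfolding start_def by (rule fact_mono_nat) simp

lemma zone_length: "m \<le> k \<Longrightarrow> start k div Suc m * Suc m = start k"
  unfolding start_def by (rule dvd_div_mult_self) (rule dvd_fact, auto)

lemma zone_end: "start k + start k div m \<le> 2 * start k"
  using div_le_dividend[of "start k" m] by simp

text \<open>A zone is at most as long as its starting position, so all zones up to index
  \<open>k\<close> end by \<open>2 * start k\<close>. The long gaps will force every limit of zone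
  averages to be 0.\<close>

lemma zone_gap:
  assumes "2 * start k \<le> i" "i < start (Suc k)"
  shows "i \<notin> zone x"
proof
  assume "i \<in> zone x"
  then obtain j where j: "start j \<le> i" "i < start j + start j div Suc (stage_row j)"
    by (auto simp: zone_def)
  show False
  proof (cases "j \<le> k")
    case True
    then show False using j(2) zone_end[of j "Suc (stage_row j)"] start_mono[OF True] assms(1) by linarith
  next
    case False
    then show False using start_mono[of "Suc k" j] j(1) assms(2) by simp
  qed
qed

lemma zone_initial:
  assumes "N < start (Suc (Suc k))"
  shows "zone x \<inter> {..<N} \<subseteq> {..<2 * start k} \<union>
    (if x (Suc k) then {start (Suc k)..<start (Suc k) + start (Suc k) div Suc (stage_row (Suc k))} else {})"
proof
  fix i assume i: "i \<in> zone x \<inter> {..<N}"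
  then obtain j where j: "x j" "start j \<le> i" "i < start j + start j div Suc (stage_row j)"
    by (auto simp: zone_def)
  have "j \<le> Suc k"
    using j(2) i assms start_mono[of "Suc (Suc k)" j] by (cases "j \<le> Suc k") auto
  then consider "j = Suc k" | "j \<le> k" by linarith
  then show "i \<in> {..<2 * start k} \<union>
    (if x (Suc k) then {start (Suc k)..<start (Suc k) + start (Suc k) div Suc (stage_row (Suc k))} else {})"
  proof cases
    case 1
    then show ?thesis using j by auto
  next
    case 2
    have "i < 2 * start k" using j(3) zone_end[of j "Suc (stage_row j)"] start_mono[OF 2] by linarith
    then show ?thesis by simp
  qed
qed

text \<open>Everything before the latest zone fits below \<open>2 * start k\<close>, the fraction 2
  / (k + 2) of \<open>start (Suc k)\<close>. Only the latest zone can contribute a proportion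
  bounded away from 0.\<close>

lemma zone_density_le:
  assumes "start (Suc k) \<le> N" "N < start (Suc (Suc k))"
  shows "real (card (zone x \<inter> {..<N})) / real N
    \<le> 2 / real (k + 2) + (if x (Suc k) then 1 / real (Suc (stage_row (Suc k))) else 0)"
proof -
  let ?t = "start (Suc k)" and ?r = "Suc (stage_row (Suc k))"
  have "card (zone x \<inter> {..<N}) \<le> card ({..<2 * start k} \<union> (if x (Suc k) then {?t..<?t + ?t div ?r} else {}))"
    by (intro card_mono zone_initial assms(2)) auto
  also have "\<dots> \<le> card {..<2 * start k} + card (if x (Suc k) then {?t..<?t + ?t div ?r} else {})"
    by (rule card_Un_le)
  also have "\<dots> = 2 * start k + (if x (Suc k) then ?t div ?r else 0)" by simp
  finally have "real (card (zone x \<inter> {..<N})) \<le> real (2 * start k + (if x (Suc k) then ?t div ?r else 0))"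
    by (rule of_nat_mono)
  also have "\<dots> = real ?t * (2 / real (k + 2)) + (if x (Suc k) then real (?t div ?r) else 0)"
    by (simp add: start_Suc field_simps)
  also have "\<dots> \<le> real ?t * (2 / real (k + 2)) + real ?t * (if x (Suc k) then 1 / real ?r else 0)"
    using of_nat_div_le_of_nat[of ?t ?r, where 'a = real] by simp
  also have "\<dots> = real ?t * (2 / real (k + 2) + (if x (Suc k) then 1 / real ?r else 0))"
    by (simp only: distrib_left)
  also have "\<dots> \<le> real N * (2 / real (k + 2) + (if x (Suc k) then 1 / real ?r else 0))"
    using assms(1) by (intro mult_right_mono) auto
  finally show ?thesis using assms(1) start_pos[of "Suc k"] by (simp add: divide_le_eq mult.commute)
qed

text \<open>If rows are finite, eventually only zones of rows beyond \<open>m\<close> are selected,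
  and each contributes at most 1 / Suc m to the density.\<close>

lemma zone_density:
  assumes fin: "\<And>m. finite {k. x k \<and> stage_row k = m}"
  shows "(\<lambda>N. real (card (zone x \<inter> {..<N})) / real N) \<longlonglongrightarrow> 0"
proof (rule LIMSEQ_I)
  fix e :: real assume e: "0 < e"
  obtain m where m: "1 / real (Suc m) < e / 2" using nat_approx_posE[of "e / 2"] e by auto
  have "finite (\<Union>l\<le>m. {k. x k \<and> stage_row k = l})" using fin by blast
  then obtain k0 where k0: "\<And>k. k \<in> (\<Union>l\<le>m. {k. x k \<and> stage_row k = l}) \<Longrightarrow> k \<le> k0"
    unfolding finite_nat_set_iff_bounded_le by blast
  define K where "K = Suc (max k0 (2 * Suc m))"
  have "norm (real (card (zone x \<inter> {..<N})) / real N - 0) < e" if N: "N \<ge> start K" for N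
  proof -
    have "start 0 \<le> N" using N start_mono[of 0 K] by simp
    then obtain l where l: "start l \<le> N" "N < start (Suc l)"
      using nat_between_partial_sums[of start N] start_gt less_imp_le by blast
    have "K \<le> l" using l(2) N start_mono[of "Suc l" K] by (cases "K \<le> l") auto
    then obtain k where k: "l = Suc k" "k \<ge> max k0 (2 * Suc m)" unfolding K_def by (cases l) auto
    have "2 / real (k + 2) \<le> 2 / real (2 * Suc m)" using k(2) by (intro divide_left_mono) auto
    also have "\<dots> = 1 / real (Suc m)" by (simp add: field_simps)
    finally have 1: "2 / real (k + 2) < e / 2" using m by linarith
    have 2: "(if x (Suc k) then 1 / real (Suc (stage_row (Suc k))) else 0) < e / 2"
    proof (cases "x (Suc k)")
      case True
      have "\<not> stage_row (Suc k) \<le> m" using k0[of "Suc k"] True k(2) by auto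
      then have "1 / real (Suc (stage_row (Suc k))) \<le> 1 / real (Suc m)" by (intro divide_left_mono) auto
      then show ?thesis using True m by simp
    qed (use e in simp)
    show ?thesis using zone_density_le[of k N x] l 1 2 unfolding k(1) by (simp add: abs_of_nonneg)
  qed
  then show "\<exists>M. \<forall>N\<ge>M. norm (real (card (zone x \<inter> {..<N})) / real N - 0) < e" by blast
qed

text \<open>Suppose the zone part \<open>u\<close> has average limit \<open>c\<close>. Across the
  gap from \<open>2 * start k\<close> to \<open>start (Suc k)\<close> the sum \<open>u\<close> is
  constant while time grows by an unbounded factor, so \<open>c = 0\<close> and the remaining part
  \<open>v\<close> has average limit \<open>A\<close>. Across a zone of row \<open>m\<close>,
  however, \<open>v\<close> is constant while time grows by the fixed factor
  \<open>1 + \<rho>\<close>, so (1 + \<rho>) * A = A, contradicting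
  \<open>A \<noteq> 0\<close>.\<close>

lemma zone_not_convergent:
  fixes e :: "nat \<Rightarrow> real"
  assumes avg: "(\<lambda>N. (\<Sum>i<N. e i) / real N) \<longlonglongrightarrow> A" and A: "A \<noteq> 0"
    and inf: "infinite {k. x k \<and> stage_row k = m}"
  shows "\<not> convergent (\<lambda>N. (\<Sum>i<N. if i \<in> zone x then e i else 0) / real N)"
proof
  define u where "u N = (\<Sum>i<N. if i \<in> zone x then e i else 0)" for N
  define v where "v N = (\<Sum>i<N. if i \<in> zone x then 0 else e i)" for N
  assume "convergent (\<lambda>N. (\<Sum>i<N. if i \<in> zone x then e i else 0) / real N)"
  then obtain c where c: "(\<lambda>N. u N / real N) \<longlonglongrightarrow> c" by (auto simp: convergent_def u_def)
  have start_lim: "filterlim start at_top sequentially"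
    by (rule filterlim_at_top_mono[OF filterlim_ident]) (use start_gt in \<open>auto intro: always_eventually less_imp_le\<close>)
  have u_gap: "u (start (Suc k)) = u (2 * start k)" for k
    unfolding u_def
    by (rule sum.mono_neutral_right) (use zone_gap[of k _ x] start_Suc[of k] in \<open>auto simp: not_less\<close>)
  have "u (start (Suc k)) / real (start (Suc k)) = u (2 * start k) / real (2 * start k) * (2 / real (k + 2))" for k
  proof -
    have "real (start (Suc k)) = real (2 * start k) * (real (k + 2) / 2)"
      by (simp add: start_Suc field_simps)
    then show ?thesis unfolding u_gap by simp
  qed
  moreover have "(\<lambda>k. u (start (Suc k)) / real (start (Suc k))) \<longlonglongrightarrow> c"
    by (rule filterlim_compose[OF c filterlim_compose[OF start_lim filterlim_Suc]])
  moreover have "(\<lambda>k. u (2 * start k) / real (2 * start k) * (2 / real (k + 2))) \<longlonglongrightarrow> c * 0"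
  proof (intro tendsto_mult)
    have "filterlim (\<lambda>k. 2 * start k) at_top sequentially"
      by (rule filterlim_at_top_mono[OF start_lim]) auto
    then show "(\<lambda>k. u (2 * start k) / real (2 * start k)) \<longlonglongrightarrow> c" by (rule filterlim_compose[OF c])
    show "(\<lambda>k. 2 / real (k + 2)) \<longlonglongrightarrow> 0" 
      using LIMSEQ_ignore_initial_segment[OF lim_const_over_n[of "2 :: real"], of 2] by simp
  qed
  ultimately have "c = 0" using LIMSEQ_unique by fastforce
  moreover have "(\<lambda>N. (\<Sum>i<N. e i) / real N - u N / real N) \<longlonglongrightarrow> A - c"
    by (rule tendsto_diff[OF avg c])
  moreover have "(\<Sum>i<N. e i) / real N - u N / real N = v N / real N" for N
    unfolding u_def v_def diff_divide_distrib[symmetric] sum_subtractf[symmetric]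
    by (intro arg_cong2[where f="(/)"] sum.cong refl) auto
  ultimately have v: "(\<lambda>N. v N / real N) \<longlonglongrightarrow> A" by simp
  define \<rho> where "\<rho> = 1 / real (Suc m)"
  define s where "s k = start k + start k div Suc m" for k
  have s_lim: "filterlim s at_top sequentially"
    by (rule filterlim_at_top_mono[OF start_lim]) (simp add: s_def)
  have "(\<lambda>k. (1 + \<rho>) * (v (s k) / real (s k)) - v (start k) / real (start k)) \<longlonglongrightarrow> (1 + \<rho>) * A - A"
    by (intro tendsto_intros filterlim_compose[OF v s_lim] filterlim_compose[OF v start_lim])
  moreover have "(1 + \<rho>) * A - A \<noteq> 0" using A by (simp add: \<rho>_def distrib_right)
  ultimately have "\<forall>\<^sub>F k in sequentially. (1 + \<rho>) * (v (s k) / real (s k)) - v (start k) / real (start k) \<noteq> 0"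
    by (rule tendsto_imp_eventually_ne)
  then obtain K where K: "\<And>k. k \<ge> K \<Longrightarrow> (1 + \<rho>) * (v (s k) / real (s k)) - v (start k) / real (start k) \<noteq> 0"
    unfolding eventually_sequentially by blast
  \<comment> \<open>\<open>k \<ge> m\<close> ensures that \<open>Suc m\<close> divides
    \<open>start k\<close>, so the zone has length exactly \<rho> * start k.\<close>
  obtain k where k: "k \<ge> max K m" "x k" "stage_row k = m"
    using inf unfolding infinite_nat_iff_unbounded_le by blast
  have "real (start k) = real (start k div Suc m) * real (Suc m)"
    using zone_length[of m k] k(1) by (metis max.bounded_iff of_nat_mult)
  then have "real (start k div Suc m) = real (start k) * \<rho>" by (simp add: \<rho>_def)
  then have s: "real (s k) = (1 + \<rho>) * real (start k)" by (simp add: s_def distrib_right mult.commute)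
  have "v (s k) = v (start k)"
    unfolding v_def
  proof (rule sum.mono_neutral_right)
    have "i \<in> zone x" if "start k \<le> i" "i < s k" for i
      using k that unfolding zone_def s_def by auto
    then show "\<forall>i\<in>{..<s k} - {..<start k}. (if i \<in> zone x then 0 else e i) = 0" by auto
  qed (auto simp: s_def)
  moreover have "0 < 1 + \<rho>" by (simp add: \<rho>_def add_pos_pos)
  ultimately have "(1 + \<rho>) * (v (s k) / real (s k)) = v (start k) / real (start k)" unfolding s by simp
  then show False using K[of k] k(1) by simp
qed

text \<open>Zone \<open>k\<close> starts after position \<open>k\<close>, so the first
  \<open>n\<close> positions see only the first \<open>n\<close> entries of the binary sequence.
  This is the continuity of the reduction on the level of digits.\<close>

lemma zone_prefix:
  assumes "\<And>k. k < n \<Longrightarrow> x k = x' k" "i < n"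
  shows "i \<in> zone x \<longleftrightarrow> i \<in> zone x'"
proof -
  have "x k = x' k" if "start k \<le> i" for k
    using start_gt[of k] that assms by (intro assms(1)) simp
  then show ?thesis unfolding zone_def by auto
qed

section \<open>Masked expansions\<close>

text \<open>The tails \<open>y\<close> are carried along with the digits. Demanding that every tail
  lie in \<open>{0..<1}\<close> forces \<open>D\<close> to be the digit sequence produced by the
  map, which replaces Parry's lexicographic admissibility condition. Indices start at 0, one lower
  than for \<open>beta_digit\<close>.\<close>

definition expansion :: "real \<Rightarrow> (nat \<Rightarrow> int) \<Rightarrow> (nat \<Rightarrow> real) \<Rightarrow> bool" where
  "expansion \<beta> D y \<longleftrightarrow> (\<forall>i. y i \<in> {0..<1} \<and> \<beta> * y i = of_int (D i) + y (Suc i))"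

lemma expansion_range: "expansion \<beta> D y \<Longrightarrow> y i \<in> {0..<1}"
  and expansion_step: "expansion \<beta> D y \<Longrightarrow> \<beta> * y i = of_int (D i) + y (Suc i)"
  unfolding expansion_def by blast+

lemma expansion_orbit:
  assumes "expansion \<beta> D y" shows "(beta_map \<beta> ^^ i) (y 0) = y i"
proof (induction i)
  case (Suc i)
  have "beta_map \<beta> (y i) = y (Suc i)"
    using expansion_step[OF assms, of i] expansion_range[OF assms, of "Suc i"]
    by (simp add: beta_map_def frac_unique_iff)
  then show ?case using Suc by simp
qed simp

lemma expansion_floor:
  assumes "expansion \<beta> D y" shows "D i = \<lfloor>\<beta> * y i\<rfloor>"
  using expansion_range[OF assms, of "Suc i"]
  unfolding expansion_step[OF assms, of i] by (intro floor_unique[symmetric]) auto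

lemma expansion_digit:
  assumes "expansion \<beta> D y" shows "beta_digit \<beta> (y 0) (Suc i) = D i"
  using expansion_floor[OF assms, of i] by (simp add: beta_digit_def expansion_orbit[OF assms])

lemma orbit_expansion:
  assumes "x \<in> {0..<1}"
  shows "expansion \<beta> (\<lambda>i. \<lfloor>\<beta> * (beta_map \<beta> ^^ i) x\<rfloor>) (\<lambda>i. (beta_map \<beta> ^^ i) x)"
  unfolding expansion_def
proof (intro allI conjI)
  fix i
  show "(beta_map \<beta> ^^ i) x \<in> {0..<1}" using assms by (cases i) (simp_all add: beta_map_def frac_lt_1)
  show "\<beta> * (beta_map \<beta> ^^ i) x = of_int \<lfloor>\<beta> * (beta_map \<beta> ^^ i) x\<rfloor> + (beta_map \<beta> ^^ Suc i) x"
    by (simp add: beta_map_def frac_def)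
qed

lemma zero_expansion: "expansion \<beta> (\<lambda>_. 0) (\<lambda>_. 0)"
  by (simp add: expansion_def)

definition mask :: "(nat \<Rightarrow> int) \<Rightarrow> nat set \<Rightarrow> nat \<Rightarrow> int" where
  "mask e Z i = (if i \<in> Z then e i else 0)"

definition mask_point :: "real \<Rightarrow> (nat \<Rightarrow> int) \<Rightarrow> nat set \<Rightarrow> nat \<Rightarrow> real" where
  "mask_point \<beta> e Z i = (\<Sum>j. of_int (mask e Z (i + j)) / \<beta> ^ Suc j)"

context
  fixes \<beta> :: real
  assumes \<beta>: "\<beta> > 1"
begin

lemma expansion_nonneg:
  assumes "expansion \<beta> D y" shows "0 \<le> D i"
  using expansion_floor[OF assms, of i] expansion_range[OF assms, of i] \<beta> by simp

lemma expansion_le: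
  assumes "expansion \<beta> D y" shows "real_of_int (D i) \<le> \<beta>"
proof -
  have "real_of_int (D i) \<le> \<beta> * y i" using expansion_floor[OF assms, of i] by simp
  also have "\<dots> \<le> \<beta> * 1" using expansion_range[OF assms, of i] \<beta> by (intro mult_left_mono) auto
  finally show ?thesis by simp
qed

lemma expansion_partial_sum:
  assumes "expansion \<beta> D y"
  shows "y i = (\<Sum>j<n. of_int (D (i + j)) / \<beta> ^ Suc j) + y (i + n) / \<beta> ^ n"
proof (induction n)
  case (Suc n)
  have "y (i + n) = (of_int (D (i + n)) + y (Suc (i + n))) / \<beta>"
    using expansion_step[OF assms, of "i + n"] \<beta> by (simp add: field_simps)
  then have "y (i + n) / \<beta> ^ n = of_int (D (i + n)) / \<beta> ^ Suc n + y (i + Suc n) / \<beta> ^ Suc n"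
    by (simp add: add_divide_distrib)
  then show ?case using Suc by simp
qed simp

text \<open>Replacing digits by zero decreases all tails of the expansion, so no admissibility
  condition can be violated.\<close>

lemma expansion_mask:
  assumes e: "expansion \<beta> e r"
  shows "expansion \<beta> (mask e Z) (mask_point \<beta> e Z)"
proof -
  have pos: "0 < \<beta> ^ n" for n using \<beta> by simp
  have m: "0 \<le> mask e Z i" "mask e Z i \<le> e i" for i
    using expansion_nonneg[OF e, of i] by (auto simp: mask_def)
  have nonneg: "0 \<le> of_int (mask e Z (i + j)) / \<beta> ^ Suc j" for i j
    using m(1)[of "i + j"] pos[of "Suc j"] by (intro divide_nonneg_pos) auto
  have partial: "(\<Sum>j<n. of_int (mask e Z (i + j)) / \<beta> ^ Suc j) \<le> r i" for i n
  proof -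
    have "(\<Sum>j<n. of_int (mask e Z (i + j)) / \<beta> ^ Suc j) \<le> (\<Sum>j<n. of_int (e (i + j)) / \<beta> ^ Suc j)"
      using m(2) by (intro sum_mono divide_right_mono less_imp_le[OF pos]) simp
    also have "\<dots> \<le> r i"
    proof -
      have "0 \<le> r (i + n) / \<beta> ^ n" using expansion_range[OF e, of "i + n"] pos[of n] by simp
      then show ?thesis using expansion_partial_sum[OF e, of i n] by linarith
    qed
    finally show ?thesis .
  qed
  have summable: "summable (\<lambda>j. of_int (mask e Z (i + j)) / \<beta> ^ Suc j)" for i
    by (rule summableI_nonneg_bounded[OF nonneg partial])
  have "mask_point \<beta> e Z i \<in> {0..<1}" for i
  proof -
    have "mask_point \<beta> e Z i \<le> r i"
      unfolding mask_point_def by (rule suminf_le_const[OF summable partial])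
    moreover have "0 \<le> mask_point \<beta> e Z i"
      unfolding mask_point_def by (rule suminf_nonneg[OF summable nonneg])
    ultimately show ?thesis using expansion_range[OF e, of i] by auto
  qed
  moreover have "\<beta> * mask_point \<beta> e Z i = of_int (mask e Z i) + mask_point \<beta> e Z (Suc i)" for i
  proof -
    have "(\<Sum>j. of_int (mask e Z (i + Suc j)) / \<beta> ^ Suc (Suc j)) = mask_point \<beta> e Z i - of_int (mask e Z i) / \<beta>"
      unfolding mask_point_def using suminf_split_head[OF summable[of i]] by simp
    moreover have "(\<Sum>j. of_int (mask e Z (i + Suc j)) / \<beta> ^ Suc (Suc j)) = mask_point \<beta> e Z (Suc i) / \<beta>"
      unfolding mask_point_def
      using suminf_divide[OF summable[of "Suc i"], of \<beta>] by (simp add: mult.commute)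
    ultimately show ?thesis using \<beta> by (simp add: field_simps)
  qed
  ultimately show ?thesis by (simp add: expansion_def)
qed

text \<open>Digits lie between 0 and \<beta>, so the distances \<open>d\<close> satisfy \<beta> * d
  i \<le> d (Suc i), plus \<beta> where the digits differ. Summation telescopes: every changed digit
  displaces the whole orbit by a bounded total amount.\<close>

lemma expansion_close:
  assumes "expansion \<beta> D y" "expansion \<beta> D' y'"
  shows "(\<beta> - 1) * (\<Sum>i<N. \<bar>y i - y' i\<bar>) \<le> \<beta> * real (card {i. i < N \<and> D i \<noteq> D' i}) + 1"
proof -
  define d where "d i = \<bar>y i - y' i\<bar>" for i
  have d01: "0 \<le> d i" "d i \<le> 1" for i
    using expansion_range[OF assms(1), of i] expansion_range[OF assms(2), of i] by (auto simp: d_def)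
  have step: "\<beta> * d i \<le> (if D i \<noteq> D' i then \<beta> else 0) + d (Suc i)" for i
  proof -
    have "\<beta> * d i = \<bar>\<beta> * y i - \<beta> * y' i\<bar>"
      using \<beta> unfolding d_def right_diff_distrib[symmetric] abs_mult by simp
    also have "\<dots> = \<bar>(of_int (D i) - of_int (D' i)) + (y (Suc i) - y' (Suc i))\<bar>"
      unfolding expansion_step[OF assms(1)] expansion_step[OF assms(2)] by (simp add: algebra_simps)
    also have "\<dots> \<le> \<bar>of_int (D i) - of_int (D' i)\<bar> + d (Suc i)"
      unfolding d_def by (rule abs_triangle_ineq)
    also have "\<bar>of_int (D i) - of_int (D' i)\<bar> \<le> (if D i \<noteq> D' i then \<beta> else 0)"
      using expansion_le[OF assms(1), of i] expansion_le[OF assms(2), of i]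
        expansion_nonneg[OF assms(1), of i] expansion_nonneg[OF assms(2), of i] by auto
    finally show ?thesis by simp
  qed
  have "\<beta> * (\<Sum>i<N. d i) \<le> (\<Sum>i<N. (if D i \<noteq> D' i then \<beta> else 0) + d (Suc i))"
    unfolding sum_distrib_left by (intro sum_mono step)
  also have "\<dots> = (\<Sum>i<N. if D i \<noteq> D' i then \<beta> else 0) + (\<Sum>i<N. d (Suc i))" by (rule sum.distrib)
  also have "(\<Sum>i<N. d (Suc i)) = (\<Sum>i<N. d i) + d N - d 0"
    by (induction N) simp_all
  also have "(\<Sum>i<N. if D i \<noteq> D' i then \<beta> else 0) = \<beta> * real (card {i. i < N \<and> D i \<noteq> D' i})"
    by (simp add: sum.If_cases Int_def lessThan_def)
  finally show ?thesis using d01(1)[of 0] d01(2)[of N] unfolding d_def by (simp add: left_diff_distrib)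
qed

text \<open>Digit changes of density 0 move the orbit by a distance of average 0, so Lipschitz
  averages keep their limits.\<close>

lemma expansion_average_transfer:
  assumes y: "expansion \<beta> D y" and y': "expansion \<beta> D' y'"
    and close: "(\<lambda>N. real (card {i. i < N \<and> D i \<noteq> D' i}) / real N) \<longlonglongrightarrow> 0"
    and f: "1-lipschitz_on {0..1} f"
    and lim: "(\<lambda>N. (\<Sum>i<N. f (y' i)) / real N) \<longlonglongrightarrow> (c :: real)"
  shows "(\<lambda>N. (\<Sum>i<N. f (y i)) / real N) \<longlonglongrightarrow> c"
proof -
  define b where "b N = (\<beta> * (real (card {i. i < N \<and> D i \<noteq> D' i}) / real N) + 1 / real N) / (\<beta> - 1)" for N
  have b: "b \<longlonglongrightarrow> (\<beta> * 0 + 0) / (\<beta> - 1)"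
    unfolding b_def[abs_def] using \<beta> by (intro tendsto_intros close lim_const_over_n) auto
  then have b0: "b \<longlonglongrightarrow> 0" by simp
  have le_b: "\<bar>(\<Sum>i<N. f (y i)) / real N - (\<Sum>i<N. f (y' i)) / real N\<bar> \<le> b N" for N
  proof -
    have "\<bar>\<Sum>i<N. f (y i) - f (y' i)\<bar> \<le> (\<Sum>i<N. \<bar>f (y i) - f (y' i)\<bar>)" by (rule sum_abs)
    also have "\<dots> \<le> (\<Sum>i<N. \<bar>y i - y' i\<bar>)"
    proof (rule sum_mono)
      fix i
      show "\<bar>f (y i) - f (y' i)\<bar> \<le> \<bar>y i - y' i\<bar>"
        using expansion_range[OF y, of i] expansion_range[OF y', of i]
        by (intro lipschitz_le[OF f]) auto
    qed
    also have "\<dots> \<le> (\<beta> * real (card {i. i < N \<and> D i \<noteq> D' i}) + 1) / (\<beta> - 1)"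
      using expansion_close[OF y y', of N] \<beta> by (simp add: pos_le_divide_eq mult.commute)
    finally have "\<bar>\<Sum>i<N. f (y i) - f (y' i)\<bar> / real N
        \<le> (\<beta> * real (card {i. i < N \<and> D i \<noteq> D' i}) + 1) / (\<beta> - 1) / real N"
      by (rule divide_right_mono) simp
    then show ?thesis
      unfolding b_def diff_divide_distrib[symmetric] sum_subtractf[symmetric] abs_divide
      by (simp add: add_divide_distrib mult.commute)
  qed
  have "(\<lambda>N. (\<Sum>i<N. f (y i)) / real N - (\<Sum>i<N. f (y' i)) / real N) \<longlonglongrightarrow> 0"
    by (rule Lim_null_comparison[OF always_eventually b0]) (simp only: real_norm_def le_b simp_thms)
  from tendsto_add[OF this lim] show ?thesis by simp
qed

text \<open>Summing \<beta> * y i = D i + y (Suc i) telescopes. The average digit, a discontinuous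
  observable, is thereby controlled by the average of the identity function, to which weak
  convergence applies.\<close>

lemma digit_sum:
  assumes "expansion \<beta> D y"
  shows "(\<Sum>i<N. real_of_int (D i)) = (\<beta> - 1) * (\<Sum>i<N. y i) + y 0 - y N"
proof (induction N)
  case (Suc N)
  then show ?case using expansion_step[OF assms, of N] by (simp add: algebra_simps)
qed simp

lemma digit_average:
  assumes y: "expansion \<beta> D y" and lim: "(\<lambda>N. (\<Sum>i<N. y i) / real N) \<longlonglongrightarrow> c"
  shows "(\<lambda>N. (\<Sum>i<N. real_of_int (D i)) / real N) \<longlonglongrightarrow> (\<beta> - 1) * c"
proof -
  have "norm ((y 0 - y N) / real N) \<le> 1 / real N" for N
  proof -
    have "\<bar>y 0 - y N\<bar> \<le> 1" using expansion_range[OF y, of 0] expansion_range[OF y, of N] by auto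
    then show ?thesis by (simp add: abs_divide divide_right_mono)
  qed
  then have "(\<lambda>N. (y 0 - y N) / real N) \<longlonglongrightarrow> 0"
    by (intro Lim_null_comparison[OF _ lim_const_over_n[of 1]] always_eventually) auto
  from tendsto_add[OF tendsto_mult_left[OF lim, of "\<beta> - 1"] this] show ?thesis
    unfolding digit_sum[OF y] by (simp add: add_divide_distrib diff_divide_distrib add_diff_eq)
qed

lemma mask_point_close:
  assumes e: "expansion \<beta> e r" and agree: "\<And>i. i < n \<Longrightarrow> i \<in> Z \<longleftrightarrow> i \<in> Z'"
  shows "\<bar>mask_point \<beta> e Z 0 - mask_point \<beta> e Z' 0\<bar> \<le> 1 / \<beta> ^ n"
proof -
  have pos: "0 < \<beta> ^ n" using \<beta> by simp
  note y = expansion_mask[OF e, of Z] and y' = expansion_mask[OF e, of Z']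
  have "mask e Z i = mask e Z' i" if "i < n" for i using agree[OF that] by (simp add: mask_def)
  then have "mask_point \<beta> e Z 0 - mask_point \<beta> e Z' 0 = (mask_point \<beta> e Z n - mask_point \<beta> e Z' n) / \<beta> ^ n"
    using expansion_partial_sum[OF y, of 0 n] expansion_partial_sum[OF y', of 0 n]
    by (simp add: diff_divide_distrib)
  moreover have "\<bar>mask_point \<beta> e Z n - mask_point \<beta> e Z' n\<bar> \<le> 1"
    using expansion_range[OF y, of n] expansion_range[OF y', of n] by auto
  ultimately show ?thesis using pos by (simp add: abs_divide divide_right_mono)
qed

end

section \<open>Completeness\<close>

lemma tendsto_zero_sandwich:
  fixes f g :: "nat \<Rightarrow> real"
  assumes "\<And>N. 0 \<le> f N" "\<And>N. f N \<le> g N" "g \<longlonglongrightarrow> 0"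
  shows "f \<longlonglongrightarrow> 0"
  by (rule tendsto_sandwich[OF always_eventually always_eventually tendsto_const assms(3)]) (simp_all add: assms)

context
  fixes \<beta> :: real
  assumes \<beta>: "\<beta> > 1"
begin

text \<open>The word of \<open>n\<close> zeros followed by a one is repeated; the tails
  \<open>r\<close> are geometric sums and the average digit tends to 1 / K. For \<beta> close to 1
  the ones must be far apart.\<close>

lemma periodic_expansion:
  obtains e r and A :: real where "expansion \<beta> e r"
    "(\<lambda>N. (\<Sum>i<N. real_of_int (e i)) / real N) \<longlonglongrightarrow> A" "A \<noteq> 0"
proof -
  \<comment> \<open>Equivalent to \<open>\<beta> ^ n < \<beta> ^ Suc n - 1\<close>, which says that
    the largest tail, the one beginning with the digit 1, is below 1.\<close>
  obtain n where n: "1 / (\<beta> - 1) < \<beta> ^ n" using real_arch_pow[OF \<beta>] by blast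
  define K where "K = Suc n"
  have K1: "1 < \<beta> ^ K" unfolding K_def using \<beta> by (intro one_less_power) auto
  have big: "\<beta> ^ n < \<beta> ^ K - 1" using n \<beta> by (simp add: K_def field_simps)
  define e where "e i = (if i mod K = n then 1 else 0 :: int)" for i
  define r where "r i = \<beta> ^ (i mod K) / (\<beta> ^ K - 1)" for i
  have exp: "expansion \<beta> e r"
    unfolding expansion_def
  proof (intro allI conjI)
    fix i
    have "i mod K \<le> n" unfolding K_def by (metis less_Suc_eq_le mod_less_divisor zero_less_Suc)
    then have "\<beta> ^ (i mod K) \<le> \<beta> ^ n" using \<beta> by (intro power_increasing) auto
    then have "\<beta> ^ (i mod K) < \<beta> ^ K - 1" using big by linarith
    then show "r i \<in> {0..<1}" using K1 \<beta> by (simp add: r_def)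
    show "\<beta> * r i = of_int (e i) + r (Suc i)"
    proof (cases "i mod K = n")
      case True
      then have "Suc i mod K = 0" by (simp add: mod_Suc K_def)
      then show ?thesis using True K1 by (simp add: e_def r_def K_def field_simps)
    next
      case False
      then have "Suc i mod K = Suc (i mod K)" by (simp add: mod_Suc K_def)
      then show ?thesis using False by (simp add: e_def r_def)
    qed
  qed
  have sum: "(\<Sum>i<N. real_of_int (e i)) = real (N div K)" for N
  proof (induction N)
    case (Suc N)
    have "Suc (N mod K) = K \<longleftrightarrow> N mod K = n" by (simp add: K_def)
    then show ?case using Suc by (simp add: div_Suc mod_Suc e_def)
  qed simp
  have close: "norm (real (N div K) / real N - 1 / real K) \<le> 1 / real N" if "N \<ge> 1" for N
  proof -
    have "N mod K \<le> K" by (rule less_imp_le, rule mod_less_divisor) (simp add: K_def)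
    then have "real (N mod K) / real K \<le> 1" by (auto simp: divide_le_eq_1)
    moreover have "0 \<le> real (N mod K) / real K" by simp
    ultimately have "\<bar>real (N div K) - real N / real K\<bar> \<le> 1"
      using of_nat_of_nat_div_aux[of N K, where 'a = real] by linarith
    then have "\<bar>real (N div K) - real N / real K\<bar> / real N \<le> 1 / real N" by (rule divide_right_mono) simp
    moreover have "real (N div K) / real N - 1 / real K = (real (N div K) - real N / real K) / real N"
      using that by (simp add: diff_divide_distrib)
    ultimately show ?thesis by (simp only: real_norm_def abs_divide abs_of_nat)
  qed
  have "(\<lambda>N. real (N div K) / real N - 1 / real K) \<longlonglongrightarrow> 0"
    by (rule Lim_null_comparison[OF _ lim_const_over_n[of 1]])
      (use close in \<open>auto simp: eventually_sequentially intro!: exI[of _ 1]\<close>)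
  then have "(\<lambda>N. (\<Sum>i<N. real_of_int (e i)) / real N) \<longlonglongrightarrow> 1 / real K"
    unfolding sum by (subst LIM_zero_iff[symmetric])
  moreover have "1 / real K \<noteq> 0" by (simp add: K_def)
  ultimately show thesis using that[OF exp] by blast
qed

text \<open>Finitely many entries of the binary sequence determine the first \<open>n\<close>
  digits, and these determine the point up to 1 / \<beta> ^ n.\<close>

lemma mask_reduction_continuous:
  assumes e: "expansion \<beta> e r"
    and prefix: "\<And>n x x' i. (\<And>k. k < n \<Longrightarrow> x k = x' k) \<Longrightarrow> i < n \<Longrightarrow> i \<in> Z x \<longleftrightarrow> i \<in> Z x'"
    and U: "openin unit_top U" "mask_point \<beta> e (Z x) 0 \<in> U"
  shows "\<exists>n. \<forall>y::nat \<Rightarrow> bool. (\<forall>i<n. y i = x i) \<longrightarrow> mask_point \<beta> e (Z y) 0 \<in> U"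
proof -
  let ?\<phi> = "\<lambda>x. mask_point \<beta> e (Z x) 0"
  have range: "?\<phi> y \<in> {0..1}" for y
    using expansion_range[OF expansion_mask[OF \<beta> e, of "Z y"], of 0] by auto
  obtain W where W: "open W" "U = {0..1} \<inter> W" using U(1) by (auto simp: openin_open)
  obtain d where d: "0 < d" "\<And>u. dist u (?\<phi> x) < d \<Longrightarrow> u \<in> W"
    using W U(2) unfolding open_dist by blast
  obtain n where "1 / d < \<beta> ^ n" using real_arch_pow[OF \<beta>] by blast
  moreover have "0 < \<beta> ^ n" using \<beta> by simp
  ultimately have n: "1 / \<beta> ^ n < d" using d(1) by (simp add: field_simps)
  have "?\<phi> y \<in> U" if y: "\<forall>i<n. y i = x i" for y
  proof -
    have "\<bar>?\<phi> y - ?\<phi> x\<bar> \<le> 1 / \<beta> ^ n"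
      using y by (intro mask_point_close[OF \<beta> e] prefix[of n y x]) auto
    then have "dist (?\<phi> y) (?\<phi> x) < d" using n by (simp add: dist_real_def)
    then show ?thesis using d(2) range W(2) by blast
  qed
  then show ?thesis by blast
qed

text \<open>The common core of both lower bounds. \<open>Z = zone\<close> inserts digits into a
  sequence of zeros, the complement erases digits. All that is asked of \<open>Q\<close> is that
  finite rows imply it and that it implies convergence of the average digit.\<close>

lemma mask_not_Sigma03:
  assumes e: "expansion \<beta> e r"
    and avg: "(\<lambda>N. (\<Sum>i<N. real_of_int (e i)) / real N) \<longlonglongrightarrow> A" and A: "A \<noteq> 0"
    and Z: "Z = zone \<or> Z = (\<lambda>x. - zone x)"
    and good: "\<And>x. (\<And>m. finite {k. x k \<and> stage_row k = m}) \<Longrightarrow> Q (mask_point \<beta> e (Z x) 0)"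
    and conv: "\<And>x. Q (mask_point \<beta> e (Z x) 0) \<Longrightarrow>
      convergent (\<lambda>N. (\<Sum>i<N. real_of_int (mask e (Z x) i)) / real N)"
  shows "{x \<in> {0..1}. Q x} \<notin> Sigma0 unit_top 3"
proof (rule not_Sigma03_reduction[where \<phi> = "\<lambda>x. mask_point \<beta> e (Z x) 0" and row = stage_row])
  have range: "mask_point \<beta> e (Z x) 0 \<in> {0..1}" for x
    using expansion_range[OF expansion_mask[OF \<beta> e, of "Z x"], of 0] by auto
  show "infinite {k. stage_row k = m}" for m by (rule infinite_stage_row)
  show "mask_point \<beta> e (Z x) 0 \<in> topspace unit_top" for x using range by simp
  show "\<exists>n. \<forall>y. (\<forall>i<n. y i = x i) \<longrightarrow> mask_point \<beta> e (Z y) 0 \<in> U"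
    if "openin unit_top U" "mask_point \<beta> e (Z x) 0 \<in> U" for U x
  proof (rule mask_reduction_continuous[where Z = Z, OF e _ that])
    show "i \<in> Z x \<longleftrightarrow> i \<in> Z x'" if "\<And>k. k < n \<Longrightarrow> x k = x' k" "i < n" for n x x' i
      using zone_prefix[OF that] Z by auto
  qed
  show "mask_point \<beta> e (Z x) 0 \<in> {x \<in> {0..1}. Q x} \<longleftrightarrow> (\<forall>m. finite {k. x k \<and> stage_row k = m})" for x
  proof
    assume "\<forall>m. finite {k. x k \<and> stage_row k = m}"
    then show "mask_point \<beta> e (Z x) 0 \<in> {x \<in> {0..1}. Q x}" using good range by blast
  next
    assume "mask_point \<beta> e (Z x) 0 \<in> {x \<in> {0..1}. Q x}"
    then have c: "convergent (\<lambda>N. (\<Sum>i<N. real_of_int (mask e (Z x) i)) / real N)" using conv by blast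
    \<comment> \<open>Since the unmasked average converges, convergence of the part outside the
      zones is the same as convergence of the part inside; this reduces erasing to
      inserting.\<close>
    have split: "real_of_int (e i) = real_of_int (mask e (zone x) i) + real_of_int (mask e (- zone x) i)" for i
      by (simp add: mask_def)
    have "convergent (\<lambda>N. (\<Sum>i<N. real_of_int (mask e (zone x) i)) / real N)"
      using Z
    proof
      assume "Z = (\<lambda>x. - zone x)"
      then have "convergent (\<lambda>N. (\<Sum>i<N. real_of_int (mask e (- zone x) i)) / real N)" using c by simp
      moreover have "convergent (\<lambda>N. (\<Sum>i<N. real_of_int (e i)) / real N)"
        using avg by (auto simp: convergent_def)
      ultimately have "convergent (\<lambda>N. (\<Sum>i<N. real_of_int (e i)) / real N
          - (\<Sum>i<N. real_of_int (mask e (- zone x) i)) / real N)"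
        by (rule convergent_diff[rotated])
      then show ?thesis by (simp add: split sum.distrib add_divide_distrib)
    qed (use c in simp)
    moreover have "real_of_int (mask e (zone x) i) = (if i \<in> zone x then real_of_int (e i) else 0)" for i
      by (simp add: mask_def)
    ultimately have "convergent (\<lambda>N. (\<Sum>i<N. if i \<in> zone x then real_of_int (e i) else 0) / real N)"
      by simp
    then show "\<forall>m. finite {k. x k \<and> stage_row k = m}" using zone_not_convergent[OF avg A] by blast
  qed
qed

text \<open>For a generic point the average digit tends to \<beta> - 1 times the mean of \<mu>. If
  the mean is positive, digits of such a point are erased in the zones. If it is 0, then \<mu> is
  the point mass at 0, there is nothing to erase, and digits of a periodic expansion are inserted
  into zeros.\<close>

lemma generating_set_not_Sigma03:
  assumes \<mu>: "borel_prob_unit \<mu>" and inv: "beta_invariant \<beta> \<mu>"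
  shows "{x \<in> {0..1}. generates \<beta> \<mu> x} \<notin> Sigma0 unit_top 3"
proof -
  have reduce: ?thesis
    if e: "expansion \<beta> e r" and avg: "(\<lambda>N. (\<Sum>i<N. real_of_int (e i)) / real N) \<longlonglongrightarrow> A"
      and A: "A \<noteq> 0" and Z: "Z = zone \<or> Z = (\<lambda>x. - zone x)"
      and b: "expansion \<beta> D y" and D: "\<And>x i. i \<notin> zone x \<Longrightarrow> mask e (Z x) i = D i"
      and gen: "\<And>f. 1-lipschitz_on {0..1} f \<Longrightarrow> (\<lambda>N. (\<Sum>i<N. f (y i)) / real N) \<longlonglongrightarrow> integral\<^sup>L \<mu> f"
    for e r A Z D y
  proof (rule mask_not_Sigma03[OF e avg A Z])
    fix x
    note m = expansion_mask[OF \<beta> e, of "Z x"]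
    have y01: "mask_point \<beta> e (Z x) i \<in> {0..1}" for i using expansion_range[OF m, of i] by auto
    have gen_iff: "generates \<beta> \<mu> (mask_point \<beta> e (Z x) 0) \<longleftrightarrow> equidistributed \<mu> (mask_point \<beta> e (Z x))"
      using generates_iff_equidistributed[OF \<mu>, of \<beta> "mask_point \<beta> e (Z x) 0"] y01
      by (simp add: expansion_orbit[OF m])
    show "generates \<beta> \<mu> (mask_point \<beta> e (Z x) 0)" if fin: "\<And>m. finite {k. x k \<and> stage_row k = m}"
      unfolding gen_iff
    proof (rule equidistributed_if_Lipschitz[OF \<mu>])
      fix f :: "real \<Rightarrow> real" assume f: "1-lipschitz_on {0..1} f"
      have "card {i. i < N \<and> mask e (Z x) i \<noteq> D i} \<le> card (zone x \<inter> {..<N})" for N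
        by (intro card_mono) (use D in auto)
      then have "(\<lambda>N. real (card {i. i < N \<and> mask e (Z x) i \<noteq> D i}) / real N) \<longlonglongrightarrow> 0"
        by (intro tendsto_zero_sandwich[OF _ _ zone_density[OF fin]] divide_right_mono) auto
      then show "(\<lambda>N. (\<Sum>i<N. f (mask_point \<beta> e (Z x) i)) / real N) \<longlonglongrightarrow> integral\<^sup>L \<mu> f"
        by (rule expansion_average_transfer[OF \<beta> m b _ f gen[OF f]])
    qed
    assume "generates \<beta> \<mu> (mask_point \<beta> e (Z x) 0)"
    then have "equidistributed \<mu> (mask_point \<beta> e (Z x))" unfolding gen_iff .
    from equidistributed_imp_average[OF \<mu> y01 this continuous_on_id]
    have "(\<lambda>N. (\<Sum>i<N. mask_point \<beta> e (Z x) i) / real N) \<longlonglongrightarrow> integral\<^sup>L \<mu> (\<lambda>x. x)" by simp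
    from digit_average[OF \<beta> m this]
    show "convergent (\<lambda>N. (\<Sum>i<N. real_of_int (mask e (Z x) i)) / real N)" by (auto simp: convergent_def)
  qed
  have lip_id: "1-lipschitz_on {0..1} (\<lambda>x::real. x)" by (intro lipschitz_intros)
  show ?thesis
  proof (cases "integral\<^sup>L \<mu> (\<lambda>x. x) = 0")
    case False
    obtain z where z: "z \<in> {0..<1}" and gen: "\<And>f. 1-lipschitz_on {0..1} f \<Longrightarrow>
        (\<lambda>N. (\<Sum>i<N. f ((beta_map \<beta> ^^ i) z)) / real N) \<longlonglongrightarrow> integral\<^sup>L \<mu> f"
      using exists_generic_point[OF \<beta> \<mu> inv] by blast
    note e = orbit_expansion[OF z, of \<beta>]
    show ?thesis
    \<comment> \<open>The generic expansion plays both roles: its digits are erased in the zones,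
      and it is the reference with which the masked sequence agrees elsewhere.\<close>
    proof (rule reduce[OF e digit_average[OF \<beta> e gen[OF lip_id]] _ _ e _ gen])
      show "(\<beta> - 1) * integral\<^sup>L \<mu> (\<lambda>x. x) \<noteq> 0" using False \<beta> by simp
      show "(\<lambda>x. - zone x) = zone \<or> (\<lambda>x. - zone x) = (\<lambda>x. - zone x)" by simp
    qed (simp_all add: mask_def)
  next
    case True
    interpret prob_space \<mu> by (rule prob_mu[OF \<mu>])
    have int_id: "integrable \<mu> (\<lambda>x. x)" by (rule lipschitz_integral(1)[OF \<beta> \<mu> inv lip_id])
    \<comment> \<open>On the unit interval \<bar>f 0 - f x\<bar> \<le> x, so mean 0 forces \<mu> to
      integrate every test function like the point mass at 0.\<close>
    have f0: "f 0 = integral\<^sup>L \<mu> f" if f: "1-lipschitz_on {0..1} f" for f :: "real \<Rightarrow> real"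
    proof -
      have int: "integrable \<mu> f" by (rule lipschitz_integral(1)[OF \<beta> \<mu> inv f])
      have "\<bar>f 0 - integral\<^sup>L \<mu> f\<bar> = \<bar>\<integral>x. f 0 - f x \<partial>\<mu>\<bar>" using int prob_space by simp
      also have "\<dots> \<le> (\<integral>x. \<bar>f 0 - f x\<bar> \<partial>\<mu>)" by (rule integral_abs_bound)
      also have "\<dots> \<le> (\<integral>x. x \<partial>\<mu>)"
      proof (rule integral_mono)
        fix x assume "x \<in> space \<mu>"
        then have x: "x \<in> {0..1}" by (simp add: space_mu[OF \<mu>])
        show "\<bar>f 0 - f x\<bar> \<le> x" using lipschitz_le[OF f _ x, of 0] x by simp
      qed (use int int_id in auto)
      finally show ?thesis using True by simp
    qed
    obtain e r and A :: real where e: "expansion \<beta> e r"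
      "(\<lambda>N. (\<Sum>i<N. real_of_int (e i)) / real N) \<longlonglongrightarrow> A" "A \<noteq> 0"
      using periodic_expansion by blast
    show ?thesis
    proof (rule reduce[OF e _ zero_expansion])
      show "zone = zone \<or> zone = (\<lambda>x. - zone x)" by simp
      show "mask e (zone x) i = 0" if "i \<notin> zone x" for x i using that by (simp add: mask_def)
      fix f :: "real \<Rightarrow> real" assume f: "1-lipschitz_on {0..1} f"
      have "\<forall>\<^sub>F N in sequentially. f 0 = (\<Sum>i<N. f 0) / real N"
        unfolding eventually_sequentially by (intro exI[of _ 1]) auto
      from Lim_transform_eventually[OF tendsto_const this]
      show "(\<lambda>N. (\<Sum>i<N. f 0) / real N) \<longlonglongrightarrow> integral\<^sup>L \<mu> f" by (simp only: f0[OF f])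
    qed
  qed
qed

text \<open>The average digit is a finite linear combination of the frequencies of single digits,
  that is, of blocks of length one.\<close>

lemma regular_digit_average:
  assumes y: "expansion \<beta> D y" and reg: "\<not> irregular_expansion \<beta> (y 0)"
  shows "convergent (\<lambda>N. (\<Sum>i<N. real_of_int (D i)) / real N)"
proof -
  let ?c = "\<lambda>a N. card {i \<in> {1..N}. map (beta_digit \<beta> (y 0)) [i..<i + length [a]] = [a]}"
  have conv: "convergent (\<lambda>N. real (?c a N) / real N)" if "a \<in> {0..\<lfloor>\<beta>\<rfloor>}" for a
  proof -
    have "[a] \<noteq> [] \<and> set [a] \<subseteq> {0..\<lfloor>\<beta>\<rfloor>}" using that by simp
    then show ?thesis using reg unfolding irregular_expansion_def by blast
  qed
  have card: "real (?c a N) = (\<Sum>i<N. if D i = a then 1 else 0)" for a N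
  proof -
    have "{i \<in> {1..N}. map (beta_digit \<beta> (y 0)) [i..<i + length [a]] = [a]} = Suc ` {i \<in> {..<N}. D i = a}"
    proof (intro set_eqI iffI)
      fix i assume i: "i \<in> {i \<in> {1..N}. map (beta_digit \<beta> (y 0)) [i..<i + length [a]] = [a]}"
      then obtain j where "i = Suc j" by (cases i) auto
      then show "i \<in> Suc ` {i \<in> {..<N}. D i = a}" using i by (auto simp: expansion_digit[OF y])
    qed (auto simp: expansion_digit[OF y])
    then have "?c a N = card {i \<in> {..<N}. D i = a}" by (simp add: card_image)
    then show ?thesis by (simp add: sum.If_cases Int_def)
  qed
  have "real_of_int (D i) = (\<Sum>a\<in>{0..\<lfloor>\<beta>\<rfloor>}. real_of_int a * (if D i = a then 1 else 0))" for i
  proof -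
    have "D i \<in> {0..\<lfloor>\<beta>\<rfloor>}" using expansion_nonneg[OF \<beta> y, of i] expansion_le[OF \<beta> y, of i] by (simp add: le_floor_iff)
    then show ?thesis by (simp add: if_distrib cong: if_cong)
  qed
  then have "(\<Sum>i<N. real_of_int (D i)) = (\<Sum>a\<in>{0..\<lfloor>\<beta>\<rfloor>}. real_of_int a * real (?c a N))" for N
    unfolding card sum_distrib_left by (subst sum.swap) simp
  then have "(\<Sum>i<N. real_of_int (D i)) / real N = (\<Sum>a\<in>{0..\<lfloor>\<beta>\<rfloor>}. real_of_int a * (real (?c a N) / real N))" for N
    by (simp add: sum_divide_distrib)
  moreover have "convergent (\<lambda>N. \<Sum>a\<in>{0..\<lfloor>\<beta>\<rfloor>}. real_of_int a * (real (?c a N) / real N))"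
    by (intro convergent_sum convergent_mult convergent_const conv)
  ultimately show ?thesis by (simp only:)
qed

text \<open>Each nonzero digit spoils at most \<open>length w\<close> windows of that length, so the
  windows that are not all zero have density 0. The all-zero block has frequency 1, any other block
  frequency 0.\<close>

lemma sparse_regular:
  assumes y: "expansion \<beta> D y"
    and sparse: "(\<lambda>N. real (card {i. i < N \<and> D i \<noteq> 0}) / real N) \<longlonglongrightarrow> 0"
  shows "\<not> irregular_expansion \<beta> (y 0)"
proof -
  have "convergent (\<lambda>N. real (card {i \<in> {1..N}. map (beta_digit \<beta> (y 0)) [i..<i + length w] = w}) / real N)"
    for w :: "int list"
  proof -
    let ?d = "beta_digit \<beta> (y 0)" and ?k = "length w"
    define bad where "bad N = {i \<in> {1..N}. map ?d [i..<i + ?k] \<noteq> replicate ?k 0}" for N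
    have "card (bad N) \<le> ?k * (card {i. i < N \<and> D i \<noteq> 0} + ?k)" for N
    proof -
      \<comment> \<open>Windows are numbered from 1 and \<open>D\<close> from 0: a nonzero digit at
        index \<open>i\<close> of \<open>D\<close> seen at offset \<open>j\<close> belongs to the
        window starting at \<open>Suc i - j\<close>. The last windows reach up to
        \<open>length w\<close> positions past \<open>N\<close>.\<close>
      have "bad N \<subseteq> (\<Union>j<?k. (\<lambda>i. Suc i - j) ` {i. i < N + ?k \<and> D i \<noteq> 0})"
      proof
        fix i assume i: "i \<in> bad N"
        have "\<exists>j<?k. ?d (i + j) \<noteq> 0"
        proof (rule ccontr)
          assume "\<not> (\<exists>j<?k. ?d (i + j) \<noteq> 0)"
          then have "map ?d [i..<i + ?k] = replicate ?k 0" by (intro nth_equalityI) simp_all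
          then show False using i by (simp add: bad_def)
        qed
        then obtain j where j: "j < ?k" "?d (i + j) \<noteq> 0" by blast
        obtain i' where i': "i = Suc i'" using i by (cases i) (auto simp: bad_def)
        have "D (i' + j) \<noteq> 0" using j(2) by (simp add: i' expansion_digit[OF y])
        moreover have "i' + j < N + ?k" using i j(1) by (simp add: bad_def i')
        ultimately show "i \<in> (\<Union>j<?k. (\<lambda>i. Suc i - j) ` {i. i < N + ?k \<and> D i \<noteq> 0})"
          using j(1) by (auto simp: i' intro!: bexI[of _ j] image_eqI[of _ _ "i' + j"])
      qed
      then have "card (bad N) \<le> card (\<Union>j<?k. (\<lambda>i. Suc i - j) ` {i. i < N + ?k \<and> D i \<noteq> 0})"
        by (intro card_mono) auto
      also have "\<dots> \<le> (\<Sum>j<?k. card ((\<lambda>i. Suc i - j) ` {i. i < N + ?k \<and> D i \<noteq> 0}))"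
        by (rule card_UN_le) simp
      also have "\<dots> \<le> (\<Sum>j<?k. card {i. i < N \<and> D i \<noteq> 0} + ?k)"
      proof (rule sum_mono)
        fix j
        have "card ((\<lambda>i. Suc i - j) ` {i. i < N + ?k \<and> D i \<noteq> 0}) \<le> card {i. i < N + ?k \<and> D i \<noteq> 0}"
          by (rule card_image_le) simp
        also have "\<dots> \<le> card ({i. i < N \<and> D i \<noteq> 0} \<union> {N..<N + ?k})" by (intro card_mono) auto
        also have "\<dots> \<le> card {i. i < N \<and> D i \<noteq> 0} + card {N..<N + ?k}" by (rule card_Un_le)
        finally show "card ((\<lambda>i. Suc i - j) ` {i. i < N + ?k \<and> D i \<noteq> 0}) \<le> card {i. i < N \<and> D i \<noteq> 0} + ?k"
          by simp
      qed
      also have "\<dots> = ?k * (card {i. i < N \<and> D i \<noteq> 0} + ?k)" by simp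
      finally show ?thesis .
    qed
    then have bad_le: "real (card (bad N)) / real N \<le> real ?k * (real (card {i. i < N \<and> D i \<noteq> 0}) / real N + real ?k / real N)" for N
    proof -
      have "real (card (bad N)) \<le> real (?k * (card {i. i < N \<and> D i \<noteq> 0} + ?k))"
        using \<open>card (bad N) \<le> _\<close> by (rule of_nat_mono)
      then have "real (card (bad N)) / real N \<le> real (?k * (card {i. i < N \<and> D i \<noteq> 0} + ?k)) / real N"
        by (rule divide_right_mono) simp
      then show ?thesis by (simp add: add_divide_distrib[symmetric])
    qed
    have "(\<lambda>N. real ?k * (real (card {i. i < N \<and> D i \<noteq> 0}) / real N + real ?k / real N)) \<longlonglongrightarrow> real ?k * (0 + 0)"
      by (intro tendsto_intros sparse lim_const_over_n)
    then have bad0: "(\<lambda>N. real (card (bad N)) / real N) \<longlonglongrightarrow> 0"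
      by (intro tendsto_zero_sandwich[OF _ bad_le]) simp_all
    show ?thesis
    proof (cases "w = replicate ?k 0")
      case True
      have "real (card {i \<in> {1..N}. map ?d [i..<i + ?k] = w}) / real N = 1 - real (card (bad N)) / real N"
        if "N \<ge> 1" for N
      proof -
        have "{i \<in> {1..N}. map ?d [i..<i + ?k] = w} = {1..N} - bad N"
          using True by (auto simp: bad_def)
        moreover have sub: "bad N \<subseteq> {1..N}" by (auto simp: bad_def)
        ultimately have "card {i \<in> {1..N}. map ?d [i..<i + ?k] = w} = N - card (bad N)"
          by (simp add: card_Diff_subset finite_subset[OF sub])
        moreover have "card (bad N) \<le> N" using card_mono[OF _ sub] by simp
        ultimately show ?thesis using that by (simp add: of_nat_diff diff_divide_distrib)
      qed
      then have "\<forall>\<^sub>F N in sequentially. 1 - real (card (bad N)) / real N =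
          real (card {i \<in> {1..N}. map ?d [i..<i + ?k] = w}) / real N"
        unfolding eventually_sequentially by (intro exI[of _ 1]) auto
      from Lim_transform_eventually[OF tendsto_diff[OF tendsto_const bad0] this]
      show ?thesis by (auto simp: convergent_def)
    next
      case False
      have "card {i \<in> {1..N}. map ?d [i..<i + ?k] = w} \<le> card (bad N)" for N
        using False by (intro card_mono) (auto simp: bad_def)
      then have "(\<lambda>N. real (card {i \<in> {1..N}. map ?d [i..<i + ?k] = w}) / real N) \<longlonglongrightarrow> 0"
        by (intro tendsto_zero_sandwich[OF _ _ bad0] divide_right_mono) auto
      then show ?thesis by (auto simp: convergent_def)
    qed
  qed
  then show ?thesis by (simp add: irregular_expansion_def)
qed

text \<open>The reduction for the point mass at 0 works again: finite rows leave nonzero digits of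
  density 0, hence a regular expansion, and a regular expansion has a convergent average
  digit.\<close>

lemma regular_set_not_Sigma03:
  "{x \<in> {0..1}. \<not> irregular_expansion \<beta> x} \<notin> Sigma0 unit_top 3"
proof -
  obtain e r and A :: real where e: "expansion \<beta> e r"
    and avg: "(\<lambda>N. (\<Sum>i<N. real_of_int (e i)) / real N) \<longlonglongrightarrow> A" "A \<noteq> 0"
    using periodic_expansion by blast
  show ?thesis
  proof (rule mask_not_Sigma03[OF e avg, of zone])
    fix x
    note m = expansion_mask[OF \<beta> e, of "zone x"]
    show "\<not> irregular_expansion \<beta> (mask_point \<beta> e (zone x) 0)" if fin: "\<And>m. finite {k. x k \<and> stage_row k = m}"
    proof (rule sparse_regular[OF m])
      have "card {i. i < N \<and> mask e (zone x) i \<noteq> 0} \<le> card (zone x \<inter> {..<N})" for N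
        by (intro card_mono) (auto simp: mask_def)
      then show "(\<lambda>N. real (card {i. i < N \<and> mask e (zone x) i \<noteq> 0}) / real N) \<longlonglongrightarrow> 0"
        by (intro tendsto_zero_sandwich[OF _ _ zone_density[OF fin]] divide_right_mono) auto
    qed
    assume "\<not> irregular_expansion \<beta> (mask_point \<beta> e (zone x) 0)"
    then show "convergent (\<lambda>N. (\<Sum>i<N. real_of_int (mask e (zone x) i)) / real N)"
      by (rule regular_digit_average[OF m])
  qed simp
qed

end

theorem theorem15:
  fixes \<beta> :: real
  assumes "\<beta> > 1"
  shows "(\<forall>\<mu>. borel_prob_unit \<mu> \<and> beta_invariant \<beta> \<mu> \<longrightarrow>
            Pi03_complete unit_top {x \<in> {0..1}. generates \<beta> \<mu> x})
       \<and> Sigma03_complete unit_top {x \<in> {0..1}. irregular_expansion \<beta> x}"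
proof (intro conjI allI impI, elim conjE)
  fix \<mu> assume "borel_prob_unit \<mu>" "beta_invariant \<beta> \<mu>"
  then show "Pi03_complete unit_top {x \<in> {0..1}. generates \<beta> \<mu> x}"
    unfolding Pi03_complete_def
    using generating_set_Pi03[OF assms] generating_set_not_Sigma03[OF assms] by blast
next
  let ?I = "{x \<in> {0..1}. irregular_expansion \<beta> x}" and ?R = "{x \<in> {0..1}. \<not> irregular_expansion \<beta> x}"
  have compl: "?I = {0..1} - ?R" "?R = {0..1} - ?I" by auto
  \<comment> \<open>Complementation within the unit interval is an involution only on its subsets;
    this bound permits passing between the irregular points and their complement.\<close>
  have sub: "S \<subseteq> {0..1}" if "S \<in> Sigma0 unit_top 3" for S
    using that by (auto simp: numeral_3_eq_3)
  obtain S where S: "?R = {0..1} - S" "S \<in> Sigma0 unit_top 3"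
    using regular_set_Pi03[OF assms] by (auto simp: Pi0_def)
  have "?I = S" using compl(1) S sub[OF S(2)] by blast
  then have "?I \<in> Sigma0 unit_top 3" using S(2) by simp
  moreover have "?I \<notin> Pi0 unit_top 3"
  proof
    assume "?I \<in> Pi0 unit_top 3"
    then obtain S' where S': "?I = {0..1} - S'" "S' \<in> Sigma0 unit_top 3" by (auto simp: Pi0_def)
    have "?R = S'" using compl(2) S' sub[OF S'(2)] by blast
    then show False using regular_set_not_Sigma03[OF assms] S'(2) by simp
  qed
  ultimately show "Sigma03_complete unit_top ?I" by (simp add: Sigma03_complete_def)
qed

end
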